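(* Let $\nu$ be a finite positive Borel measure on $\mathbb{D}$, and let $\mu=\sum_{j=1}^n\alpha_j\delta_{\lambda_j}$, where $n\ge1$, $\lambda_j\in\mathbb{T}$ and $\alpha_j>0$ for $1\le j\le n$. Then $\nu$ is a Carleson measure for $\mathcal{D}(\mu)$ if and only if there exists a constant $C>0$ such that $$\int_{\mathbb{D}}|k_w^\mu|^2\,d\nu\le C\,\|k_w^\mu\|_\mu^2\qquad\text{for every } w\in\mathbb{D},$$ where $k_w^\mu$ is the reproducing kernel of $\mathcal{D}(\mu)$ at $w$.
   Context: $\mathbb{D}=\{z\in\mathbb{C}:|z|<1\}$ and $\mathbb{T}$ is the unit circle; $\delta_\lambda$ is the unit point mass at $\lambda$. $H^2$ is the Hardy space of analytic functions $f(z)=\sum_{k\ge0}a_kz^k$ on $\mathbb{D}$ with $\|f\|_2^2=\sum_{k\ge0}|a_k|^2<\infty$. For a positive finite Borel measure $\mu$ on $\mathbb{T}$, put $P_\mu(z)=\int_{\mathbb{T}}\frac{1-|z|^2}{|\zeta-z|^2}\,d\mu(\zeta)$ for $z\in\mathbb{D}$. The Dirichlet-type space $\mathcal{D}(\mu)$ is the set of holomorphic functions $f$ on $\mathbb{D}$ with $\mathcal{D}_\mu(f):=\int_{\mathbb{D}}|f'(z)|^2P_\mu(z)\,dA(z)<\infty$, where $dA$ is normalized area measure on $\mathbb{D}$. One has $\mathcal{D}(\mu)\subset H^2$, and $\mathcal{D}(\mu)$ is a Hilbert space with norm $\|f\|_\mu^2=\|f\|_2^2+\mathcal{D}_\mu(f)$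 and corresponding inner product $\langle\cdot,\cdot\rangle_\mu$. Point evaluations at $w\in\mathbb{D}$ are bounded on $\mathcal{D}(\mu)$; $k_w^\mu\in\mathcal{D}(\mu)$ is the element with $f(w)=\langle f,k_w^\mu\rangle_\mu$ for all $f\in\mathcal{D}(\mu)$. A positive Borel measure $\nu$ on $\mathbb{D}$ is a Carleson measure for $\mathcal{D}(\mu)$ if there is a constant $C>0$ with $\int_{\mathbb{D}}|f|^2\,d\nu\le C\|f\|_\mu^2$ for all $f\in\mathcal{D}(\mu)$. *)

theory Defs
  imports "HOL-Complex_Analysis.Complex_Analysis" "HOL-Probability.Probability"
begin

text \<open>
  Functions on the disc are represented by total functions of type
  \<^typ>\<open>complex \<Rightarrow> complex\<close>; every notion below depends only on their values in the disc.
  Squared norms take values in \<^typ>\<open>ennreal\<close>, so that they are meaningful for all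
  holomorphic functions.
\<close>

abbreviation unit_disc :: "complex set" where
  "unit_disc \<equiv> ball 0 1"

abbreviation disc_borel :: "complex measure" where
  "disc_borel \<equiv> restrict_space borel unit_disc"

abbreviation circle_borel :: "complex measure" where
  "circle_borel \<equiv> restrict_space borel (sphere 0 1)"

definition disc_area :: "complex measure" where
  "disc_area = density (restrict_space lborel unit_disc) (\<lambda>_. ennreal (1 / pi))"

definition atomic_circle_measure ::
    "nat \<Rightarrow> (nat \<Rightarrow> real) \<Rightarrow> (nat \<Rightarrow> complex) \<Rightarrow> complex measure" where
  "atomic_circle_measure n \<alpha> lam =
     measure_of (space circle_borel) (sets circle_borel)
       (\<lambda>A. \<Sum>j=1..n. ennreal (\<alpha> j) * emeasure (return circle_borel (lam j)) A)"

lemma sets_atomic_circle_measure [simp]: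
  "sets (atomic_circle_measure n \<alpha> lam) = sets circle_borel"
  unfolding atomic_circle_measure_def
  by (simp only: sets.sets_measure_of_eq)

lemma emeasure_atomic_circle_measure:
  assumes "A \<in> sets circle_borel"
  shows "emeasure (atomic_circle_measure n \<alpha> lam) A =
           (\<Sum>j=1..n. ennreal (\<alpha> j) * emeasure (return circle_borel (lam j)) A)"
proof (rule emeasure_measure_of[OF atomic_circle_measure_def])
  show "sets circle_borel \<subseteq> Pow (space circle_borel)"
    by (rule sets.space_closed)
  show "A \<in> sets (atomic_circle_measure n \<alpha> lam)"
    using assms by simp
  show "positive (sets (atomic_circle_measure n \<alpha> lam))
     (\<lambda>A. \<Sum>j=1..n. ennreal (\<alpha> j) * emeasure (return circle_borel (lam j)) A)"
    by (simp add: positive_def)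
  show "countably_additive (sets (atomic_circle_measure n \<alpha> lam))
     (\<lambda>A. \<Sum>j=1..n. ennreal (\<alpha> j) * emeasure (return circle_borel (lam j)) A)"
  proof (rule countably_additiveI)
    fix F :: "nat \<Rightarrow> complex set"
    assume F: "range F \<subseteq> sets (atomic_circle_measure n \<alpha> lam)" "disjoint_family F"
    have "(\<Sum>i. \<Sum>j=1..n. ennreal (\<alpha> j) * emeasure (return circle_borel (lam j)) (F i)) =
          (\<Sum>j=1..n. \<Sum>i. ennreal (\<alpha> j) * emeasure (return circle_borel (lam j)) (F i))"
      by (rule suminf_sum) simp
    also have "\<dots> = (\<Sum>j=1..n. ennreal (\<alpha> j) *
                       emeasure (return circle_borel (lam j)) (\<Union>i. F i))"
    proof (intro sum.cong refl)
      fix j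
      have "(\<Sum>i. emeasure (return circle_borel (lam j)) (F i)) =
              emeasure (return circle_borel (lam j)) (\<Union>i. F i)"
        using F by (intro suminf_emeasure) (simp_all only: sets_return sets_atomic_circle_measure)
      then show "(\<Sum>i. ennreal (\<alpha> j) * emeasure (return circle_borel (lam j)) (F i)) =
              ennreal (\<alpha> j) * emeasure (return circle_borel (lam j)) (\<Union>i. F i)"
        by (simp only: ennreal_suminf_cmult)
    qed
    finally show "(\<Sum>i. \<Sum>j=1..n. ennreal (\<alpha> j) *
                      emeasure (return circle_borel (lam j)) (F i)) =
        (\<Sum>j=1..n. ennreal (\<alpha> j) * emeasure (return circle_borel (lam j)) (\<Union>i. F i))" .
  qed
qed

definition poisson :: "complex measure \<Rightarrow> complex \<Rightarrow> real" where
  "poisson \<mu> z = (\<integral>\<zeta>. (1 - (cmod z)\<^sup>2) / (cmod (\<zeta> - z))\<^sup>2 \<partial>\<mu>)"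

definition dirichlet_integral :: "complex measure \<Rightarrow> (complex \<Rightarrow> complex) \<Rightarrow> ennreal" where
  "dirichlet_integral \<mu> f =
     (\<integral>\<^sup>+z. ennreal ((cmod (deriv f z))\<^sup>2 * poisson \<mu> z) \<partial>disc_area)"

definition dirichlet_space :: "complex measure \<Rightarrow> (complex \<Rightarrow> complex) set" where
  "dirichlet_space \<mu> = {f. f holomorphic_on unit_disc \<and> dirichlet_integral \<mu> f < \<infinity>}"

definition taylor_coeff :: "(complex \<Rightarrow> complex) \<Rightarrow> nat \<Rightarrow> complex" where
  "taylor_coeff f k = (deriv ^^ k) f 0 / fact k"

definition hardy_norm_sq :: "(complex \<Rightarrow> complex) \<Rightarrow> ennreal" where
  "hardy_norm_sq f = (\<Sum>k. ennreal ((cmod (taylor_coeff f k))\<^sup>2))"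

definition dirichlet_norm_sq :: "complex measure \<Rightarrow> (complex \<Rightarrow> complex) \<Rightarrow> ennreal" where
  "dirichlet_norm_sq \<mu> f = hardy_norm_sq f + dirichlet_integral \<mu> f"

definition dirichlet_inner ::
    "complex measure \<Rightarrow> (complex \<Rightarrow> complex) \<Rightarrow> (complex \<Rightarrow> complex) \<Rightarrow> complex" where
  "dirichlet_inner \<mu> f g =
     (\<Sum>k. taylor_coeff f k * cnj (taylor_coeff g k)) +
     (\<integral>z. deriv f z * cnj (deriv g z) * of_real (poisson \<mu> z) \<partial>disc_area)"

text \<open>The reproducing property determines the kernel on the disc; its values elsewhere
  are left unspecified.\<close>

definition repr_kernel :: "complex measure \<Rightarrow> complex \<Rightarrow> complex \<Rightarrow> complex" where
  "repr_kernel \<mu> w =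
     (SOME k. k \<in> dirichlet_space \<mu> \<and> (\<forall>f\<in>dirichlet_space \<mu>. f w = dirichlet_inner \<mu> f k))"

definition carleson_measure :: "complex measure \<Rightarrow> complex measure \<Rightarrow> bool" where
  "carleson_measure \<mu> \<nu> \<longleftrightarrow>
     (\<exists>C::real. C > 0 \<and>
        (\<forall>f\<in>dirichlet_space \<mu>.
           (\<integral>\<^sup>+z. ennreal ((cmod (f z))\<^sup>2) \<partial>\<nu>) \<le> ennreal C * dirichlet_norm_sq \<mu> f))"

end

theory Submission
  imports Defs
begin

text \<open>
  A function \<open>f\<close> has finite local Dirichlet integral at \<open>\<lambda>\<close> iff \<open>f = c + (z - \<lambda>) g\<close> with \<open>g\<close> in the Hardy
  space, and then the integral is the squared Hardy norm of \<open>g\<close>: the Taylor coefficients of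
  \<open>f' / (\<lambda> - z)\<close> are weighted differences of the averages of the (rotated) coefficients of \<open>g\<close>, and the
  two norms agree by a telescoping identity. Let \<open>p\<close> be the polynomial with simple zeros at the atoms,
  \<open>p\<^sub>\<lambda> = p / (z - \<lambda>)\<close> and \<open>W = \<bar>p\<bar>\<^sup>2 + \<Sum> a\<^sub>\<lambda> \<bar>p\<^sub>\<lambda>\<bar>\<^sup>2\<close>, which is positive on the closed disc. Up to an error
  that is bounded in norm uniformly in \<open>w\<close>, the reproducing kernel at \<open>w\<close> is
  \<open>cnj (p w) / W w\<close> times \<open>p\<close> times the Szego kernel.

  Hence the kernel condition nearly gives the kernel test for the embedding of the Hardy space with
  respect to \<open>\<bar>p\<bar>\<^sup>2 \<nu>\<close>, and by the Vinogradov--Senichkin argument the embedding itself, with linear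
  dependence of the constants. Multiplying \<open>f\<close> by \<open>W\<close> turns this into the Carleson embedding of the
  Dirichlet-type space. The error term is absorbed by a bootstrap: for the truncations of \<open>\<nu>\<close> to smaller
  discs, where some embedding constant \<open>A\<close> exists, the argument yields the constant \<open>c + A / 2\<close>.
\<close>

section \<open>Semi-inner products and the Hardy space\<close>

text \<open>Origin of the factor in the approximate kernel: pair
  \<open>f = c l + (z - l) g l\<close> with \<open>p\<close> times the Szego kernel at
  \<open>w\<close>. With the polynomials frozen at \<open>w\<close>, the Hardy part yields
  \<open>cnj (p w) f(w)\<close> and the atom \<open>l\<close> yields
  \<open>a l cnj (pl l w) g l w\<close>. Multiplied by \<open>p w\<close>, this is
  \<open>W w f(w)\<close> minus the terms \<open>a l |pl l w|^2 c l\<close>; the \<open>c l\<close>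
  are bounded functionals of \<open>f\<close> and go into the error.

  The obstacle is that the error is bounded but not small. In the kernel test it is multiplied by
  \<open>(1 - |w|^2) / |p w|^2\<close> up to constants, so it is harmless only where
  \<open>|p w|^2 >= M (1 - |w|^2)\<close>. In the remaining region, comparable near an atom to a
  horodisc, the test integral is bounded by the total mass, since \<open>p\<close> is Lipschitz and
  \<open>|z - w| <= |1 - z cnj w|\<close>. Elsewhere the error is a function of bounded norm, so its
  integral is at most a multiple of the unknown embedding constant \<open>A\<close>. Hence the
  truncations, which make \<open>A\<close> finite, and the need for a test theorem with linear
  dependence on its constant.\<close>

locale semi_inner_space =
  fixes V :: "(complex \<Rightarrow> complex) set"
    and B :: "(complex \<Rightarrow> complex) \<Rightarrow> (complex \<Rightarrow> complex) \<Rightarrow> complex"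
  assumes mem_add: "\<lbrakk>f \<in> V; g \<in> V\<rbrakk> \<Longrightarrow> (\<lambda>z. f z + g z) \<in> V"
    and mem_cmult: "f \<in> V \<Longrightarrow> (\<lambda>z. c * f z) \<in> V"
    and inner_add_left: "\<lbrakk>f \<in> V; g \<in> V; h \<in> V\<rbrakk> \<Longrightarrow> B (\<lambda>z. f z + g z) h = B f h + B g h"
    and inner_cmult_left: "\<lbrakk>f \<in> V; h \<in> V\<rbrakk> \<Longrightarrow> B (\<lambda>z. c * f z) h = c * B f h"
    and inner_commute: "\<lbrakk>f \<in> V; h \<in> V\<rbrakk> \<Longrightarrow> B h f = cnj (B f h)"
    and inner_ge_0: "f \<in> V \<Longrightarrow> 0 \<le> Re (B f f)"
begin

definition sqnorm :: "(complex \<Rightarrow> complex) \<Rightarrow> real" where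
  "sqnorm f = Re (B f f)"

lemma sqnorm_nonneg: "f \<in> V \<Longrightarrow> 0 \<le> sqnorm f"
  by (simp add: sqnorm_def inner_ge_0)

lemma inner_self: "f \<in> V \<Longrightarrow> B f f = of_real (sqnorm f)"
  using inner_commute[of f f] by (simp add: sqnorm_def complex_eq_iff)

lemma mem_diff: "\<lbrakk>f \<in> V; g \<in> V\<rbrakk> \<Longrightarrow> (\<lambda>z. f z - g z) \<in> V"
  using mem_add[OF _ mem_cmult, of f g "-1"] by simp

lemma inner_add_right:
  assumes "f \<in> V" "g \<in> V" "h \<in> V"
  shows "B h (\<lambda>z. f z + g z) = B h f + B h g"
  using inner_add_left[OF assms] inner_commute[of h f] inner_commute[of h g]
    inner_commute[of h "\<lambda>z. f z + g z"] assms mem_add[of f g]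
  by (metis complex_cnj_add complex_cnj_cnj)

lemma inner_cmult_right:
  assumes "f \<in> V" "h \<in> V"
  shows "B h (\<lambda>z. c * f z) = cnj c * B h f"
  using inner_cmult_left[OF assms] inner_commute[of h f] 
    inner_commute[of h "\<lambda>z. c * f z"] assms mem_cmult[of f c]
  by (metis complex_cnj_mult complex_cnj_cnj)

lemma inner_diff_left:
  assumes "f \<in> V" "g \<in> V" "h \<in> V"
  shows "B (\<lambda>z. f z - g z) h = B f h - B g h"
  using inner_add_left[OF assms(1) mem_cmult[OF assms(2), of "-1"] assms(3)]
    inner_cmult_left[of g h "-1"] assms by simp

lemma inner_diff_right:
  assumes "f \<in> V" "g \<in> V" "h \<in> V"
  shows "B h (\<lambda>z. f z - g z) = B h f - B h g"
  using inner_add_right[OF assms(1) mem_cmult[OF assms(2), of "-1"] assms(3)]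
    inner_cmult_right[of g h "-1"] assms by simp

lemma sqnorm_add:
  assumes "f \<in> V" "g \<in> V"
  shows "sqnorm (\<lambda>z. f z + g z) = sqnorm f + sqnorm g + 2 * Re (B f g)"
  using assms mem_add[OF assms] inner_commute[OF assms]
  by (simp add: sqnorm_def inner_add_left inner_add_right)

lemma sqnorm_cmult:
  assumes "f \<in> V"
  shows "sqnorm (\<lambda>z. c * f z) = (cmod c)\<^sup>2 * sqnorm f"
proof -
  have "B (\<lambda>z. c * f z) (\<lambda>z. c * f z) = c * (cnj c * B f f)"
    using assms mem_cmult[OF assms] by (simp add: inner_cmult_left inner_cmult_right)
  also have "\<dots> = of_real ((cmod c)\<^sup>2) * of_real (sqnorm f)"
    by (simp add: inner_self[OF assms] complex_norm_square[symmetric] mult.assoc[symmetric])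
  finally show ?thesis by (simp add: sqnorm_def)
qed

lemma sqnorm_diff_scaled:
  assumes "f \<in> V" "g \<in> V"
  shows "sqnorm (\<lambda>z. f z - c * g z) = sqnorm f + (cmod c)\<^sup>2 * sqnorm g - 2 * Re (cnj c * B f g)"
proof -
  have "(\<lambda>z. f z - c * g z) = (\<lambda>z. f z + (-c) * g z)" by auto
  then show ?thesis
    using sqnorm_add[OF assms(1) mem_cmult[OF assms(2), of "-c"]] sqnorm_cmult[OF assms(2), of "-c"]
      inner_cmult_right[OF assms(2,1), of "-c"] by simp
qed

text \<open>The case \<open>sqnorm g = 0\<close> needs its own argument because the form is only
  semidefinite: total functions that vanish on the disc need not be zero, and the energy form also
  kills constants.\<close>

lemma Cauchy_Schwarz:
  assumes "f \<in> V" "g \<in> V"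
  shows "(cmod (B f g))\<^sup>2 \<le> sqnorm f * sqnorm g"
proof (cases "sqnorm g = 0")
  case False
  then have pos: "sqnorm g > 0" using sqnorm_nonneg[OF assms(2)] by simp
  let ?b = "B f g" and ?G = "sqnorm g"
  \<comment> \<open>Coefficient of the orthogonal projection of \<open>f\<close> onto
    \<open>g\<close>.\<close>
  let ?c = "?b / of_real ?G"
  have "0 \<le> sqnorm (\<lambda>z. f z - ?c * g z)"
    by (intro sqnorm_nonneg mem_diff mem_cmult assms)
  also have "\<dots> = sqnorm f + (cmod ?b / ?G)\<^sup>2 * ?G - 2 * ((cmod ?b)\<^sup>2 / ?G)"
  proof -
    have "cnj ?c * ?b = of_real ((cmod ?b)\<^sup>2 / ?G)"
      using complex_norm_square[of ?b] by (simp add: mult.commute)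
    then have "Re (cnj ?c * ?b) = (cmod ?b)\<^sup>2 / ?G" by (metis Re_complex_of_real)
    then show ?thesis
      unfolding sqnorm_diff_scaled[OF assms] using pos by (simp add: norm_divide)
  qed
  also have "(cmod ?b / ?G)\<^sup>2 * ?G = (cmod ?b)\<^sup>2 / ?G"
    using pos by (simp add: power2_eq_square)
  finally have "(cmod ?b)\<^sup>2 / ?G \<le> sqnorm f" by simp
  then show ?thesis using pos by (simp add: field_simps)
next
  case True
  have "B f g = 0"
  proof (rule ccontr)
    assume nz: "B f g \<noteq> 0"
    \<comment> \<open>When \<open>sqnorm g = 0\<close>, the squared norm of
      \<open>f - t B(f,g) g\<close> is affine in \<open>t\<close>; this \<open>t\<close> makes it
      \<open>-1\<close>.\<close>
    define t where "t = (sqnorm f + 1) / (2 * (cmod (B f g))\<^sup>2)"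
    have "0 \<le> sqnorm (\<lambda>z. f z - of_real t * B f g * g z)"
      using mem_diff[OF assms(1) mem_cmult[OF assms(2), of "of_real t * B f g"]]
      by (intro sqnorm_nonneg) simp
    also have "\<dots> = sqnorm f - 2 * Re (cnj (of_real t * B f g) * B f g)"
      using sqnorm_diff_scaled[OF assms, of "of_real t * B f g"] True by simp
    also have "cnj (of_real t * B f g) * B f g = of_real (t * (cmod (B f g))\<^sup>2)"
      by (simp only: of_real_mult complex_norm_square) simp
    also have "sqnorm f - 2 * Re (of_real (t * (cmod (B f g))\<^sup>2)) = -1"
      using nz by (simp add: t_def field_simps)
    finally show False by simp
  qed
  then show ?thesis using True by simp
qed

lemma sqnorm_add_le:
  assumes "f \<in> V" "g \<in> V"
  shows "sqnorm (\<lambda>z. f z + g z) \<le> 2 * sqnorm f + 2 * sqnorm g"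
proof -
  have "0 \<le> sqnorm (\<lambda>z. f z - 1 * g z)"
    using mem_diff[OF assms] by (simp add: sqnorm_nonneg)
  also have "\<dots> = sqnorm f + sqnorm g - 2 * Re (B f g)"
    by (subst sqnorm_diff_scaled[OF assms]) simp
  finally show ?thesis by (simp add: sqnorm_add[OF assms])
qed

end

lemma l2_prod_abs_le: "cmod (a * cnj b) \<le> ((cmod a)\<^sup>2 + (cmod b)\<^sup>2) / 2"
  using sum_squares_bound[of "cmod a" "cmod b"] by (simp add: norm_mult)

lemma cmod_add_squared_le: "(cmod (a + b))\<^sup>2 \<le> 2 * (cmod a)\<^sup>2 + 2 * (cmod b)\<^sup>2"
proof -
  have "(cmod (a + b))\<^sup>2 \<le> (cmod a + cmod b)\<^sup>2"
    by (intro power_mono norm_triangle_ineq) auto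
  also have "\<dots> \<le> 2 * (cmod a)\<^sup>2 + 2 * (cmod b)\<^sup>2"
    using sum_squares_bound[of "cmod a" "cmod b"] by (simp add: power2_sum)
  finally show ?thesis .
qed

lemma cmod_diff_squared_le: "(cmod (a - b))\<^sup>2 \<le> 2 * (cmod a)\<^sup>2 + 2 * (cmod b)\<^sup>2"
  using cmod_add_squared_le[of a "-b"] by simp

section \<open>Taylor coefficients on the unit disc\<close>

lemma taylor_sums:
  assumes "f holomorphic_on unit_disc" "cmod z < 1"
  shows "(\<lambda>k. taylor_coeff f k * z ^ k) sums f z"
  using holomorphic_power_series[OF assms(1), of z] assms(2) by (simp add: taylor_coeff_def)

text \<open>Uniqueness of power series serves as the computing device: most coefficient formulas
  below are obtained by exhibiting a series that converges to the function.\<close>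

lemma taylor_unique:
  assumes "\<And>z. cmod z < 1 \<Longrightarrow> (\<lambda>k. b k * z ^ k) sums f z"
  shows "f holomorphic_on unit_disc" "taylor_coeff f k = b k"
proof -
  show hol: "f holomorphic_on unit_disc"
    using power_series_holomorphic[of 0 1 b f] assms by simp
  have "f has_fps_expansion Abs_fps b"
  proof (rule has_fps_expansionI)
    have "\<forall>\<^sub>F z in nhds 0. (z::complex) \<in> ball 0 1"
      by (rule eventually_nhds_in_open) auto
    then show "\<forall>\<^sub>F z in nhds 0. (\<lambda>n. fps_nth (Abs_fps b) n * z ^ n) sums f z"
      by eventually_elim (use assms in auto)
  qed
  moreover have "f has_fps_expansion fps_expansion f 0"
    using hol by (intro has_fps_expansion_fps_expansion[of "unit_disc"]) auto
  ultimately have "fps_expansion f 0 = Abs_fps b"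
    using fps_expansion_unique_complex by blast
  then show "taylor_coeff f k = b k"
    by (simp add: taylor_coeff_def fps_eq_iff fps_expansion_def)
qed

lemma taylor_cong:
  assumes "f holomorphic_on unit_disc" "\<And>z. cmod z < 1 \<Longrightarrow> f z = g z"
  shows "taylor_coeff g k = taylor_coeff f k"
  using taylor_unique(2)[of "taylor_coeff f" g] taylor_sums[OF assms(1)] assms(2) by simp

lemma taylor_add:
  assumes "f holomorphic_on unit_disc" "g holomorphic_on unit_disc"
  shows "taylor_coeff (\<lambda>z. f z + g z) k = taylor_coeff f k + taylor_coeff g k"
  by (rule taylor_unique) (simp add: ring_distribs sums_add taylor_sums assms)

lemma taylor_cmult:
  assumes "f holomorphic_on unit_disc"
  shows "taylor_coeff (\<lambda>z. c * f z) k = c * taylor_coeff f k"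
  by (rule taylor_unique) (simp add: mult.assoc sums_mult taylor_sums assms)

lemma taylor_diff:
  assumes "f holomorphic_on unit_disc" "g holomorphic_on unit_disc"
  shows "taylor_coeff (\<lambda>z. f z - g z) k = taylor_coeff f k - taylor_coeff g k"
  by (rule taylor_unique) (simp add: ring_distribs sums_diff taylor_sums assms)

lemma taylor_mult_z:
  assumes "f holomorphic_on unit_disc"
  shows "taylor_coeff (\<lambda>z. z * f z) k = (case k of 0 \<Rightarrow> 0 | Suc j \<Rightarrow> taylor_coeff f j)"
proof (rule taylor_unique)
  fix z :: complex assume "cmod z < 1"
  from sums_mult[OF taylor_sums[OF assms this], of z]
  have "(\<lambda>k. taylor_coeff f k * z ^ Suc k) sums (z * f z)"
    by (simp add: mult_ac)
  then show "(\<lambda>k. (case k of 0 \<Rightarrow> 0 | Suc j \<Rightarrow> taylor_coeff f j) * z ^ k) sums (z * f z)"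
    by (subst sums_Suc_iff[of "\<lambda>k. (case k of 0 \<Rightarrow> 0 | Suc j \<Rightarrow> taylor_coeff f j) * z ^ k"
          "z * f z", simplified, symmetric]) simp
qed

lemma taylor_deriv: "taylor_coeff (deriv f) k = of_nat (Suc k) * taylor_coeff f (Suc k)"
  by (simp add: taylor_coeff_def funpow_swap1 divide_simps del: of_nat_Suc)

lemma taylor_0: "taylor_coeff f 0 = f 0"
  by (simp add: taylor_coeff_def)

lemma taylor_const: "taylor_coeff (\<lambda>_. c) k = (if k = 0 then c else 0)"
proof (rule taylor_unique)
  fix z :: complex
  have "(\<lambda>k. (if k = 0 then c else 0) * z ^ k) = (\<lambda>k. if k = 0 then c else 0)" by auto
  then show "(\<lambda>k. (if k = 0 then c else 0) * z ^ k) sums c"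
    using sums_single[of 0 "\<lambda>_. c"] by simp
qed

lemma taylor_eqD:
  assumes "f holomorphic_on unit_disc" "g holomorphic_on unit_disc" "taylor_coeff f = taylor_coeff g"
    and "cmod z < 1"
  shows "f z = g z"
  using sums_unique2 taylor_sums[OF assms(1,4)] taylor_sums[OF assms(2,4)] assms(3) by metis

section \<open>The Hardy space\<close>

definition H2 :: "(complex \<Rightarrow> complex) set" where
  "H2 = {f. f holomorphic_on unit_disc \<and> summable (\<lambda>k. (cmod (taylor_coeff f k))\<^sup>2)}"

definition H2_inner :: "(complex \<Rightarrow> complex) \<Rightarrow> (complex \<Rightarrow> complex) \<Rightarrow> complex" where
  "H2_inner f g = (\<Sum>k. taylor_coeff f k * cnj (taylor_coeff g k))"

lemma l2_summable_prod:
  fixes a b :: "nat \<Rightarrow> complex"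
  assumes "summable (\<lambda>k. (cmod (a k))\<^sup>2)" "summable (\<lambda>k. (cmod (b k))\<^sup>2)"
  shows "summable (\<lambda>k. a k * cnj (b k))"
proof (rule summable_comparison_test')
  show "summable (\<lambda>k. ((cmod (a k))\<^sup>2 + (cmod (b k))\<^sup>2) / 2)"
    by (intro summable_divide summable_add assms)
qed (rule l2_prod_abs_le)

lemma H2_inner_summable:
  "f \<in> H2 \<Longrightarrow> g \<in> H2 \<Longrightarrow> summable (\<lambda>k. taylor_coeff f k * cnj (taylor_coeff g k))"
  by (rule l2_summable_prod) (auto simp: H2_def)

lemma H2_add: 
  assumes "f \<in> H2" "g \<in> H2" shows "(\<lambda>z. f z + g z) \<in> H2"
proof -
  have "summable (\<lambda>k. (cmod (taylor_coeff f k + taylor_coeff g k))\<^sup>2)"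
  proof (rule summable_comparison_test')
    show "summable (\<lambda>k. 2 * (cmod (taylor_coeff f k))\<^sup>2 + 2 * (cmod (taylor_coeff g k))\<^sup>2)"
      using assms unfolding H2_def by (intro summable_add summable_mult) auto
  qed (simp add: cmod_add_squared_le)
  moreover have "(\<lambda>z. f z + g z) holomorphic_on unit_disc"
    using assms unfolding H2_def by (intro holomorphic_on_add) auto
  ultimately show ?thesis using assms by (simp add: H2_def taylor_add)
qed

lemma H2_cmult: "f \<in> H2 \<Longrightarrow> (\<lambda>z. c * f z) \<in> H2"
  by (simp add: H2_def taylor_cmult norm_mult power_mult_distrib holomorphic_on_mult summable_mult)

interpretation H2: semi_inner_space H2 H2_inner
proof
  fix f g h :: "complex \<Rightarrow> complex" and c :: complex
  show "f \<in> H2 \<Longrightarrow> g \<in> H2 \<Longrightarrow> (\<lambda>z. f z + g z) \<in> H2" by (rule H2_add)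
  show "f \<in> H2 \<Longrightarrow> (\<lambda>z. c * f z) \<in> H2" by (rule H2_cmult)
  show "H2_inner (\<lambda>z. f z + g z) h = H2_inner f h + H2_inner g h" if "f \<in> H2" "g \<in> H2" "h \<in> H2"
    using that suminf_add[OF H2_inner_summable[of f h] H2_inner_summable[of g h]]
    by (simp add: H2_inner_def taylor_add H2_def ring_distribs)
  show "H2_inner (\<lambda>z. c * f z) h = c * H2_inner f h" if "f \<in> H2" "h \<in> H2"
    using that suminf_mult[OF H2_inner_summable[of f h], of c]
    by (simp add: H2_inner_def taylor_cmult H2_def mult.assoc)
  show "H2_inner h f = cnj (H2_inner f h)" if "f \<in> H2" "h \<in> H2"
  proof -
    have "(\<lambda>k. cnj (taylor_coeff f k * cnj (taylor_coeff h k))) sums cnj (H2_inner f h)"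
      unfolding sums_cnj H2_inner_def by (intro summable_sums H2_inner_summable that)
    then show ?thesis unfolding H2_inner_def[of h] by (simp add: sums_iff mult.commute)
  qed
  show "0 \<le> Re (H2_inner f f)" if "f \<in> H2"
    unfolding H2_inner_def Re_suminf[OF H2_inner_summable[OF that that]]
    by (intro suminf_nonneg summable_Re H2_inner_summable that) (auto simp: complex_mult_cnj)
qed

lemma H2_sqnorm_sums:
  assumes "f \<in> H2"
  shows "(\<lambda>k. (cmod (taylor_coeff f k))\<^sup>2) sums H2.sqnorm f"
proof -
  have "(\<lambda>k. Re (taylor_coeff f k * cnj (taylor_coeff f k))) sums Re (H2_inner f f)"
    unfolding H2_inner_def by (intro sums_Re summable_sums H2_inner_summable assms)
  then show ?thesis unfolding H2.sqnorm_def complex_norm_square[symmetric] by simp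
qed

lemma hardy_norm_sq_H2:
  assumes "f \<in> H2" shows "hardy_norm_sq f = ennreal (H2.sqnorm f)"
  unfolding hardy_norm_sq_def using H2_sqnorm_sums[OF assms]
  by (subst suminf_ennreal2) (auto simp: sums_iff)

lemma H2_cong:
  assumes "f \<in> H2" "\<And>z. cmod z < 1 \<Longrightarrow> f z = g z"
  shows "g \<in> H2" "H2.sqnorm g = H2.sqnorm f"
proof -
  have t: "taylor_coeff g k = taylor_coeff f k" for k
    using assms by (intro taylor_cong) (auto simp: H2_def)
  have "g holomorphic_on unit_disc \<longleftrightarrow> f holomorphic_on unit_disc"
    using assms(2) by (intro holomorphic_cong) auto
  with t show "g \<in> H2" using assms(1) by (simp add: H2_def)
  show "H2.sqnorm g = H2.sqnorm f" by (simp add: H2.sqnorm_def H2_inner_def t)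
qed

section \<open>The Szego kernel and simple multipliers\<close>

definition szego :: "complex \<Rightarrow> complex \<Rightarrow> complex" where
  "szego w z = 1 / (1 - cnj w * z)"

lemma szego_taylor:
  assumes "cmod w < 1"
  shows "szego w holomorphic_on unit_disc" "taylor_coeff (szego w) k = cnj w ^ k"
proof -
  have "(\<lambda>k. cnj w ^ k * z ^ k) sums szego w z" if "cmod z < 1" for z
  proof -
    have "cmod w * cmod z \<le> cmod w * 1" by (intro mult_left_mono) (use that in auto)
    then have "cmod (cnj w * z) < 1" using assms by (simp add: norm_mult)
    then show ?thesis using geometric_sums[of "cnj w * z"]
      by (simp add: szego_def power_mult_distrib)
  qed
  from taylor_unique[of "\<lambda>k. cnj w ^ k" "szego w", OF this]
  show "szego w holomorphic_on unit_disc" "taylor_coeff (szego w) k = cnj w ^ k" by auto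
qed

lemma sq_less_1: "cmod w < 1 \<Longrightarrow> (cmod w)\<^sup>2 < 1"
  by (simp add: abs_square_less_1)

lemma szego_H2:
  assumes "cmod w < 1"
  shows "szego w \<in> H2" "H2.sqnorm (szego w) = 1 / (1 - (cmod w)\<^sup>2)"
proof -
  have *: "(\<lambda>k. (cmod (taylor_coeff (szego w) k))\<^sup>2) sums (1 / (1 - (cmod w)\<^sup>2))"
    using geometric_sums[of "(cmod w)\<^sup>2"] sq_less_1[OF assms]
    by (simp add: szego_taylor[OF assms] norm_power power_mult[symmetric] mult.commute)
  then show "szego w \<in> H2" using szego_taylor[OF assms] by (auto simp: H2_def sums_iff)
  from H2_sqnorm_sums[OF this] * show "H2.sqnorm (szego w) = 1 / (1 - (cmod w)\<^sup>2)"
    using sums_unique2 by blast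
qed

lemma szego_reproducing:
  assumes "f \<in> H2" "cmod w < 1"
  shows "H2_inner f (szego w) = f w"
  using taylor_sums[of f w] assms by (simp add: H2_inner_def szego_taylor sums_iff H2_def)

lemma H2_eval_bound:
  assumes "f \<in> H2" "cmod w < 1"
  shows "(cmod (f w))\<^sup>2 \<le> H2.sqnorm f / (1 - (cmod w)\<^sup>2)"
  using H2.Cauchy_Schwarz[OF assms(1) szego_H2(1)[OF assms(2)]]
  by (simp add: szego_reproducing assms szego_H2)

lemma H2_mult_z:
  assumes "f \<in> H2"
  shows "(\<lambda>z. z * f z) \<in> H2" "H2.sqnorm (\<lambda>z. z * f z) = H2.sqnorm f"
proof -
  have hol: "f holomorphic_on unit_disc" using assms by (simp add: H2_def)
  have "(\<lambda>k. (cmod (taylor_coeff (\<lambda>z. z * f z) (Suc k)))\<^sup>2) sums H2.sqnorm f"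
    using H2_sqnorm_sums[OF assms] by (simp add: taylor_mult_z[OF hol])
  then have *: "(\<lambda>k. (cmod (taylor_coeff (\<lambda>z. z * f z) k))\<^sup>2) sums H2.sqnorm f"
    by (subst (asm) sums_Suc_iff) (simp add: taylor_mult_z[OF hol])
  then show 1: "(\<lambda>z. z * f z) \<in> H2" using hol by (simp add: H2_def sums_iff holomorphic_on_mult)
  from H2_sqnorm_sums[OF 1] * show "H2.sqnorm (\<lambda>z. z * f z) = H2.sqnorm f"
    using sums_unique2 by blast
qed

lemma H2_const: "(\<lambda>_. c) \<in> H2" "H2.sqnorm (\<lambda>_. c) = (cmod c)\<^sup>2"
proof -
  have *: "(\<lambda>k. (cmod (taylor_coeff (\<lambda>_. c) k))\<^sup>2) sums (cmod c)\<^sup>2"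
  proof -
    have "(\<lambda>k. (cmod (taylor_coeff (\<lambda>_. c) k))\<^sup>2) = (\<lambda>k. if k = 0 then (cmod c)\<^sup>2 else 0)"
      by (auto simp: taylor_const)
    then show ?thesis using sums_single[of 0 "\<lambda>_. (cmod c)\<^sup>2"] by simp
  qed
  then show 1: "(\<lambda>_. c) \<in> H2" by (auto simp: H2_def sums_iff)
  from H2_sqnorm_sums[OF 1] * show "H2.sqnorm (\<lambda>_. c) = (cmod c)\<^sup>2"
    using sums_unique2 by blast
qed

text \<open>Multiplication by \<open>z\<close> is isometric and \<open>l\<close> has modulus 1, so
  the parallelogram bound gives \<open>2 + 2 = 4\<close>.\<close>

lemma H2_mult_linear:
  assumes "f \<in> H2" "cmod l = 1"
  shows "(\<lambda>z. (z - l) * f z) \<in> H2" "H2.sqnorm (\<lambda>z. (z - l) * f z) \<le> 4 * H2.sqnorm f"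
proof -
  have eq: "(\<lambda>z. (z - l) * f z) = (\<lambda>z. z * f z + (-l) * f z)" by (auto simp: algebra_simps)
  show "(\<lambda>z. (z - l) * f z) \<in> H2"
    unfolding eq by (intro H2_add H2_mult_z H2_cmult assms)
  show "H2.sqnorm (\<lambda>z. (z - l) * f z) \<le> 4 * H2.sqnorm f"
    unfolding eq using H2.sqnorm_add_le[OF H2_mult_z(1)[OF assms(1)] H2_cmult[OF assms(1), of "-l"]]
    using H2.sqnorm_cmult[OF assms(1), of "-l"] H2_mult_z(2)[OF assms(1)] assms(2) by simp
qed

section \<open>Area integrals of power series\<close>

definition vec_complex :: "real^2 \<Rightarrow> complex" where
  "vec_complex v = Complex (vec_nth v 1) (vec_nth v 2)"

lemma linear_vec_complex: "linear vec_complex"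
  by (rule linearI) (auto simp: vec_complex_def complex_eq_iff)

lemma vec_complex_measurable [measurable]: "vec_complex \<in> borel_measurable borel"
  using linear_vec_complex by (intro borel_measurable_continuous_onI linear_continuous_on linear_conv_bounded_linear[THEN iffD1])

text \<open>Lebesgue measure is determined by its values on boxes, and the preimage of a box is a
  box with the same side lengths.\<close>

lemma distr_vec_complex: "distr lborel borel vec_complex = lborel"
proof (rule lborel_eqI[symmetric])
  fix l u :: complex assume lu: "\<And>b. b \<in> Basis \<Longrightarrow> l \<bullet> b \<le> u \<bullet> b"
  let ?l = "vector [Re l, Im l] :: real^2" and ?u = "vector [Re u, Im u] :: real^2"
  have le: "Re l \<le> Re u" "Im l \<le> Im u" using lu[of 1] lu[of \<i>] by (auto simp: Basis_complex_def)
  have le2: "vec_nth ?l i \<le> vec_nth ?u i" for i using le exhaust_2[of i] by auto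
  have "vec_complex -` box l u = box ?l ?u"
    by (auto simp: vec_complex_def mem_box Basis_complex_def Basis_vec_def forall_2 inner_axis axis_eq_axis)
  then have "emeasure (distr lborel borel vec_complex) (box l u) = emeasure lborel (box ?l ?u)"
    by (subst emeasure_distr) auto
  also have "\<dots> = ennreal (\<Prod>b\<in>Basis. (?u - ?l) \<bullet> b)"
    by (subst emeasure_lborel_box) (auto simp: Basis_vec_def inner_axis le intro: le2)
  also have "(\<Prod>b\<in>Basis. (?u - ?l) \<bullet> b) = (Re u - Re l) * (Im u - Im l)"
  proof -
    have B: "(Basis :: (real^2) set) = {axis 1 1, axis 2 1}"
      by (auto simp: Basis_vec_def) (metis exhaust_2)
    have "axis 1 1 \<noteq> (axis 2 1 :: real^2)" by (simp add: axis_eq_axis)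
    then show ?thesis unfolding B by (simp add: inner_axis)
  qed
  also have "\<dots> = ennreal (\<Prod>b\<in>Basis. (u - l) \<bullet> b)"
    by (simp add: Basis_complex_def)
  finally show "emeasure (distr lborel borel vec_complex) (box l u) = ennreal (\<Prod>b\<in>Basis. (u - l) \<bullet> b)" .
qed simp

text \<open>The orthogonal-invariance of Lebesgue measure is available for \<^typ>\<open>real^2\<close> only, so it is
  transported along the isometry \<^const>\<open>vec_complex\<close>.\<close>

lemma distr_rotation:
  assumes "cmod c = 1"
  shows "distr lborel borel (\<lambda>z. c * z) = lborel"
proof (rule lborel_eqI[symmetric])
  fix l u :: complex assume lu: "\<And>b. b \<in> Basis \<Longrightarrow> l \<bullet> b \<le> u \<bullet> b"
  \<comment> \<open>\<open>T\<close> is the rotation by \<open>cnj c\<close>, the inverse of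
    multiplication by \<open>c\<close>: a preimage under that multiplication becomes an image under
    \<open>T\<close>, which is the form in which \<open>measure_orthogonal_image\<close>
    applies.\<close>
  define T where "T = (\<lambda>v::real^2. (vector [Re (cnj c * vec_complex v), Im (cnj c * vec_complex v)] :: real^2))"
  define V where "V = vec_complex -` box l u"
  have vT: "vec_complex (T v) = cnj c * vec_complex v" for v
    by (simp add: T_def vec_complex_def complex_eq_iff)
  have cc: "c * cnj c = 1" using assms by (metis complex_norm_square of_real_1 one_power2)
  have norm_vec: "cmod (vec_complex v) = norm v" for v
    by (simp add: vec_complex_def norm_vec_def cmod_def L2_set_def sum_2)
  have inj_vec: "vec_complex v = vec_complex v' \<longleftrightarrow> v = v'" for v v'
    by (auto simp: vec_complex_def vec_eq_iff forall_2)
  have lin: "linear T"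
    by (rule linearI) (auto simp: T_def vec_complex_def vec_eq_iff forall_2 algebra_simps)
  have orth: "orthogonal_transformation T"
    unfolding orthogonal_transformation
    using lin by (auto simp: norm_vec[symmetric] vT norm_mult assms)
  have surj: "\<exists>v. vec_complex v = z" for z
    by (rule exI[of _ "vector [Re z, Im z]"]) (simp add: vec_complex_def)
  have im: "vec_complex -` ((\<lambda>z. c * z) -` box l u) = T ` V"
  proof (intro equalityI subsetI)
    fix v assume "v \<in> vec_complex -` ((\<lambda>z. c * z) -` box l u)"
    then have v: "c * vec_complex v \<in> box l u" by simp
    obtain v' where v': "vec_complex v' = c * vec_complex v" using surj by metis
    have "vec_complex (T v') = vec_complex v"
      using cc by (simp add: vT v' mult.assoc[symmetric] mult.commute[of "cnj c"])
    then have "T v' = v" by (simp add: inj_vec)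
    then show "v \<in> T ` V" using v v' by (auto simp: V_def)
  next
    fix v assume "v \<in> T ` V"
    then show "v \<in> vec_complex -` ((\<lambda>z. c * z) -` box l u)"
      using cc by (auto simp: V_def vT mult.assoc[symmetric])
  qed
  have V_box: "V = box (vector [Re l, Im l] :: real^2) (vector [Re u, Im u])"
    by (auto simp: V_def vec_complex_def mem_box Basis_complex_def Basis_vec_def forall_2 inner_axis axis_eq_axis)
  then have Vm: "V \<in> lmeasurable" by simp
  have mc[measurable]: "(\<lambda>z. c * z) \<in> borel_measurable borel" by measurable
  have Bm: "vec_complex -` ((\<lambda>z. c * z) -` box l u) \<in> sets borel"
    using measurable_sets[OF measurable_compose[OF vec_complex_measurable mc], of "box l u"]
    by (simp add: vimage_def)
  have "emeasure (distr lborel borel (\<lambda>z. c * z)) (box l u) = emeasure lborel ((\<lambda>z. c * z) -` box l u)"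
    by (subst emeasure_distr) auto
  also have "\<dots> = emeasure (distr lborel borel vec_complex) ((\<lambda>z. c * z) -` box l u)"
    by (simp add: distr_vec_complex)
  also have "\<dots> = emeasure lborel (T ` V)"
    using measurable_sets[OF mc, of "box l u"]
    by (subst emeasure_distr) (auto simp: im)
  also have "\<dots> = emeasure lebesgue (T ` V)"
    using Bm im by (simp add: emeasure_completion)
  also have "\<dots> = ennreal (measure lebesgue (T ` V))"
    using measurable_orthogonal_image[OF orth Vm] by (intro emeasure_eq_measure2) (auto simp: fmeasurable_def)
  also have "measure lebesgue (T ` V) = measure lebesgue V"
    by (rule measure_orthogonal_image[OF orth Vm])
  also have "ennreal (measure lebesgue V) = emeasure lebesgue V"
    using Vm by (intro emeasure_eq_measure2[symmetric]) (auto simp: fmeasurable_def)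
  also have "\<dots> = emeasure lborel V" by (simp add: V_box)
  also have "\<dots> = emeasure (distr lborel borel vec_complex) (box l u)"
    by (subst emeasure_distr) (auto simp: V_def)
  also have "\<dots> = ennreal (\<Prod>b\<in>Basis. (u - l) \<bullet> b)"
    using lu by (simp add: distr_vec_complex)
  finally show "emeasure (distr lborel borel (\<lambda>z. c * z)) (box l u) = ennreal (\<Prod>b\<in>Basis. (u - l) \<bullet> b)" .
qed simp

lemma integral_rotation:
  fixes f :: "complex \<Rightarrow> complex"
  assumes "cmod c = 1" "f \<in> borel_measurable borel"
  shows "(\<integral>z. f (c * z) \<partial>lborel) = (\<integral>z. f z \<partial>lborel)"
proof -
  have "(\<integral>z. f z \<partial>lborel) = (\<integral>z. f z \<partial>distr lborel borel (\<lambda>z. c * z))"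
    by (simp add: distr_rotation[OF assms(1)])
  also have "\<dots> = (\<integral>z. f (c * z) \<partial>lborel)"
    by (rule integral_distr) (use assms(2) in auto)
  finally show ?thesis by simp
qed

lemma cnj_measurable [measurable]: "cnj \<in> borel_measurable borel"
  by (intro borel_measurable_continuous_onI continuous_intros)

lemma of_real_measurable [measurable]: "(of_real :: real \<Rightarrow> complex) \<in> borel_measurable borel"
  by (intro borel_measurable_continuous_onI continuous_intros)

lemma monomials_orthogonal:
  fixes \<psi> :: "real \<Rightarrow> real"
  assumes "j \<noteq> k" and [measurable]: "\<psi> \<in> borel_measurable borel"
  shows "(\<integral>z. z ^ j * cnj z ^ k * of_real (\<psi> (cmod z)) \<partial>lborel) = 0"
proof -
  \<comment> \<open>Rotation by this angle multiplies the integrand by \<open>-1\<close>, since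
    \<open>c ^ j * cnj c ^ k = cis pi\<close>; the integral therefore equals its own
    negative.\<close>
  define c where "c = cis (pi / (real j - real k))"
  have c: "cmod c = 1" by (simp add: c_def)
  have "c ^ j * cnj c ^ k = cis (pi / (real j - real k) * (real j - real k))"
    unfolding c_def cis_cnj Complex.DeMoivre cis_mult by (rule arg_cong[of _ _ cis]) (simp add: algebra_simps diff_divide_distrib)
  also have "\<dots> = -1" using assms(1) by simp
  finally have cjk: "c ^ j * cnj c ^ k = -1" .
  let ?f = "\<lambda>z. z ^ j * cnj z ^ k * of_real (\<psi> (cmod z))"
  have "(\<integral>z. ?f z \<partial>lborel) = (\<integral>z. ?f (c * z) \<partial>lborel)"
  proof (rule integral_rotation[OF c, symmetric])
    show "?f \<in> borel_measurable borel" by measurable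
  qed
  also have "(\<lambda>z. ?f (c * z)) = (\<lambda>z. (c ^ j * cnj c ^ k) * ?f z)"
    by (auto simp: norm_mult c power_mult_distrib mult_ac)
  also have "(\<integral>z. (c ^ j * cnj c ^ k) * ?f z \<partial>lborel) = - (\<integral>z. ?f z \<partial>lborel)"
    unfolding cjk by simp
  finally show ?thesis by simp
qed


section \<open>Normalized area measure on the disc\<close>

lemma space_disc_area [simp]: "space disc_area = unit_disc"
  and sets_disc_area [simp, measurable_cong]: "sets disc_area = sets disc_borel"
  by (simp_all add: disc_area_def space_restrict_space sets_restrict_space)

lemma nn_integral_disc_area:
  assumes [measurable]: "f \<in> borel_measurable disc_borel"
  shows "(\<integral>\<^sup>+z. f z \<partial>disc_area) = ennreal (1 / pi) * (\<integral>\<^sup>+z. f z * indicator unit_disc z \<partial>lborel)"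
proof -
  have [measurable]: "f \<in> borel_measurable (restrict_space lborel unit_disc)"
    using assms by (simp add: measurable_def space_restrict_space sets_restrict_space)
  show ?thesis
    unfolding disc_area_def
    by (subst nn_integral_density)
       (auto simp: nn_integral_cmult nn_integral_restrict_space)
qed

lemma emeasure_disc_area_cball:
  assumes "0 \<le> t" "t < 1"
  shows "emeasure disc_area (cball 0 t) = ennreal (t\<^sup>2)"
proof -
  have sub: "cball 0 t \<subseteq> unit_disc" using assms by auto
  then have m: "cball 0 t \<in> sets disc_borel" by (simp add: sets_restrict_space_iff)
  have "emeasure disc_area (cball 0 t) = (\<integral>\<^sup>+z. indicator (cball 0 t) z \<partial>disc_area)"
    using m by simp
  also have "\<dots> = ennreal (1 / pi) * (\<integral>\<^sup>+z. indicator (cball 0 t) z * indicator unit_disc z \<partial>lborel)"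
    by (rule nn_integral_disc_area) (use m in simp)
  also have "(\<lambda>z. indicator (cball 0 t) z * indicator unit_disc z :: ennreal) = indicator (cball (0::complex) t)"
    using sub by (intro ext) (auto simp: indicator_def)
  also have "(\<integral>\<^sup>+z. indicator (cball (0::complex) t) z \<partial>lborel) = ennreal (pi * t\<^sup>2)"
    using assms by (simp add: emeasure_cball unit_ball_vol_2)
  finally show ?thesis by (simp add: ennreal_mult[symmetric])
qed

lemma emeasure_disc_area_space: "emeasure disc_area unit_disc = 1"
proof -
  have "emeasure disc_area unit_disc = (\<integral>\<^sup>+z. 1 \<partial>disc_area)" by simp
  also have "\<dots> = ennreal (1 / pi) * (\<integral>\<^sup>+z. 1 * indicator unit_disc z \<partial>lborel)"
    by (rule nn_integral_disc_area) simp
  also have "(\<integral>\<^sup>+z. 1 * indicator (unit_disc::complex set) z \<partial>lborel) = ennreal pi"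
    by (simp add: emeasure_ball unit_ball_vol_2)
  finally show ?thesis by (simp add: ennreal_mult[symmetric])
qed

interpretation disc_area: prob_space disc_area
  by (rule prob_spaceI) (simp add: emeasure_disc_area_space)

lemma continuous_disc_measurable [measurable (raw)]:
  "continuous_on unit_disc f \<Longrightarrow> f \<in> borel_measurable disc_borel"
  for f :: "complex \<Rightarrow> 'b::topological_space"
  by (rule borel_measurable_continuous_on_restrict)

text \<open>The disc of radius \<open>sqrt t\<close> has normalized area \<open>t\<close>, so the
  squared modulus is uniformly distributed. This takes the place of polar coordinates in radial
  integrals.\<close>

lemma distr_modulus_disc_area:
  "distr disc_area borel (\<lambda>z. (cmod z)\<^sup>2) = uniform_measure lborel {0..1}"
proof (rule cdf_unique)
  have [measurable]: "(\<lambda>z. (cmod z)\<^sup>2) \<in> borel_measurable disc_area"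
    by (subst measurable_cong_sets[OF sets_disc_area refl])
       (intro continuous_disc_measurable continuous_intros)
  show "real_distribution (distr disc_area borel (\<lambda>z. (cmod z)\<^sup>2))"
    by (intro disc_area.real_distribution_distr) simp
  interpret U: prob_space "uniform_measure lborel {0..1::real}"
    by (rule prob_space_uniform_measure) auto
  show "real_distribution (uniform_measure lborel {0..1::real})"
    by unfold_locales auto
  show "cdf (distr disc_area borel (\<lambda>z. (cmod z)\<^sup>2)) = cdf (uniform_measure lborel {0..1})"
  proof
    fix t :: real
    have L: "cdf (distr disc_area borel (\<lambda>z. (cmod z)\<^sup>2)) t = measure disc_area {z \<in> unit_disc. (cmod z)\<^sup>2 \<le> t}"
      unfolding cdf_def by (subst measure_distr) (auto intro!: arg_cong[of _ _ "measure disc_area"])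
    have R: "cdf (uniform_measure lborel {0..1}) t = measure lborel ({0..1} \<inter> {..t})"
      unfolding cdf_def by (subst measure_uniform_measure) auto
    consider "t < 0" | "0 \<le> t" "t < 1" | "1 \<le> t" by linarith
    then show "cdf (distr disc_area borel (\<lambda>z. (cmod z)\<^sup>2)) t = cdf (uniform_measure lborel {0..1}) t"
    proof cases
      case 1
      then have "{z \<in> unit_disc. (cmod z)\<^sup>2 \<le> t} = {}" "{0..1} \<inter> {..t} = {}"
        by (auto simp: not_le intro: less_le_trans[OF _ zero_le_power2])
      then show ?thesis unfolding L R by (simp only: measure_empty)
    next
      case 2
      have iff: "(cmod z)\<^sup>2 \<le> t \<longleftrightarrow> cmod z \<le> sqrt t" for z
        by (metis abs_norm_cancel real_sqrt_abs real_sqrt_le_iff)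
      have "sqrt t < 1" using 2 by simp
      then have "{z \<in> unit_disc. (cmod z)\<^sup>2 \<le> t} = cball 0 (sqrt t)"
        unfolding iff by (auto intro: order_le_less_trans[of _ "sqrt t"])
      moreover have "emeasure disc_area (cball 0 (sqrt t)) = ennreal t"
        using 2 by (subst emeasure_disc_area_cball) auto
      moreover have "{0..1} \<inter> {..t} = {0..t}" using 2 by auto
      ultimately show ?thesis unfolding L R using 2 by (simp add: measure_def)
    next
      case 3
      then have "{z \<in> unit_disc. (cmod z)\<^sup>2 \<le> t} = unit_disc" "{0..1} \<inter> {..t} = {0..1}"
        by (auto intro: order_trans[OF less_imp_le[OF sq_less_1]])
      then show ?thesis unfolding L R using disc_area.prob_space by simp
    qed
  qed
qed

text \<open>With \<open>t = |z|^2\<close> uniformly distributed, this is the Beta integral of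
  \<open>t ^ k (1 - t)\<close>.\<close>

lemma integral_disc_area_radial:
  "(\<integral>\<^sup>+z. ennreal ((cmod z) ^ (2 * k) * (1 - (cmod z)\<^sup>2)) \<partial>disc_area) = ennreal (1 / ((real k + 1) * (real k + 2)))"
proof -
  have [measurable]: "(\<lambda>z. (cmod z)\<^sup>2) \<in> borel_measurable disc_area"
    by (subst measurable_cong_sets[OF sets_disc_area refl])
       (intro continuous_disc_measurable continuous_intros)
  let ?h = "\<lambda>t::real. t ^ k * (1 - t)"
  have "(\<integral>\<^sup>+z. ennreal ((cmod z) ^ (2 * k) * (1 - (cmod z)\<^sup>2)) \<partial>disc_area)
      = (\<integral>\<^sup>+z. ennreal (?h ((cmod z)\<^sup>2)) \<partial>disc_area)"
    by (simp add: power_mult)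
  also have "\<dots> = (\<integral>\<^sup>+t. ennreal (?h t) \<partial>distr disc_area borel (\<lambda>z. (cmod z)\<^sup>2))"
    by (subst nn_integral_distr) auto
  also have "\<dots> = (\<integral>\<^sup>+t. ennreal (?h t) * indicator {0..1} t \<partial>lborel)"
    unfolding distr_modulus_disc_area
    by (subst nn_integral_uniform_measure) (auto simp: divide_ennreal_def)
  also have "\<dots> = ennreal ((1 / (real k + 1) - 1 / (real k + 2)) - 0)"
  proof -
    let ?F = "\<lambda>t::real. t ^ (k + 1) / (k + 1) - t ^ (k + 2) / (k + 2)"
    have "(\<integral>\<^sup>+t. ennreal (?h t) * indicator {0..1} t \<partial>lborel) = ennreal (?F 1 - ?F 0)"
    proof (rule nn_integral_FTC_Icc)
      fix x :: real assume x: "x \<in> {0..1}"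
      have "((\<lambda>t. t ^ (k + 1) / (k + 1) - t ^ (k + 2) / (k + 2)) has_real_derivative
          (real (k + 1) * x ^ k) / (k + 1) - (real (k + 2) * x ^ (k + 1)) / (k + 2)) (at x)"
        using DERIV_diff[OF DERIV_cdivide[OF DERIV_pow[of "k + 1" x UNIV], of "real (k + 1)"]
            DERIV_cdivide[OF DERIV_pow[of "k + 2" x UNIV], of "real (k + 2)"]] by simp
      also have "(real (k + 1) * x ^ k) / (k + 1) = x ^ k"
        using nonzero_mult_div_cancel_left[of "real (k + 1)" "x ^ k"] by simp
      also have "(real (k + 2) * x ^ (k + 1)) / (k + 2) = x ^ (k + 1)"
        using nonzero_mult_div_cancel_left[of "real (k + 2)" "x ^ (k + 1)"] by simp
      also have "x ^ k - x ^ (k + 1) = ?h x"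
        by (simp add: algebra_simps)
      finally show "(?F has_real_derivative ?h x) (at x)" .
      show "0 \<le> ?h x" using x by simp
    qed auto
    then show ?thesis by (simp add: add.commute)
  qed
  also have "(1 / (real k + 1) - 1 / (real k + 2)) - 0 = 1 / ((real k + 1) * (real k + 2))"
    by (simp add: divide_simps)
  finally show ?thesis by simp
qed


section \<open>Parseval's identity for the weight \<open>1 - |z|^2\<close>\<close>

lemma nn_integral_disc_exhaust:
  assumes M: "sets M = sets disc_borel" and [measurable]: "h \<in> borel_measurable M"
  shows "(\<integral>\<^sup>+z. h z \<partial>M) = (SUP m. \<integral>\<^sup>+z. h z * indicator (cball 0 (1 - 1 / (real m + 2))) z \<partial>M)"
proof -
  have sp: "space M = unit_disc" using sets_eq_imp_space_eq[OF M] by (simp add: space_restrict_space)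
  \<comment> \<open>The shift by 2 keeps all radii in the interval from \<open>1 / 2\<close> to 1,
    so statements about truncations with \<open>0 <= r\<close> and \<open>r < 1\<close> apply to
    each of them.\<close>
  let ?r = "\<lambda>m. 1 - 1 / (real m + 2)"
  have [measurable]: "indicator (cball 0 (?r m)) \<in> borel_measurable M" for m
    by (rule measurable_cong_sets[OF M refl, THEN equalityD2, THEN subsetD])
       (intro measurable_restrict_space1 borel_measurable_indicator, simp)
  have inc: "incseq (\<lambda>m z. h z * indicator (cball 0 (?r m)) z)"
  proof (intro incseq_SucI le_funI mult_left_mono)
    fix m and z :: complex
    have "?r m \<le> ?r (Suc m)" by (simp add: divide_simps algebra_simps)
    then show "indicator (cball 0 (?r m)) z \<le> (indicator (cball 0 (?r (Suc m))) z :: ennreal)"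
      by (auto simp: indicator_def)
  qed simp
  have "(\<integral>\<^sup>+z. h z \<partial>M) = (\<integral>\<^sup>+z. (SUP m. h z * indicator (cball 0 (?r m)) z) \<partial>M)"
  proof (rule nn_integral_cong)
    fix z assume "z \<in> space M"
    then have z: "cmod z < 1" by (simp add: sp)
    obtain m :: nat where m: "1 / (1 - cmod z) < real m" using reals_Archimedean2 by blast
    have "1 / (real m + 2) \<le> 1 / (1 / (1 - cmod z))"
      using z m by (intro divide_left_mono) auto
    then have "z \<in> cball 0 (?r m)" by simp
    then have "h z \<le> (SUP m. h z * indicator (cball 0 (?r m)) z)"
      by (intro SUP_upper2[of m]) auto
    moreover have "(SUP m. h z * indicator (cball 0 (?r m)) z) \<le> h z"
      by (intro SUP_least) (auto simp: indicator_def)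
    ultimately show "h z = (SUP m. h z * indicator (cball 0 (?r m)) z)" by (rule antisym)
  qed
  also have "\<dots> = (SUP m. \<integral>\<^sup>+z. h z * indicator (cball 0 (?r m)) z \<partial>M)"
    by (rule nn_integral_monotone_convergence_SUP[OF inc]) measurable
  finally show ?thesis .
qed

text \<open>Rotation invariance removes the mixed terms. On the closed disc of radius
  \<open>r\<close> every integrand is continuous on a compact set, so sums and integrals
  interchange.\<close>

lemma partial_sums_parseval:
  fixes c :: "nat \<Rightarrow> complex"
  shows "(\<integral>z. indicator (cball 0 r) z *\<^sub>R ((\<Sum>k<n. c k * z ^ k) * cnj (\<Sum>k<n. c k * z ^ k) * of_real (1 - (cmod z)\<^sup>2)) \<partial>lborel)
    = (\<Sum>k<n. of_real ((cmod (c k))\<^sup>2) * (\<integral>z. indicator (cball 0 r) z *\<^sub>R of_real (cmod z ^ (2 * k) * (1 - (cmod z)\<^sup>2)) \<partial>lborel))"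
proof -
  let ?e = "\<lambda>j k z. indicator (cball 0 r) z *\<^sub>R (z ^ j * cnj z ^ k * of_real (1 - (cmod z)\<^sup>2)) :: complex"
  have int: "integrable lborel (?e j k)" for j k
    by (intro borel_integrable_compact compact_cball continuous_intros)
  have orth: "(\<integral>z. ?e j k z \<partial>lborel) = 0" if "j \<noteq> k" for j k
  proof -
    \<comment> \<open>The cutoff to the closed disc is radial, hence it can be absorbed into the
      weight of \<open>monomials_orthogonal\<close>.\<close>
    have "(\<integral>z. z ^ j * cnj z ^ k * of_real (indicator {..r} (cmod z) * (1 - (cmod z)\<^sup>2)) \<partial>lborel) = 0"
      by (rule monomials_orthogonal[OF that]) measurable
    also have "(\<lambda>z. z ^ j * cnj z ^ k * of_real (indicator {..r} (cmod z) * (1 - (cmod z)\<^sup>2))) = ?e j k"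
      by (intro ext) (auto simp: indicator_def)
    finally show ?thesis .
  qed
  have diag: "?e k k = (\<lambda>z. indicator (cball 0 r) z *\<^sub>R of_real (cmod z ^ (2 * k) * (1 - (cmod z)\<^sup>2)))" for k
  proof
    fix z :: complex
    have "z ^ k * cnj z ^ k = of_real (cmod z ^ (2 * k))"
      by (simp only: power_mult_distrib[symmetric] complex_norm_square[symmetric] power_mult of_real_power)
    then show "?e k k z = indicator (cball 0 r) z *\<^sub>R of_real (cmod z ^ (2 * k) * (1 - (cmod z)\<^sup>2))"
      by simp
  qed
  have "(\<lambda>z. indicator (cball 0 r) z *\<^sub>R ((\<Sum>k<n. c k * z ^ k) * cnj (\<Sum>k<n. c k * z ^ k) * of_real (1 - (cmod z)\<^sup>2)))
     = (\<lambda>z. \<Sum>j<n. \<Sum>k<n. c j * cnj (c k) * ?e j k z)"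
    unfolding cnj_sum sum_product
    by (intro ext) (simp add: sum_distrib_left sum_distrib_right scaleR_sum_right mult_ac)
  moreover have "(\<integral>z. (\<Sum>j<n. \<Sum>k<n. a j k * e j k z) \<partial>lborel) = (\<Sum>j<n. \<Sum>k<n. a j k * (\<integral>z. e j k z \<partial>lborel))"
    if "\<And>j k. integrable lborel (e j k)" for a :: "nat \<Rightarrow> nat \<Rightarrow> complex" and e :: "nat \<Rightarrow> nat \<Rightarrow> complex \<Rightarrow> complex"
    by (simp add: Bochner_Integration.integral_sum that)
  ultimately have "(\<integral>z. indicator (cball 0 r) z *\<^sub>R ((\<Sum>k<n. c k * z ^ k) * cnj (\<Sum>k<n. c k * z ^ k) * of_real (1 - (cmod z)\<^sup>2)) \<partial>lborel)
     = (\<Sum>j<n. \<Sum>k<n. c j * cnj (c k) * (\<integral>z. ?e j k z \<partial>lborel))"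
    using int by (simp only:)
  also have "\<dots> = (\<Sum>j<n. \<Sum>k<n. if k = j then c j * cnj (c k) * (\<integral>z. ?e j k z \<partial>lborel) else 0)"
    by (intro sum.cong refl) (use orth in auto)
  also have "\<dots> = (\<Sum>j<n. c j * cnj (c j) * (\<integral>z. ?e j j z \<partial>lborel))"
    by (intro sum.cong refl) simp
  also have "\<dots> = (\<Sum>k<n. of_real ((cmod (c k))\<^sup>2) * (\<integral>z. indicator (cball 0 r) z *\<^sub>R of_real (cmod z ^ (2 * k) * (1 - (cmod z)\<^sup>2)) \<partial>lborel))"
    unfolding diag by (simp only: complex_norm_square)
  finally show ?thesis .
qed


text \<open>Dominated convergence on a closed disc inside the unit disc; the bound \<open>M\<close>
  is the sum of the absolute values of the Taylor terms at radius \<open>r\<close>.\<close>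

lemma partial_sums_limit:
  assumes F: "F holomorphic_on unit_disc" and r: "r < 1"
  shows "(\<lambda>n. \<integral>z. indicator (cball 0 r) z *\<^sub>R ((\<Sum>k<n. taylor_coeff F k * z ^ k) *
            cnj (\<Sum>k<n. taylor_coeff F k * z ^ k) * of_real (1 - (cmod z)\<^sup>2)) \<partial>lborel)
     \<longlonglongrightarrow> (\<integral>z. indicator (cball 0 r) z *\<^sub>R (F z * cnj (F z) * of_real (1 - (cmod z)\<^sup>2)) \<partial>lborel)"
proof (cases "r < 0")
  case True
  then have "cball (0::complex) r = {}" by simp
  then show ?thesis by simp
next
  case False
  let ?c = "taylor_coeff F"
  let ?Q = "\<lambda>n z. \<Sum>k<n. ?c k * z ^ k"
  have sub: "cball 0 r \<subseteq> unit_disc" using r by auto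
  \<comment> \<open>Convergence at a radius strictly between \<open>r\<close> and 1 gives absolute
    convergence at \<open>r\<close>.\<close>
  have "summable (\<lambda>k. ?c k * complex_of_real ((r + 1) / 2) ^ k)"
    using taylor_sums[OF F, of "complex_of_real ((r + 1) / 2)"] r False by (auto simp: sums_iff norm_divide)
  then have sm: "summable (\<lambda>k. cmod (?c k * complex_of_real r ^ k))"
    by (rule powser_insidea) (use r False in auto)
  define M where "M = (\<Sum>k. cmod (?c k * complex_of_real r ^ k))"
  have bound: "cmod (?Q n z) \<le> M" if "cmod z \<le> r" for n z
  proof -
    have "cmod (?Q n z) \<le> (\<Sum>k<n. cmod (?c k * complex_of_real r ^ k))"
      using that False by (intro sum_norm_le) (auto simp: norm_mult norm_power intro!: mult_left_mono power_mono)
    also have "\<dots> \<le> M" unfolding M_def by (intro sum_le_suminf sm) auto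
    finally show ?thesis .
  qed
  have contF: "continuous_on (cball 0 r) F"
    using F sub by (meson holomorphic_on_imp_continuous_on continuous_on_subset)
  show ?thesis
  proof (rule integral_dominated_convergence[where w = "\<lambda>z. indicator (cball 0 r) z *\<^sub>R (M\<^sup>2)"])
    show "(\<lambda>z. indicator (cball 0 r) z *\<^sub>R (F z * cnj (F z) * of_real (1 - (cmod z)\<^sup>2))) \<in> borel_measurable lborel"
      by (intro borel_measurable_integrable borel_integrable_compact compact_cball continuous_intros contF)
    show "(\<lambda>z. indicator (cball 0 r) z *\<^sub>R (?Q n z * cnj (?Q n z) * of_real (1 - (cmod z)\<^sup>2))) \<in> borel_measurable lborel" for n
      by (intro borel_measurable_integrable borel_integrable_compact compact_cball continuous_intros)
    show "integrable lborel (\<lambda>z::complex. indicator (cball 0 r) z *\<^sub>R (M\<^sup>2))"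
      by (intro borel_integrable_compact compact_cball continuous_intros)
    show "AE z in lborel. (\<lambda>n. indicator (cball 0 r) z *\<^sub>R (?Q n z * cnj (?Q n z) * of_real (1 - (cmod z)\<^sup>2)))
        \<longlonglongrightarrow> indicator (cball 0 r) z *\<^sub>R (F z * cnj (F z) * of_real (1 - (cmod z)\<^sup>2))"
    proof (intro AE_I2)
      fix z
      show "(\<lambda>n. indicator (cball 0 r) z *\<^sub>R (?Q n z * cnj (?Q n z) * of_real (1 - (cmod z)\<^sup>2)))
        \<longlonglongrightarrow> indicator (cball 0 r) z *\<^sub>R (F z * cnj (F z) * of_real (1 - (cmod z)\<^sup>2))"
      proof (cases "z \<in> cball 0 r")
        case True
        then have "(\<lambda>n. ?Q n z) \<longlonglongrightarrow> F z"
          using taylor_sums[OF F, of z] r by (auto simp: sums_def)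
        then show ?thesis by (intro tendsto_intros)
      qed simp
    qed
    show "AE z in lborel. norm (indicator (cball 0 r) z *\<^sub>R (?Q n z * cnj (?Q n z) * of_real (1 - (cmod z)\<^sup>2)))
        \<le> indicator (cball 0 r) z *\<^sub>R (M\<^sup>2)" for n
    proof (intro AE_I2)
      fix z
      show "norm (indicator (cball 0 r) z *\<^sub>R (?Q n z * cnj (?Q n z) * of_real (1 - (cmod z)\<^sup>2)))
        \<le> indicator (cball 0 r) z *\<^sub>R (M\<^sup>2)"
      proof (cases "z \<in> cball 0 r")
        case True
        then have z: "cmod z \<le> r" by simp
        have "(cmod z)\<^sup>2 \<le> 1" using z r False by (simp add: abs_square_le_1)
        then have "cmod (of_real (1 - (cmod z)\<^sup>2)) \<le> 1" by (simp only: norm_of_real) simp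
        moreover have "cmod (?Q n z * cnj (?Q n z)) \<le> M\<^sup>2"
          unfolding norm_mult complex_mod_cnj power2_eq_square
          by (intro mult_mono bound z) (auto intro: order_trans[OF norm_ge_zero bound[OF z]])
        ultimately have "cmod (?Q n z * cnj (?Q n z)) * cmod (of_real (1 - (cmod z)\<^sup>2)) \<le> M\<^sup>2 * 1"
          by (intro mult_mono) auto
        then show ?thesis using True by (simp add: norm_mult)
      qed simp
    qed
  qed
qed

text \<open>Both sides may be infinite. The orthogonality argument is therefore run on closed discs
  of radius \<open>r < 1\<close>, where all integrals are finite, and monotone convergence leads to
  the whole disc.\<close>

lemma area_parseval:
  assumes F: "F holomorphic_on unit_disc"
  shows "(\<integral>\<^sup>+z. ennreal ((cmod (F z))\<^sup>2 * (1 - (cmod z)\<^sup>2)) \<partial>disc_area) =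
    (\<Sum>k. ennreal ((cmod (taylor_coeff F k))\<^sup>2 / ((real k + 1) * (real k + 2))))"
proof -
  let ?c = "taylor_coeff F"
  let ?G = "\<lambda>z. (\<Sum>k. ennreal ((cmod (?c k))\<^sup>2) * ennreal (cmod z ^ (2 * k) * (1 - (cmod z)\<^sup>2)))"
  let ?L = "\<lambda>z. ennreal ((cmod (F z))\<^sup>2 * (1 - (cmod z)\<^sup>2))"
  have contF: "continuous_on unit_disc F" using F by (rule holomorphic_on_imp_continuous_on)
  have meas: "\<And>f :: complex \<Rightarrow> ennreal. f \<in> borel_measurable disc_borel \<Longrightarrow> f \<in> borel_measurable disc_area"
    by (subst measurable_cong_sets[OF sets_disc_area refl])
  have mE[measurable]: "(\<lambda>z. ennreal (cmod z ^ (2 * k) * (1 - (cmod z)\<^sup>2))) \<in> borel_measurable disc_area" for k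
    by (intro meas measurable_compose[OF _ measurable_ennreal] continuous_disc_measurable continuous_intros)
  have mG: "?G \<in> borel_measurable disc_area" by measurable
  have mL: "?L \<in> borel_measurable disc_area"
    by (intro meas measurable_compose[OF _ measurable_ennreal] continuous_disc_measurable continuous_intros contF)
  have eq: "(\<integral>\<^sup>+z. ?L z * indicator (cball 0 r) z \<partial>disc_area) = (\<integral>\<^sup>+z. ?G z * indicator (cball 0 r) z \<partial>disc_area)"
    if r: "r < 1" for r
  proof -
    have sub: "cball 0 r \<subseteq> unit_disc" using r by auto
    then have cb: "cball 0 r \<in> sets disc_borel" by (simp add: sets_restrict_space_iff)
    have m2: "(\<lambda>z. h z * indicator (cball 0 r) z) \<in> borel_measurable disc_borel"
      if "h \<in> borel_measurable disc_area" for h :: "complex \<Rightarrow> ennreal"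
      using that cb by (subst measurable_cong_sets[OF sets_disc_area[symmetric] refl]) simp
    have contF': "continuous_on (cball 0 r) F" using contF sub by (rule continuous_on_subset)
    have bnn: "(\<integral>\<^sup>+z. ennreal (h z) * indicator (cball 0 r) z * indicator unit_disc z \<partial>lborel)
        = ennreal (Re (\<integral>z. indicator (cball 0 r) z *\<^sub>R complex_of_real (h z) \<partial>lborel))"
      (is "?A = _") if ch: "continuous_on (cball 0 r) h" and hn: "\<And>z. z \<in> cball 0 r \<Longrightarrow> 0 \<le> h z" for h
    proof -
      have int: "integrable lborel (\<lambda>z. indicator (cball 0 r) z *\<^sub>R h z)"
        by (intro borel_integrable_compact compact_cball ch)
      have "?A = (\<integral>\<^sup>+z. ennreal (indicator (cball 0 r) z *\<^sub>R h z) \<partial>lborel)"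
        using sub by (intro nn_integral_cong) (auto simp: indicator_def)
      also have "\<dots> = ennreal (\<integral>z. indicator (cball 0 r) z *\<^sub>R h z \<partial>lborel)"
        by (intro nn_integral_eq_integral int AE_I2) (use hn in \<open>auto simp: indicator_def\<close>)
      also have "(\<integral>z. indicator (cball 0 r) z *\<^sub>R h z \<partial>lborel) =
          Re (\<integral>z. complex_of_real (indicator (cball 0 r) z *\<^sub>R h z) \<partial>lborel)"
        by (simp only: integral_complex_of_real Re_complex_of_real)
      finally show ?thesis by (simp add: scaleR_conv_of_real)
    qed
    \<comment> \<open>The weight of the \<open>k\<close>-th coefficient on the smaller disc. It
      stays an unevaluated integral; the closed form enters only on the whole disc.\<close>
    define m where "m k = Re (\<integral>z. indicator (cball 0 r) z *\<^sub>R complex_of_real (cmod z ^ (2 * k) * (1 - (cmod z)\<^sup>2)) \<partial>lborel)" for k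
    have le1: "(cmod z)\<^sup>2 \<le> 1" if "z \<in> cball 0 r" for z
      using that r by (auto simp: abs_square_le_1)
    have m: "(\<integral>\<^sup>+z. ennreal (cmod z ^ (2 * k) * (1 - (cmod z)\<^sup>2)) * indicator (cball 0 r) z * indicator unit_disc z \<partial>lborel) = ennreal (m k)" for k
      unfolding m_def using le1 by (intro bnn continuous_intros) auto
    have mc: "(\<integral>z. indicator (cball 0 r) z *\<^sub>R complex_of_real (cmod z ^ (2 * k) * (1 - (cmod z)\<^sup>2)) \<partial>lborel) = complex_of_real (m k)" for k
    proof -
      have "(\<integral>z. indicator (cball 0 r) z *\<^sub>R complex_of_real (cmod z ^ (2 * k) * (1 - (cmod z)\<^sup>2)) \<partial>lborel) =
         (\<integral>z. complex_of_real (indicator (cball 0 r) z * (cmod z ^ (2 * k) * (1 - (cmod z)\<^sup>2))) \<partial>lborel)"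
        by (simp add: scaleR_conv_of_real)
      also have "\<dots> = complex_of_real (\<integral>z. indicator (cball 0 r) z * (cmod z ^ (2 * k) * (1 - (cmod z)\<^sup>2)) \<partial>lborel)"
        by (rule integral_complex_of_real)
      finally show ?thesis by (simp add: m_def)
    qed
    have m0: "0 \<le> m k" for k
      unfolding m_def
    proof -
      have "0 \<le> (\<integral>z. indicator (cball 0 r) z * (cmod z ^ (2 * k) * (1 - (cmod z)\<^sup>2)) \<partial>(lborel :: complex measure))"
        using le1 by (intro integral_nonneg_AE AE_I2) (auto simp: indicator_def)
      also have "\<dots> = Re (\<integral>z. complex_of_real (indicator (cball 0 r) z * (cmod z ^ (2 * k) * (1 - (cmod z)\<^sup>2))) \<partial>lborel)"
        by (simp only: integral_complex_of_real Re_complex_of_real)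
      finally show "0 \<le> Re (\<integral>z. indicator (cball 0 r) z *\<^sub>R complex_of_real (cmod z ^ (2 * k) * (1 - (cmod z)\<^sup>2)) \<partial>lborel)"
        by (simp add: scaleR_conv_of_real)
    qed
    define I where "I = (\<integral>z. indicator (cball 0 r) z *\<^sub>R (F z * cnj (F z) * of_real (1 - (cmod z)\<^sup>2)) \<partial>lborel)"
    have "(\<lambda>n. \<Sum>k<n. of_real ((cmod (?c k))\<^sup>2) * complex_of_real (m k)) \<longlonglongrightarrow> I"
      using partial_sums_limit[OF F r] unfolding partial_sums_parseval mc I_def .
    from tendsto_Re[OF this] have "(\<lambda>k. (cmod (?c k))\<^sup>2 * m k) sums Re I"
      by (simp add: sums_def del: of_real_power)
    then have sumI: "(\<Sum>k. ennreal ((cmod (?c k))\<^sup>2) * ennreal (m k)) = ennreal (Re I)"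
      using m0 by (simp add: ennreal_mult[symmetric] suminf_ennreal_eq sums_iff)
    have "(\<integral>\<^sup>+z. ?L z * indicator (cball 0 r) z \<partial>disc_area) =
        ennreal (1 / pi) * (\<integral>\<^sup>+z. ?L z * indicator (cball 0 r) z * indicator unit_disc z \<partial>lborel)"
      by (intro nn_integral_disc_area m2 mL)
    also have "(\<integral>\<^sup>+z. ?L z * indicator (cball 0 r) z * indicator unit_disc z \<partial>lborel) = ennreal (Re I)"
      unfolding I_def complex_norm_square[symmetric] of_real_mult[symmetric] using le1
      by (intro bnn continuous_intros contF') auto
    also have "\<dots> = (\<Sum>k. ennreal ((cmod (?c k))\<^sup>2) *
        (\<integral>\<^sup>+z. ennreal (cmod z ^ (2 * k) * (1 - (cmod z)\<^sup>2)) * indicator (cball 0 r) z * indicator unit_disc z \<partial>lborel))"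
      by (simp only: m sumI)
    also have "ennreal (1 / pi) * \<dots> = (\<Sum>k. ennreal ((cmod (?c k))\<^sup>2) * (ennreal (1 / pi) *
        (\<integral>\<^sup>+z. ennreal (cmod z ^ (2 * k) * (1 - (cmod z)\<^sup>2)) * indicator (cball 0 r) z * indicator unit_disc z \<partial>lborel)))"
      by (subst ennreal_suminf_cmult[symmetric]) (simp only: mult_ac)
    also have "\<dots> = (\<Sum>k. ennreal ((cmod (?c k))\<^sup>2) *
        (\<integral>\<^sup>+z. ennreal (cmod z ^ (2 * k) * (1 - (cmod z)\<^sup>2)) * indicator (cball 0 r) z \<partial>disc_area))"
      by (subst nn_integral_disc_area[OF m2[OF mE]]) (rule refl)
    also have "\<dots> = (\<Sum>k. (\<integral>\<^sup>+z. ennreal ((cmod (?c k))\<^sup>2) *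
        (ennreal (cmod z ^ (2 * k) * (1 - (cmod z)\<^sup>2)) * indicator (cball 0 r) z) \<partial>disc_area))"
      using cb by (subst nn_integral_cmult) auto
    also have "\<dots> = (\<integral>\<^sup>+z. (\<Sum>k. ennreal ((cmod (?c k))\<^sup>2) *
        (ennreal (cmod z ^ (2 * k) * (1 - (cmod z)\<^sup>2)) * indicator (cball 0 r) z)) \<partial>disc_area)"
      using cb by (intro nn_integral_suminf[symmetric]) auto
    also have "\<dots> = (\<integral>\<^sup>+z. ?G z * indicator (cball 0 r) z \<partial>disc_area)"
      by (intro nn_integral_cong) (simp add: mult.assoc[symmetric] ennreal_suminf_multc)
    finally show ?thesis .
  qed
  have "(\<integral>\<^sup>+z. ?L z \<partial>disc_area) = (\<integral>\<^sup>+z. ?G z \<partial>disc_area)"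
    unfolding nn_integral_disc_exhaust[OF sets_disc_area mL] nn_integral_disc_exhaust[OF sets_disc_area mG]
    by (subst eq) auto
  also have "\<dots> = (\<Sum>k. (\<integral>\<^sup>+z. ennreal ((cmod (?c k))\<^sup>2) * ennreal (cmod z ^ (2 * k) * (1 - (cmod z)\<^sup>2)) \<partial>disc_area))"
    by (rule nn_integral_suminf) measurable
  also have "\<dots> = (\<Sum>k. ennreal ((cmod (?c k))\<^sup>2) * ennreal (1 / ((real k + 1) * (real k + 2))))"
    by (subst nn_integral_cmult[OF mE]) (simp only: integral_disc_area_radial)
  also have "\<dots> = (\<Sum>k. ennreal ((cmod (?c k))\<^sup>2 / ((real k + 1) * (real k + 2))))"
    by (simp add: ennreal_mult[symmetric])
  finally show ?thesis .
qed

section \<open>The local Dirichlet integral\<close>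

lemma average_step:
  "(cmod ((of_nat k + 2) * a - (of_nat k + 1) * b))\<^sup>2 =
     (real k + 1) * (real k + 2) * (cmod (b - a))\<^sup>2 + (real k + 2) * (cmod a)\<^sup>2 - (real k + 1) * (cmod b)\<^sup>2"
  unfolding cmod_power2 by (simp add: power2_eq_square algebra_simps)

text \<open>The assumption says that \<open>m\<close> is the sequence of averages of
  \<open>\<gamma>\<close>. By \<open>average_step\<close> with \<open>a = m (Suc k)\<close> and
  \<open>b = m k\<close>, each weighted squared difference is \<open>|\<gamma> (Suc k)|^2\<close>
  plus a telescoping term, whose first value is \<open>|\<gamma> 0|^2\<close> and whose last value
  is subtracted.\<close>

lemma average_identity:
  fixes m :: "nat \<Rightarrow> complex"
  assumes "\<gamma> 0 = m 0" "\<And>k. \<gamma> (Suc k) = (of_nat k + 2) * m (Suc k) - (of_nat k + 1) * m k"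
  shows "(\<Sum>k<N. (real k + 1) * (real k + 2) * (cmod (m k - m (Suc k)))\<^sup>2) =
     (\<Sum>k<Suc N. (cmod (\<gamma> k))\<^sup>2) - (real N + 1) * (cmod (m N))\<^sup>2"
proof (induction N)
  case 0 then show ?case using assms(1) by simp
next
  case (Suc N)
  have "(\<Sum>k<Suc N. (real k + 1) * (real k + 2) * (cmod (m k - m (Suc k)))\<^sup>2) =
      (\<Sum>k<Suc N. (cmod (\<gamma> k))\<^sup>2) - (real N + 1) * (cmod (m N))\<^sup>2
        + (real N + 1) * (real N + 2) * (cmod (m N - m (Suc N)))\<^sup>2"
    by (simp add: Suc)
  also have "\<dots> = (\<Sum>k<Suc N. (cmod (\<gamma> k))\<^sup>2) + (cmod (\<gamma> (Suc N)))\<^sup>2 - (real N + 2) * (cmod (m (Suc N)))\<^sup>2"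
    unfolding assms(2) average_step by simp
  finally show ?case by (simp add: algebra_simps)
qed

text \<open>Makes the boundary term of \<open>average_identity\<close> vanish in the limit. A fixed
  head of the sum contributes \<open>O(1 / N)\<close>; for the rest, Cauchy-Schwarz produces a
  factor that the denominator \<open>N + 1\<close> cancels, and the small tail of the square sum
  remains.\<close>

lemma average_l2_tendsto_0:
  fixes \<gamma> :: "nat \<Rightarrow> complex"
  assumes sm: "summable (\<lambda>k. (cmod (\<gamma> k))\<^sup>2)"
  shows "(\<lambda>N. (real N + 1) * (cmod ((\<Sum>i<Suc N. \<gamma> i) / (of_nat N + 1)))\<^sup>2) \<longlonglongrightarrow> 0"
proof (rule LIMSEQ_I)
  fix e :: real assume e: "0 < e"
  \<comment> \<open>A quarter of \<open>e\<close>, because splitting the square into head and tail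
    doubles the tail, and the head takes the other half of \<open>e\<close>.\<close>
  obtain M where M: "\<And>n. norm (\<Sum>k = M..<n. (cmod (\<gamma> k))\<^sup>2) < e / 4"
  proof -
    from sm[unfolded summable_Cauchy, rule_format, of "e / 4"] e
    obtain M where "\<forall>m\<ge>M. \<forall>n. norm (\<Sum>k = m..<n. (cmod (\<gamma> k))\<^sup>2) < e / 4" by auto
    then show ?thesis using that by blast
  qed
  let ?A = "2 * (cmod (\<Sum>i<M. \<gamma> i))\<^sup>2"
  obtain N0 :: nat where N0: "2 * ?A / e < real N0" using reals_Archimedean2 by blast
  show "\<exists>no. \<forall>n\<ge>no. norm ((real n + 1) * (cmod ((\<Sum>i<Suc n. \<gamma> i) / (of_nat n + 1)))\<^sup>2 - 0) < e"
  proof (intro exI allI impI)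
    fix n assume n: "max M N0 \<le> n"
    have S: "(\<Sum>i<Suc n. \<gamma> i) = (\<Sum>i<M. \<gamma> i) + (\<Sum>i=M..<Suc n. \<gamma> i)"
      using n by (simp only: lessThan_atLeast0) (subst sum.atLeastLessThan_concat, auto)
    have "(cmod (\<Sum>i=M..<Suc n. \<gamma> i))\<^sup>2 \<le> (\<Sum>i=M..<Suc n. cmod (\<gamma> i))\<^sup>2"
      by (intro power_mono norm_sum) simp
    also have "\<dots> \<le> (\<Sum>i=M..<Suc n. (cmod (\<gamma> i))\<^sup>2) * card {M..<Suc n}"
      by (rule sum_squared_le_sum_of_squares)
    also have "\<dots> \<le> e / 4 * (real n + 1)"
      using M[of "Suc n"] e by (intro mult_mono) (auto simp: sum_nonneg)
    finally have T: "(cmod (\<Sum>i=M..<Suc n. \<gamma> i))\<^sup>2 \<le> e / 4 * (real n + 1)" .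
    have c: "cmod (of_nat n + 1) = real n + 1"
      by (metis norm_of_nat of_nat_Suc add.commute)
    have "(real n + 1) * (cmod ((\<Sum>i<Suc n. \<gamma> i) / (of_nat n + 1)))\<^sup>2 = (cmod (\<Sum>i<Suc n. \<gamma> i))\<^sup>2 / (real n + 1)"
      unfolding norm_divide c by (simp add: power2_eq_square)
    also have "\<dots> \<le> (?A + 2 * (e / 4 * (real n + 1))) / (real n + 1)"
      unfolding S using cmod_add_squared_le[of "\<Sum>i<M. \<gamma> i" "\<Sum>i=M..<Suc n. \<gamma> i"] T
      by (intro divide_right_mono) auto
    also have "\<dots> = ?A / (real n + 1) + e / 2" by (simp add: field_simps)
    also have "?A / (real n + 1) < e / 2"
    proof -
      have "2 * ?A < e * real N0" using N0 e by (simp add: field_simps)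
      also have "\<dots> \<le> e * (real n + 1)" using n e by (intro mult_left_mono) auto
      finally show ?thesis by (simp add: field_simps)
    qed
    finally show "norm ((real n + 1) * (cmod ((\<Sum>i<Suc n. \<gamma> i) / (of_nat n + 1)))\<^sup>2 - 0) < e"
      by simp
  qed
qed

section \<open>The local Dirichlet integral as a coefficient series\<close>

lemma taylor_linear_factor:
  assumes "h holomorphic_on unit_disc"
  shows "taylor_coeff (\<lambda>z. (l - z) * h z) 0 = l * taylor_coeff h 0"
    "taylor_coeff (\<lambda>z. (l - z) * h z) (Suc k) = l * taylor_coeff h (Suc k) - taylor_coeff h k"
proof -
  have eq: "(\<lambda>z. (l - z) * h z) = (\<lambda>z. l * h z - z * h z)" by (auto simp: algebra_simps)
  have h: "(\<lambda>z. l * h z) holomorphic_on unit_disc" "(\<lambda>z. z * h z) holomorphic_on unit_disc"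
    using assms by (auto intro!: holomorphic_on_mult)
  show "taylor_coeff (\<lambda>z. (l - z) * h z) 0 = l * taylor_coeff h 0"
    "taylor_coeff (\<lambda>z. (l - z) * h z) (Suc k) = l * taylor_coeff h (Suc k) - taylor_coeff h k"
    unfolding eq taylor_diff[OF h] taylor_cmult[OF assms] taylor_mult_z[OF assms] by simp_all
qed

lemma unit_circle_neq_disc: "cmod l = 1 \<Longrightarrow> cmod z < 1 \<Longrightarrow> l - z \<noteq> 0"
  by auto

text \<open>On the disc, \<open>|deriv f|^2\<close> times the Poisson kernel at \<open>l\<close> is
  the squared modulus of this function times \<open>1 - |z|^2\<close>, the weight treated in
  \<open>area_parseval\<close>.\<close>

definition dirichlet_quotient :: "complex \<Rightarrow> (complex \<Rightarrow> complex) \<Rightarrow> complex \<Rightarrow> complex" where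
  "dirichlet_quotient l f z = deriv f z / (l - z)"

lemma holomorphic_dirichlet_quotient:
  assumes "f holomorphic_on unit_disc" "cmod l = 1"
  shows "dirichlet_quotient l f holomorphic_on unit_disc"
  unfolding dirichlet_quotient_def
  by (intro holomorphic_on_divide holomorphic_deriv assms open_ball holomorphic_intros)
    (use unit_circle_neq_disc[OF assms(2)] in auto)

lemma taylor_dirichlet_quotient:
  assumes f: "f holomorphic_on unit_disc" and l: "cmod l = 1"
  shows "taylor_coeff f 1 = l * taylor_coeff (dirichlet_quotient l f) 0"
    "(of_nat k + 2) * taylor_coeff f (Suc (Suc k)) =
       l * taylor_coeff (dirichlet_quotient l f) (Suc k) - taylor_coeff (dirichlet_quotient l f) k"
proof -
  note hol = holomorphic_dirichlet_quotient[OF f l]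
  have eq: "taylor_coeff (\<lambda>z. (l - z) * dirichlet_quotient l f z) j = taylor_coeff (deriv f) j" for j
    by (rule taylor_cong[OF holomorphic_deriv[OF f]])
      (use unit_circle_neq_disc[OF l] in \<open>auto simp: dirichlet_quotient_def\<close>)
  show "taylor_coeff f 1 = l * taylor_coeff (dirichlet_quotient l f) 0"
    using eq[of 0] taylor_linear_factor(1)[OF hol, of l] by (simp add: taylor_deriv)
  show "(of_nat k + 2) * taylor_coeff f (Suc (Suc k)) =
       l * taylor_coeff (dirichlet_quotient l f) (Suc k) - taylor_coeff (dirichlet_quotient l f) k"
    using eq[of "Suc k"] taylor_linear_factor(2)[OF hol, of l] by (simp add: taylor_deriv)
qed

text \<open>The Dirichlet integral for the unit point mass at \<open>l\<close>.\<close>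

definition local_dirichlet :: "complex \<Rightarrow> (complex \<Rightarrow> complex) \<Rightarrow> ennreal" where
  "local_dirichlet l f =
     (\<integral>\<^sup>+z. ennreal ((cmod (deriv f z))\<^sup>2 * ((1 - (cmod z)\<^sup>2) / (cmod (l - z))\<^sup>2)) \<partial>disc_area)"

lemma local_dirichlet_series:
  assumes "f holomorphic_on unit_disc" "cmod l = 1"
  shows "local_dirichlet l f =
    (\<Sum>k. ennreal ((cmod (taylor_coeff (dirichlet_quotient l f) k))\<^sup>2 / ((real k + 1) * (real k + 2))))"
proof -
  have "local_dirichlet l f = (\<integral>\<^sup>+z. ennreal ((cmod (dirichlet_quotient l f z))\<^sup>2 * (1 - (cmod z)\<^sup>2)) \<partial>disc_area)"
    unfolding local_dirichlet_def dirichlet_quotient_def norm_divide power_divide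
    by (simp only: times_divide_eq_left times_divide_eq_right)
  also have "\<dots> = (\<Sum>k. ennreal ((cmod (taylor_coeff (dirichlet_quotient l f) k))\<^sup>2 / ((real k + 1) * (real k + 2))))"
    by (rule area_parseval[OF holomorphic_dirichlet_quotient[OF assms]])
  finally show ?thesis .
qed

text \<open>If \<open>f = c + (z - l) g\<close> and \<open>\<gamma> k\<close> is the \<open>k\<close>-th coefficient of \<open>g\<close> times \<open>l ^ k\<close>, then \<open>m\<close> is the
  sequence of averages of \<open>\<gamma>\<close>.\<close>

lemma dirichlet_quotient_averages:
  assumes f: "f holomorphic_on unit_disc" and l: "cmod l = 1"
    and m: "\<gamma> 0 = m 0" "\<And>k. \<gamma> (Suc k) = (of_nat k + 2) * m (Suc k) - (of_nat k + 1) * m k"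
    and coef: "\<And>k. taylor_coeff f (Suc k) * l ^ k = \<gamma> k - \<gamma> (Suc k)"
  shows "taylor_coeff (dirichlet_quotient l f) k * l ^ Suc k =
    (of_nat k + 1) * (of_nat k + 2) * (m k - m (Suc k))"
proof (induction k)
  case 0
  show ?case using taylor_dirichlet_quotient(1)[OF f l] coef[of 0] m(1) m(2)[of 0] by (simp add: algebra_simps)
next
  case (Suc k)
  let ?c = "taylor_coeff (dirichlet_quotient l f)"
  have "?c (Suc k) * l ^ Suc (Suc k) = (l * ?c (Suc k) - ?c k) * l ^ Suc k + ?c k * l ^ Suc k"
    by (simp add: algebra_simps)
  also have "\<dots> = (of_nat k + 2) * (taylor_coeff f (Suc (Suc k)) * l ^ Suc k) + ?c k * l ^ Suc k"
    unfolding taylor_dirichlet_quotient(2)[OF f l, symmetric] by (simp only: mult.assoc)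
  also have "\<dots> = (of_nat k + 2) * (\<gamma> (Suc k) - \<gamma> (Suc (Suc k))) + (of_nat k + 1) * (of_nat k + 2) * (m k - m (Suc k))"
    by (simp only: coef Suc)
  also have "\<dots> = (of_nat (Suc k) + 1) * (of_nat (Suc k) + 2) * (m (Suc k) - m (Suc (Suc k)))"
    unfolding m by (simp add: algebra_simps)
  finally show ?case .
qed

lemma taylor_dirichlet_quotient_sq:
  assumes "taylor_coeff (dirichlet_quotient l f) k * l ^ Suc k =
    (of_nat k + 1) * (of_nat k + 2) * (m k - m (Suc k))" and l: "cmod l = 1"
  shows "(cmod (taylor_coeff (dirichlet_quotient l f) k))\<^sup>2 / ((real k + 1) * (real k + 2)) =
    (real k + 1) * (real k + 2) * (cmod (m k - m (Suc k)))\<^sup>2"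
proof -
  have "cmod (taylor_coeff (dirichlet_quotient l f) k) = cmod (taylor_coeff (dirichlet_quotient l f) k * l ^ Suc k)"
    using l by (simp add: norm_mult norm_power)
  also have "\<dots> = (real k + 1) * (real k + 2) * cmod (m k - m (Suc k))"
  proof -
    have "cmod (of_nat k + 1) = real k + 1" "cmod (of_nat k + 2) = real k + 2"
      using norm_of_nat[of "k + 1"] norm_of_nat[of "k + 2"] by (simp_all only: of_nat_add of_nat_1 of_nat_numeral)
    then show ?thesis unfolding assms(1) norm_mult by simp
  qed
  finally show ?thesis by (simp add: power2_eq_square)
qed

lemma taylor_linear_decomposition:
  assumes g: "g holomorphic_on unit_disc" and f: "\<And>z. cmod z < 1 \<Longrightarrow> f z = c + (z - l) * g z"
  shows "f holomorphic_on unit_disc" "taylor_coeff f (Suc k) = taylor_coeff g k - l * taylor_coeff g (Suc k)"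
proof -
  have hol: "(\<lambda>z. c + (-1) * ((l - z) * g z)) holomorphic_on unit_disc"
    using g by (intro holomorphic_intros)
  have feq: "f z = c + (-1) * ((l - z) * g z)" if "cmod z < 1" for z
    using f[OF that] by (simp add: algebra_simps)
  have "f holomorphic_on unit_disc \<longleftrightarrow> (\<lambda>z. c + (-1) * ((l - z) * g z)) holomorphic_on unit_disc"
    by (intro holomorphic_cong) (auto simp: feq)
  with hol show "f holomorphic_on unit_disc" by blast
  have hc: "(\<lambda>_. c) holomorphic_on unit_disc" and hg: "(\<lambda>z. (l - z) * g z) holomorphic_on unit_disc"
    "(\<lambda>z. (-1) * ((l - z) * g z)) holomorphic_on unit_disc"
    using g by (auto intro!: holomorphic_intros)
  have "taylor_coeff f (Suc k) = taylor_coeff (\<lambda>z. c + (-1) * ((l - z) * g z)) (Suc k)"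
    by (rule taylor_cong[OF hol]) (simp add: feq)
  also have "\<dots> = taylor_coeff g k - l * taylor_coeff g (Suc k)"
    unfolding taylor_add[OF hc hg(2)] taylor_cmult[OF hg(1)] taylor_linear_factor(2)[OF g] taylor_const by simp
  finally show "taylor_coeff f (Suc k) = taylor_coeff g k - l * taylor_coeff g (Suc k)" .
qed

text \<open>The Richter-Sundberg formula, with \<open>c\<close> in the role of the boundary value of
  \<open>f\<close> at \<open>l\<close>. The Parseval series of \<open>dirichlet_quotient\<close> and
  the square sum of \<open>g\<close> have the same partial sums up to an index shift and the
  boundary term of the averages, which tends to zero.\<close>

lemma local_dirichlet_eq:
  assumes l: "cmod l = 1" and g: "g \<in> H2" and f: "\<And>z. cmod z < 1 \<Longrightarrow> f z = c + (z - l) * g z"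
  shows "local_dirichlet l f = ennreal (H2.sqnorm g)"
proof -
  have gh: "g holomorphic_on unit_disc" using g by (simp add: H2_def)
  have fh: "f holomorphic_on unit_disc" using taylor_linear_decomposition(1)[OF gh f] .
  define \<gamma> where "\<gamma> k = taylor_coeff g k * l ^ k" for k
  define m where "m N = (\<Sum>i<Suc N. \<gamma> i) / (of_nat N + 1)" for N
  have nz: "(of_nat k + 1 :: complex) \<noteq> 0" "(of_nat k + 2 :: complex) \<noteq> 0" for k
    by (metis of_nat_Suc of_nat_neq_0 add.commute) (metis of_nat_add of_nat_numeral of_nat_eq_0_iff add_is_0 zero_neq_numeral)
  have m0: "\<gamma> 0 = m 0" by (simp add: m_def)
  have mS: "\<gamma> (Suc k) = (of_nat k + 2) * m (Suc k) - (of_nat k + 1) * m k" for k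
  proof -
    have "(of_nat k + 2) * m (Suc k) = (\<Sum>i<Suc (Suc k). \<gamma> i)"
    proof -
      have "of_nat (Suc k) + 1 = (of_nat k + 2 :: complex)" by simp
      then show ?thesis using nz(2)[of k] unfolding m_def by (simp only:) simp
    qed
    moreover have "(of_nat k + 1) * m k = (\<Sum>i<Suc k. \<gamma> i)"
      using nz(1)[of k] by (simp add: m_def)
    ultimately show ?thesis by simp
  qed
  have coef: "taylor_coeff f (Suc k) * l ^ k = \<gamma> k - \<gamma> (Suc k)" for k
  proof -
    have "taylor_coeff f (Suc k) = taylor_coeff g k - l * taylor_coeff g (Suc k)"
      by (rule taylor_linear_decomposition(2)[OF gh f])
    then show ?thesis unfolding \<gamma>_def by (simp only:) (simp add: algebra_simps)
  qed
  have \<gamma>n: "cmod (\<gamma> k) = cmod (taylor_coeff g k)" for k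
    using l by (simp add: \<gamma>_def norm_mult norm_power)
  note c = taylor_dirichlet_quotient_sq[OF dirichlet_quotient_averages[OF fh l m0 mS coef] l]
  have sums: "(\<lambda>k. (cmod (\<gamma> k))\<^sup>2) sums H2.sqnorm g"
    unfolding \<gamma>n by (rule H2_sqnorm_sums[OF g])
  have "(\<lambda>N. (\<Sum>k<Suc N. (cmod (\<gamma> k))\<^sup>2) - (real N + 1) * (cmod (m N))\<^sup>2) \<longlonglongrightarrow> H2.sqnorm g - 0"
    using average_l2_tendsto_0[OF sums_summable[OF sums]] sums unfolding m_def
    by (intro tendsto_diff) (auto simp: sums_def dest: LIMSEQ_Suc)
  then have "(\<lambda>k. (real k + 1) * (real k + 2) * (cmod (m k - m (Suc k)))\<^sup>2) sums H2.sqnorm g"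
    unfolding average_identity[OF m0 mS, symmetric] sums_def by simp
  then show ?thesis
    unfolding local_dirichlet_series[OF fh l] c
    by (intro suminf_ennreal_eq) auto
qed

text \<open>Runs the averaging argument backwards. Finiteness makes \<open>\<Delta>\<close> square
  summable with weight \<open>(k + 1) (k + 2)\<close>. As the reciprocal weights have tail sums
  \<open>1 / (N + 1)\<close>, Cauchy-Schwarz shows that the tails of \<open>\<Delta>\<close> define
  averages \<open>m\<close> with \<open>(N + 1) |m N|^2\<close> bounded, and
  \<open>average_identity\<close> then bounds the square sum of \<open>\<gamma>\<close>.\<close>

lemma local_dirichlet_finite_imp:
  assumes l: "cmod l = 1" and f: "f holomorphic_on unit_disc" and fin: "local_dirichlet l f < \<infinity>"
  obtains c g where "g \<in> H2" "\<And>z. cmod z < 1 \<Longrightarrow> f z = c + (z - l) * g z"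
proof -
  let ?c = "taylor_coeff (dirichlet_quotient l f)"
  \<comment> \<open>The value that \<open>dirichlet_quotient_averages\<close> forces on
    \<open>m k - m (Suc k)\<close>.\<close>
  define \<Delta> where "\<Delta> k = ?c k * l ^ Suc k / ((of_nat k + 1) * (of_nat k + 2))" for k
  have nz: "(of_nat k + 1 :: complex) \<noteq> 0" "(of_nat k + 2 :: complex) \<noteq> 0" for k
    by (metis of_nat_Suc of_nat_neq_0 add.commute) (metis of_nat_add of_nat_numeral of_nat_eq_0_iff add_is_0 zero_neq_numeral)
  have nn: "cmod (of_nat k + 1) = real k + 1" "cmod (of_nat k + 2) = real k + 2" for k
    using norm_of_nat[of "k + 1"] norm_of_nat[of "k + 2"] by (simp_all only: of_nat_add of_nat_1 of_nat_numeral)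
  let ?w = "\<lambda>k. (real k + 1) * (real k + 2) * (cmod (\<Delta> k))\<^sup>2"
  have w: "(cmod (?c k))\<^sup>2 / ((real k + 1) * (real k + 2)) = ?w k" for k
  proof -
    have "cmod (\<Delta> k) = cmod (?c k) / ((real k + 1) * (real k + 2))"
      unfolding \<Delta>_def norm_divide norm_mult norm_power nn l by simp
    then show ?thesis by (simp add: power2_eq_square)
  qed
  have sw: "summable ?w"
    using fin unfolding local_dirichlet_series[OF f l] w by (intro summable_suminf_not_top) auto
  define T where "T = suminf ?w"
  have tele: "(\<Sum>i<M. 1 / ((real (i + N) + 1) * (real (i + N) + 2))) = 1 / (real N + 1) - 1 / (real (M + N) + 1)" for M N
  proof (induction M)
    case (Suc M)
    have "1 / (x + 1) = 1 / ((x + 1) * (x + 2)) + 1 / (x + 2)" if "x \<ge> 0" for x :: real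
      using that by (simp add: divide_simps)
    from this[of "real (M + N)"] have "1 / (real (M + N) + 1) =
        1 / ((real (M + N) + 1) * (real (M + N) + 2)) + 1 / (real (M + N) + 2)" by simp
    moreover have "real (Suc M + N) + 1 = real (M + N) + 2" by simp
    ultimately show ?case unfolding sum.lessThan_Suc Suc by (simp only:)
  qed simp
  have wT: "(\<Sum>i<M. ?w (i + N)) \<le> T" for M N
  proof -
    have "(\<Sum>i<M. ?w (i + N)) = sum ?w {N..<M + N}"
      using sum.shift_bounds_nat_ivl[of ?w 0 N M] by (simp add: lessThan_atLeast0)
    also have "\<dots> \<le> T" unfolding T_def by (intro sum_le_suminf sw) auto
    finally show ?thesis .
  qed
  have T0: "0 \<le> T" using wT[where M = 0 and N = 0] by simp
  have partial: "(\<Sum>i<M. cmod (\<Delta> (i + N)))\<^sup>2 \<le> T / (real N + 1)" for M N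
  proof -
    let ?a = "\<lambda>i. sqrt ((real (i + N) + 1) * (real (i + N) + 2))"
    have "(\<Sum>i<M. cmod (\<Delta> (i + N)))\<^sup>2 = (\<Sum>i<M. (?a i * cmod (\<Delta> (i + N))) * (1 / ?a i))\<^sup>2"
      by (intro arg_cong[of _ _ "\<lambda>x. x\<^sup>2"] sum.cong refl) (simp add: real_sqrt_mult)
    also have "\<dots> \<le> (\<Sum>i<M. (?a i * cmod (\<Delta> (i + N)))\<^sup>2) * (\<Sum>i<M. (1 / ?a i)\<^sup>2)"
      by (rule Cauchy_Schwarz_ineq_sum)
    also have "(\<Sum>i<M. (?a i * cmod (\<Delta> (i + N)))\<^sup>2) = (\<Sum>i<M. ?w (i + N))"
      by (simp add: power_mult_distrib)
    also have "(\<Sum>i<M. (1 / ?a i)\<^sup>2) = (\<Sum>i<M. 1 / ((real (i + N) + 1) * (real (i + N) + 2)))"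
      by (simp add: power_divide)
    also have "(\<Sum>i<M. ?w (i + N)) * \<dots> \<le> T * (1 / (real N + 1))"
      unfolding tele by (intro mult_mono wT T0) (auto simp: divide_simps)
    finally show ?thesis by simp
  qed
  have s\<Delta>': "summable (\<lambda>k. cmod (\<Delta> k))"
  proof (rule summableI_nonneg_bounded)
    fix M
    have "(\<Sum>i<M. cmod (\<Delta> i))\<^sup>2 \<le> T" using partial[where M = M and N = 0] by simp
    then show "(\<Sum>i<M. cmod (\<Delta> i)) \<le> sqrt T" by (rule real_le_rsqrt)
  qed simp
  then have s\<Delta>: "summable \<Delta>" by (rule summable_norm_cancel)
  \<comment> \<open>The differences determine \<open>m\<close> up to an additive constant; the tail
    sum is the choice that tends to zero, as averages of a square summable sequence do.\<close>
  define m where "m N = (\<Sum>k. \<Delta> (k + N))" for N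
  have m_step: "m k - m (Suc k) = \<Delta> k" for k
    using suminf_split_head[of "\<lambda>i. \<Delta> (i + k)"] s\<Delta> by (simp add: m_def summable_iff_shift)
  have m_bound: "(real N + 1) * (cmod (m N))\<^sup>2 \<le> T" for N
  proof -
    have "(\<lambda>M. (cmod (\<Sum>i<M. \<Delta> (i + N)))\<^sup>2) \<longlonglongrightarrow> (cmod (m N))\<^sup>2"
      unfolding m_def using s\<Delta> by (intro tendsto_intros summable_LIMSEQ) (simp add: summable_iff_shift)
    moreover have "(cmod (\<Sum>i<M. \<Delta> (i + N)))\<^sup>2 \<le> T / (real N + 1)" for M
      by (rule order_trans[OF power_mono[OF norm_sum] partial]) simp
    ultimately have "(cmod (m N))\<^sup>2 \<le> T / (real N + 1)"
      by (intro LIMSEQ_le_const2) auto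
    then show ?thesis by (simp add: field_simps)
  qed
  define \<gamma> where "\<gamma> k = (case k of 0 \<Rightarrow> m 0 | Suc j \<Rightarrow> (of_nat j + 2) * m (Suc j) - (of_nat j + 1) * m j)" for k
  have \<gamma>: "\<gamma> 0 = m 0" "\<And>k. \<gamma> (Suc k) = (of_nat k + 2) * m (Suc k) - (of_nat k + 1) * m k"
    by (auto simp: \<gamma>_def)
  have s\<gamma>: "summable (\<lambda>k. (cmod (\<gamma> k))\<^sup>2)"
  proof (rule summableI_nonneg_bounded)
    fix N
    have "(\<Sum>k<N. (cmod (\<gamma> k))\<^sup>2) \<le> (\<Sum>k<Suc N. (cmod (\<gamma> k))\<^sup>2)" by simp
    also have "\<dots> = (\<Sum>k<N. ?w k) + (real N + 1) * (cmod (m N))\<^sup>2"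
      using average_identity[OF \<gamma>, of N] by (simp add: m_step)
    also have "\<dots> \<le> T + T" using wT[where M = N and N = 0] m_bound[of N] by simp
    finally show "(\<Sum>k<N. (cmod (\<gamma> k))\<^sup>2) \<le> T + T" .
  qed simp
  define g where "g z = (\<Sum>k. (\<gamma> k / l ^ k) * z ^ k)" for z
  have gs: "(\<lambda>k. (\<gamma> k / l ^ k) * z ^ k) sums g z" if z: "cmod z < 1" for z
  proof -
    have "summable (\<lambda>k. (\<gamma> k / l ^ k) * cnj (cnj (z ^ k)))"
    proof (rule l2_summable_prod)
      show "summable (\<lambda>k. (cmod (\<gamma> k / l ^ k))\<^sup>2)" using s\<gamma> l by (simp add: norm_divide norm_power)
      show "summable (\<lambda>k. (cmod (cnj (z ^ k)))\<^sup>2)"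
        using summable_geometric[of "(cmod z)\<^sup>2"] sq_less_1[OF z]
        by (simp add: norm_power power_mult[symmetric] mult.commute)
    qed
    then show ?thesis unfolding g_def by (simp add: summable_sums)
  qed
  have lnz: "l ^ k \<noteq> 0" for k using l by auto
  have g: "g holomorphic_on unit_disc" "\<And>k. taylor_coeff g k = \<gamma> k / l ^ k"
    using taylor_unique[of "\<lambda>k. \<gamma> k / l ^ k" g] gs by blast+
  have gH: "g \<in> H2" using g s\<gamma> l by (simp add: H2_def norm_divide norm_power)
  \<comment> \<open>Forced by evaluating \<open>f = c + (z - l) g\<close> at
    \<open>0\<close>.\<close>
  define c where "c = f 0 + l * g 0"
  let ?h = "\<lambda>z. c + (z - l) * g z"
  have hol: "?h holomorphic_on unit_disc" by (rule taylor_linear_decomposition(1)[OF g(1) refl])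
  have c\<Delta>: "?c k * l ^ Suc k = (of_nat k + 1) * (of_nat k + 2) * \<Delta> k" for k
    using nz[of k] by (simp add: \<Delta>_def)
  have hS: "taylor_coeff ?h (Suc k) * l ^ k = \<gamma> k - \<gamma> (Suc k)" for k
    unfolding taylor_linear_decomposition(2)[OF g(1) refl] g(2) using lnz[of k] lnz[of "Suc k"] l
    by (simp add: field_simps)
  have fS: "taylor_coeff f (Suc k) * l ^ k = \<gamma> k - \<gamma> (Suc k)" for k
  proof (cases k)
    case 0
    have "taylor_coeff f (Suc 0) = ?c 0 * l ^ Suc 0"
      using taylor_dirichlet_quotient(1)[OF f l] by simp
    also have "\<dots> = \<gamma> 0 - \<gamma> (Suc 0)"
      unfolding c\<Delta> m_step[symmetric] \<gamma> by (simp add: algebra_simps)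
    finally show ?thesis using 0 by simp
  next
    case (Suc j)
    have "(of_nat j + 2) * (taylor_coeff f (Suc (Suc j)) * l ^ Suc j) = ?c (Suc j) * l ^ Suc (Suc j) - ?c j * l ^ Suc j"
      unfolding mult.assoc[symmetric] taylor_dirichlet_quotient(2)[OF f l] by (simp add: algebra_simps)
    also have "\<dots> = (of_nat j + 2) * (\<gamma> (Suc j) - \<gamma> (Suc (Suc j)))"
      unfolding c\<Delta> m_step[symmetric] \<gamma> by (simp add: algebra_simps)
    finally show ?thesis using nz(2)[of j] Suc by simp
  qed
  have "taylor_coeff f = taylor_coeff ?h"
  proof
    fix k show "taylor_coeff f k = taylor_coeff ?h k"
    proof (cases k)
      case 0 then show ?thesis by (simp add: taylor_0 c_def)
    next
      case (Suc j)
      then show ?thesis using hS[of j] fS[of j] lnz[of j] by (metis mult_right_cancel)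
    qed
  qed
  then have "f z = ?h z" if "cmod z < 1" for z by (intro taylor_eqD[OF f hol _ that])
  with gH show ?thesis using that by blast
qed

section \<open>Dirichlet-type spaces of finitely supported measures\<close>

text \<open>The atoms form a set: equal members of the family \<open>lam\<close> are merged and
  their weights added, which keeps the zeros of the polynomial \<open>p\<close> simple. The measure
  enters through its Poisson integral.\<close>

locale atomic_dirichlet =
  fixes \<mu> :: "complex measure" and Lam :: "complex set" and a :: "complex \<Rightarrow> real"
  assumes finite_Lam: "finite Lam" and Lam_nonempty: "Lam \<noteq> {}"
    and Lam_circle: "l \<in> Lam \<Longrightarrow> cmod l = 1"
    and weight_pos: "l \<in> Lam \<Longrightarrow> 0 < a l"
    and poisson_eq: "cmod z < 1 \<Longrightarrow> poisson \<mu> z = (\<Sum>l\<in>Lam. a l * ((1 - (cmod z)\<^sup>2) / (cmod (l - z))\<^sup>2))"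
begin

abbreviation "D \<equiv> dirichlet_space \<mu>"

text \<open>Decomposes \<open>f\<close> at all atoms at once. Such data exist exactly for the
  members of the space (\<open>represents_imp\<close>, \<open>representation_exists\<close>), so
  area integrals can be replaced by Hardy norms throughout.\<close>

definition represents :: "(complex \<Rightarrow> complex) \<Rightarrow> (complex \<Rightarrow> complex) \<Rightarrow> (complex \<Rightarrow> complex \<Rightarrow> complex) \<Rightarrow> bool" where
  "represents f c g \<longleftrightarrow> (\<forall>l\<in>Lam. g l \<in> H2 \<and> (\<forall>z. cmod z < 1 \<longrightarrow> f z = c l + (z - l) * g l z))"

lemma representsD:
  assumes "represents f c g" "l \<in> Lam"
  shows "g l \<in> H2" "cmod z < 1 \<Longrightarrow> f z = c l + (z - l) * g l z"
  using assms by (auto simp: represents_def)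

lemma represents_add:
  "represents f c g \<Longrightarrow> represents f' c' g' \<Longrightarrow>
    represents (\<lambda>z. f z + f' z) (\<lambda>l. c l + c' l) (\<lambda>l z. g l z + g' l z)"
  unfolding represents_def by (simp add: H2_add distrib_left)

lemma represents_cmult:
  "represents f c g \<Longrightarrow> represents (\<lambda>z. b * f z) (\<lambda>l. b * c l) (\<lambda>l z. b * g l z)"
  unfolding represents_def by (simp add: H2_cmult distrib_left mult.left_commute)

lemma poisson_nonneg: "cmod z < 1 \<Longrightarrow> 0 \<le> poisson \<mu> z"
  unfolding poisson_eq using weight_pos sq_less_1[of z]
  by (intro sum_nonneg mult_nonneg_nonneg divide_nonneg_nonneg) (auto intro: less_imp_le)

lemma disc_area_measurable:
  "continuous_on unit_disc f \<Longrightarrow> f \<in> borel_measurable disc_area"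
  for f :: "complex \<Rightarrow> 'b::topological_space"
  by (subst measurable_cong_sets[OF sets_disc_area refl]) (rule continuous_disc_measurable)

lemma continuous_poisson_kernel:
  assumes "cmod l = 1"
  shows "continuous_on unit_disc (\<lambda>z. (1 - (cmod z)\<^sup>2) / (cmod (l - z))\<^sup>2)"
  using unit_circle_neq_disc[OF assms] by (intro continuous_intros) auto

lemma poisson_measurable: "(\<lambda>z. poisson \<mu> z) \<in> borel_measurable disc_area"
proof -
  have "(\<lambda>z. \<Sum>l\<in>Lam. a l * ((1 - (cmod z)\<^sup>2) / (cmod (l - z))\<^sup>2)) \<in> borel_measurable disc_area"
    by (intro disc_area_measurable continuous_intros continuous_poisson_kernel Lam_circle)
  also have "?this \<longleftrightarrow> ?thesis"
    by (intro measurable_cong) (simp add: poisson_eq)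
  finally show ?thesis .
qed

lemma deriv_measurable:
  "f holomorphic_on unit_disc \<Longrightarrow> deriv f \<in> borel_measurable disc_area"
  by (intro disc_area_measurable holomorphic_on_imp_continuous_on holomorphic_deriv open_ball)

lemma dirichlet_integral_sum:
  assumes f: "f holomorphic_on unit_disc"
  shows "dirichlet_integral \<mu> f = (\<Sum>l\<in>Lam. ennreal (a l) * local_dirichlet l f)"
proof -
  let ?k = "\<lambda>l z. (cmod (deriv f z))\<^sup>2 * ((1 - (cmod z)\<^sup>2) / (cmod (l - z))\<^sup>2)"
  have k0: "0 \<le> ?k l z" if "cmod z < 1" for l z
    using sq_less_1[OF that] by (intro mult_nonneg_nonneg divide_nonneg_nonneg) auto
  have m: "(\<lambda>z. ennreal (?k l z)) \<in> borel_measurable disc_area" if "l \<in> Lam" for l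
    using deriv_measurable[OF f] disc_area_measurable[OF continuous_poisson_kernel[OF Lam_circle[OF that]]]
    by measurable
  have "dirichlet_integral \<mu> f = (\<integral>\<^sup>+z. (\<Sum>l\<in>Lam. ennreal (a l) * ennreal (?k l z)) \<partial>disc_area)"
    unfolding dirichlet_integral_def
  proof (rule nn_integral_cong)
    fix z assume "z \<in> space disc_area"
    then have z: "cmod z < 1" by simp
    have "(cmod (deriv f z))\<^sup>2 * poisson \<mu> z = (\<Sum>l\<in>Lam. a l * ?k l z)"
      unfolding poisson_eq[OF z] sum_distrib_left by (simp add: mult_ac)
    also have "ennreal \<dots> = (\<Sum>l\<in>Lam. ennreal (a l * ?k l z))"
      by (rule sum_ennreal[symmetric]) (rule mult_nonneg_nonneg[OF less_imp_le[OF weight_pos] k0[OF z]])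
    also have "\<dots> = (\<Sum>l\<in>Lam. ennreal (a l) * ennreal (?k l z))"
      by (intro sum.cong refl ennreal_mult less_imp_le[OF weight_pos] k0[OF z])
    finally show "ennreal ((cmod (deriv f z))\<^sup>2 * poisson \<mu> z) = (\<Sum>l\<in>Lam. ennreal (a l) * ennreal (?k l z))" .
  qed
  also have "\<dots> = (\<Sum>l\<in>Lam. (\<integral>\<^sup>+z. ennreal (a l) * ennreal (?k l z) \<partial>disc_area))"
    by (intro nn_integral_sum borel_measurable_times_ennreal m) auto
  also have "\<dots> = (\<Sum>l\<in>Lam. ennreal (a l) * local_dirichlet l f)"
    unfolding local_dirichlet_def by (intro sum.cong refl nn_integral_cmult m)
  finally show ?thesis .
qed

lemma represents_imp:
  assumes r: "represents f c g"
  shows "f holomorphic_on unit_disc" "f \<in> H2" "f \<in> D"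
    "dirichlet_integral \<mu> f = ennreal (\<Sum>l\<in>Lam. a l * H2.sqnorm (g l))"
proof -
  obtain l0 where l0: "l0 \<in> Lam" using Lam_nonempty by blast
  have "(\<lambda>z. c l0 + (z - l0) * g l0 z) \<in> H2"
    using representsD(1)[OF r l0] Lam_circle[OF l0] by (intro H2_add H2_const H2_mult_linear)
  then show fH: "f \<in> H2"
    by (rule H2_cong(1)) (simp add: representsD(2)[OF r l0])
  then show hol: "f holomorphic_on unit_disc" by (simp add: H2_def)
  have "dirichlet_integral \<mu> f = (\<Sum>l\<in>Lam. ennreal (a l) * ennreal (H2.sqnorm (g l)))"
    unfolding dirichlet_integral_sum[OF hol]
    using local_dirichlet_eq[OF Lam_circle representsD(1)[OF r] representsD(2)[OF r]] by simp
  also have "\<dots> = (\<Sum>l\<in>Lam. ennreal (a l * H2.sqnorm (g l)))"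
    using representsD(1)[OF r] weight_pos
    by (intro sum.cong refl ennreal_mult[symmetric] H2.sqnorm_nonneg) (auto intro: less_imp_le)
  also have "\<dots> = ennreal (\<Sum>l\<in>Lam. a l * H2.sqnorm (g l))"
    using representsD(1)[OF r] weight_pos
    by (intro sum_ennreal mult_nonneg_nonneg H2.sqnorm_nonneg) (auto intro: less_imp_le)
  finally show eq: "dirichlet_integral \<mu> f = ennreal (\<Sum>l\<in>Lam. a l * H2.sqnorm (g l))" .
  then show "f \<in> D" using hol by (simp add: dirichlet_space_def)
qed

text \<open>Because the weights are positive, a finite Dirichlet integral makes the local integral
  at each atom finite.\<close>

lemma representation_exists:
  assumes "f \<in> D"
  obtains c g where "represents f c g"
proof -
  have hol: "f holomorphic_on unit_disc" and fin: "dirichlet_integral \<mu> f < \<infinity>"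
    using assms by (auto simp: dirichlet_space_def)
  have "\<exists>c g. g \<in> H2 \<and> (\<forall>z. cmod z < 1 \<longrightarrow> f z = c + (z - l) * g z)" if l: "l \<in> Lam" for l
  proof -
    have "ennreal (a l) * local_dirichlet l f \<le> dirichlet_integral \<mu> f"
      unfolding dirichlet_integral_sum[OF hol] using l finite_Lam by (intro member_le_sum) auto
    then have "ennreal (a l) * local_dirichlet l f < \<infinity>" using fin by (rule order_le_less_trans)
    then have "local_dirichlet l f < \<infinity>"
      using weight_pos[OF l] by (auto simp: ennreal_mult_less_top)
    from local_dirichlet_finite_imp[OF Lam_circle[OF l] hol this] show ?thesis by metis
  qed
  then obtain c g where "\<forall>l\<in>Lam. g l \<in> H2 \<and> (\<forall>z. cmod z < 1 \<longrightarrow> f z = c l + (z - l) * g l z)"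
    by metis
  then show ?thesis using that[of c g] unfolding represents_def by blast
qed

lemma D_imp:
  assumes "f \<in> D"
  shows "f holomorphic_on unit_disc" "f \<in> H2"
  using representation_exists[OF assms] represents_imp(1,2) by metis+

section \<open>The energy form and the inner product of the space\<close>

definition energy :: "(complex \<Rightarrow> complex) \<Rightarrow> (complex \<Rightarrow> complex) \<Rightarrow> complex" where
  "energy f g = (\<integral>z. deriv f z * cnj (deriv g z) * of_real (poisson \<mu> z) \<partial>disc_area)"

text \<open>The mixed integrand is dominated by the sum of the two diagonal ones.\<close>

lemma energy_integrable:
  assumes "f \<in> D" "g \<in> D"
  shows "integrable disc_area (\<lambda>z. deriv f z * cnj (deriv g z) * of_real (poisson \<mu> z))"
proof (rule Bochner_Integration.integrable_bound)
  have *: "integrable disc_area (\<lambda>z. (cmod (deriv h z))\<^sup>2 * poisson \<mu> z)" if "h \<in> D" for h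
  proof (rule integrableI_nonneg)
    show "(\<lambda>z. (cmod (deriv h z))\<^sup>2 * poisson \<mu> z) \<in> borel_measurable disc_area"
      using deriv_measurable[OF D_imp(1)[OF that]] poisson_measurable by measurable
    show "(\<integral>\<^sup>+z. ennreal ((cmod (deriv h z))\<^sup>2 * poisson \<mu> z) \<partial>disc_area) < \<infinity>"
      using that by (simp add: dirichlet_space_def dirichlet_integral_def)
  qed (use poisson_nonneg in auto)
  show "integrable disc_area (\<lambda>z. (cmod (deriv f z))\<^sup>2 * poisson \<mu> z + (cmod (deriv g z))\<^sup>2 * poisson \<mu> z)"
    by (intro Bochner_Integration.integrable_add * assms)
  show "(\<lambda>z. deriv f z * cnj (deriv g z) * of_real (poisson \<mu> z)) \<in> borel_measurable disc_area"
    by (intro borel_measurable_times measurable_compose[OF _ cnj_measurable] measurable_compose[OF _ of_real_measurable]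
        deriv_measurable D_imp assms poisson_measurable)
  show "AE z in disc_area. norm (deriv f z * cnj (deriv g z) * of_real (poisson \<mu> z))
      \<le> norm ((cmod (deriv f z))\<^sup>2 * poisson \<mu> z + (cmod (deriv g z))\<^sup>2 * poisson \<mu> z)"
  proof (intro AE_I2)
    fix z assume "z \<in> space disc_area"
    then have P: "0 \<le> poisson \<mu> z" using poisson_nonneg by simp
    have "cmod (deriv f z * cnj (deriv g z)) \<le> (cmod (deriv f z))\<^sup>2 + (cmod (deriv g z))\<^sup>2"
      by (rule order_trans[OF l2_prod_abs_le]) simp
    from mult_right_mono[OF this P]
    show "norm (deriv f z * cnj (deriv g z) * of_real (poisson \<mu> z))
      \<le> norm ((cmod (deriv f z))\<^sup>2 * poisson \<mu> z + (cmod (deriv g z))\<^sup>2 * poisson \<mu> z)"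
      using P by (simp add: norm_mult distrib_right)
  qed
qed

lemma D_add: "f \<in> D \<Longrightarrow> g \<in> D \<Longrightarrow> (\<lambda>z. f z + g z) \<in> D"
  by (metis representation_exists represents_add represents_imp(3))

lemma D_cmult: "f \<in> D \<Longrightarrow> (\<lambda>z. b * f z) \<in> D"
  by (metis representation_exists represents_cmult represents_imp(3))

lemma deriv_disc_add:
  assumes "f \<in> D" "g \<in> D" "cmod z < 1"
  shows "deriv (\<lambda>z. f z + g z) z = deriv f z + deriv g z"
  using D_imp(1)[OF assms(1)] D_imp(1)[OF assms(2)] assms(3)
  by (intro deriv_add) (auto intro: holomorphic_on_imp_differentiable_at)

lemma deriv_disc_cmult:
  assumes "f \<in> D" "cmod z < 1"
  shows "deriv (\<lambda>z. b * f z) z = b * deriv f z"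
  using D_imp(1)[OF assms(1)] assms(2)
  by (intro deriv_cmult) (auto intro: holomorphic_on_imp_differentiable_at)

lemma energy_self:
  assumes "f \<in> D"
  shows "0 \<le> Re (energy f f)" "dirichlet_integral \<mu> f = ennreal (Re (energy f f))"
proof -
  have eq: "Re (deriv f z * cnj (deriv f z) * of_real (poisson \<mu> z)) = (cmod (deriv f z))\<^sup>2 * poisson \<mu> z" for z
    by (simp only: complex_norm_square[symmetric] of_real_mult[symmetric] Re_complex_of_real)
  have *: "Re (energy f f) = (\<integral>z. (cmod (deriv f z))\<^sup>2 * poisson \<mu> z \<partial>disc_area)"
    unfolding energy_def integral_Re[OF energy_integrable[OF assms assms], symmetric] eq ..
  then show "0 \<le> Re (energy f f)"
    using poisson_nonneg by (simp only:) (intro integral_nonneg_AE AE_I2, auto)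
  have "integrable disc_area (\<lambda>z. (cmod (deriv f z))\<^sup>2 * poisson \<mu> z)"
    using integrable_Re[OF energy_integrable[OF assms assms]] unfolding eq .
  then show "dirichlet_integral \<mu> f = ennreal (Re (energy f f))"
    unfolding dirichlet_integral_def * using poisson_nonneg
    by (intro nn_integral_eq_integral AE_I2) auto
qed

lemma dirichlet_inner_eq: "dirichlet_inner \<mu> f g = H2_inner f g + energy f g"
  by (simp add: dirichlet_inner_def H2_inner_def energy_def)

sublocale E: semi_inner_space D energy
proof
  fix f g h and b :: complex
  show "f \<in> D \<Longrightarrow> g \<in> D \<Longrightarrow> (\<lambda>z. f z + g z) \<in> D" by (rule D_add)
  show "f \<in> D \<Longrightarrow> (\<lambda>z. b * f z) \<in> D" by (rule D_cmult)
  show "energy (\<lambda>z. f z + g z) h = energy f h + energy g h" if "f \<in> D" "g \<in> D" "h \<in> D"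
    unfolding energy_def
    by (subst Bochner_Integration.integral_add[OF energy_integrable energy_integrable, symmetric])
      (use that in \<open>auto intro!: Bochner_Integration.integral_cong simp: deriv_disc_add distrib_right\<close>)
  show "energy (\<lambda>z. b * f z) h = b * energy f h" if "f \<in> D" "h \<in> D"
  proof -
    have "energy (\<lambda>z. b * f z) h = (\<integral>z. b * (deriv f z * cnj (deriv h z) * of_real (poisson \<mu> z)) \<partial>disc_area)"
      unfolding energy_def
      by (intro Bochner_Integration.integral_cong refl) (simp add: deriv_disc_cmult that mult.assoc)
    also have "\<dots> = b * energy f h" unfolding energy_def by (rule integral_mult_right_zero)
    finally show ?thesis .
  qed
  show "energy h f = cnj (energy f h)" if "f \<in> D" "h \<in> D"
  proof -
    have "energy h f = (\<integral>z. cnj (deriv f z * cnj (deriv h z) * of_real (poisson \<mu> z)) \<partial>disc_area)"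
      unfolding energy_def by (intro Bochner_Integration.integral_cong) (auto simp: mult_ac)
    also have "\<dots> = cnj (energy f h)" unfolding energy_def by (rule Bochner_Integration.integral_cnj)
    finally show ?thesis .
  qed
  show "f \<in> D \<Longrightarrow> 0 \<le> Re (energy f f)" by (rule energy_self)
qed

sublocale D: semi_inner_space D "dirichlet_inner \<mu>"
proof
  fix f g h and b :: complex
  show "f \<in> D \<Longrightarrow> g \<in> D \<Longrightarrow> (\<lambda>z. f z + g z) \<in> D" by (rule D_add)
  show "f \<in> D \<Longrightarrow> (\<lambda>z. b * f z) \<in> D" by (rule D_cmult)
qed (auto simp: dirichlet_inner_eq D_imp H2.inner_add_left E.inner_add_left
      H2.inner_cmult_left E.inner_cmult_left algebra_simps H2.inner_ge_0 E.inner_ge_0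
      intro: H2.inner_commute E.inner_commute intro!: arg_cong2[of _ _ _ _ "(+)"])

lemma dirichlet_norm_sq_eq:
  assumes "f \<in> D"
  shows "dirichlet_norm_sq \<mu> f = ennreal (D.sqnorm f)"
  unfolding dirichlet_norm_sq_def hardy_norm_sq_H2[OF D_imp(2)[OF assms]] energy_self(2)[OF assms]
  using energy_self(1)[OF assms] H2.sqnorm_nonneg[OF D_imp(2)[OF assms]]
  by (simp add: D.sqnorm_def dirichlet_inner_eq H2.sqnorm_def)

lemma energy_sqnorm_represents:
  assumes "represents f c g"
  shows "E.sqnorm f = (\<Sum>l\<in>Lam. a l * H2.sqnorm (g l))"
proof -
  have "ennreal (E.sqnorm f) = ennreal (\<Sum>l\<in>Lam. a l * H2.sqnorm (g l))"
    using energy_self(2)[OF represents_imp(3)[OF assms]] represents_imp(4)[OF assms]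
    by (simp add: E.sqnorm_def)
  then show ?thesis
    using representsD(1)[OF assms] weight_pos E.sqnorm_nonneg[OF represents_imp(3)[OF assms]]
    by (subst (asm) ennreal_inj)
      (auto intro!: sum_nonneg mult_nonneg_nonneg H2.sqnorm_nonneg intro: less_imp_le)
qed

lemma sqnorm_represents:
  assumes "represents f c g"
  shows "D.sqnorm f = H2.sqnorm f + (\<Sum>l\<in>Lam. a l * H2.sqnorm (g l))"
  using energy_sqnorm_represents[OF assms]
  by (simp add: D.sqnorm_def dirichlet_inner_eq H2.sqnorm_def E.sqnorm_def)

text \<open>Polarization of \<open>energy_sqnorm_represents\<close>: expanding the square of a sum
  gives the real part, and the same identity for \<open>\<i> f\<close> gives the imaginary
  part.\<close>

lemma energy_represents:
  assumes f: "represents f c g" and u: "represents u d h"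
  shows "energy f u = (\<Sum>l\<in>Lam. of_real (a l) * H2_inner (g l) (h l))"
proof -
  note uD = represents_imp(3)[OF u]
  have Re: "Re (energy f u) = (\<Sum>l\<in>Lam. a l * Re (H2_inner (g l) (h l)))"
    if f: "represents f c g" for f c g
  proof -
    have "E.sqnorm (\<lambda>z. f z + u z) = (\<Sum>l\<in>Lam. a l * H2.sqnorm (\<lambda>z. g l z + h l z))"
      by (rule energy_sqnorm_represents[OF represents_add[OF f u]])
    also have "\<dots> = (\<Sum>l\<in>Lam. a l * (H2.sqnorm (g l) + H2.sqnorm (h l) + 2 * Re (H2_inner (g l) (h l))))"
      using representsD(1)[OF f] representsD(1)[OF u]
      by (intro sum.cong refl) (simp add: H2.sqnorm_add)
    also have "\<dots> = E.sqnorm f + E.sqnorm u + 2 * (\<Sum>l\<in>Lam. a l * Re (H2_inner (g l) (h l)))"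
      unfolding energy_sqnorm_represents[OF f] energy_sqnorm_represents[OF u]
      by (simp add: distrib_left sum.distrib sum_distrib_left mult_ac)
    finally show ?thesis
      using E.sqnorm_add[OF represents_imp(3)[OF f] uD] by simp
  qed
  have "Re (\<i> * energy f u) = (\<Sum>l\<in>Lam. a l * Re (\<i> * H2_inner (g l) (h l)))"
    using Re[OF represents_cmult[OF f, of \<i>]] representsD(1)[OF f] representsD(1)[OF u]
    by (simp add: E.inner_cmult_left[OF represents_imp(3)[OF f] uD] H2.inner_cmult_left)
  then show ?thesis using Re[OF f] by (simp add: complex_eq_iff sum_negf)
qed

lemma D_eval_bound:
  assumes "f \<in> D" "cmod w < 1"
  shows "(cmod (f w))\<^sup>2 \<le> D.sqnorm f / (1 - (cmod w)\<^sup>2)"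
proof -
  have "H2.sqnorm f \<le> D.sqnorm f"
    using E.inner_ge_0[OF assms(1)] by (simp add: D.sqnorm_def dirichlet_inner_eq H2.sqnorm_def)
  then show ?thesis
    using order_trans[OF H2_eval_bound[OF D_imp(2)[OF assms(1)] assms(2)] divide_right_mono]
      sq_less_1[OF assms(2)] by simp
qed

end

section \<open>The Vinogradov--Senichkin test\<close>

lemma one_minus_product_sq:
  "(cmod (1 - t * cnj x))\<^sup>2 = (cmod (t - x))\<^sup>2 + (1 - (cmod t)\<^sup>2) * (1 - (cmod x)\<^sup>2)"
  unfolding cmod_power2 by (simp add: power2_eq_square algebra_simps)

text \<open>The quotient of the two sides is the pseudo-hyperbolic distance; their squares differ by
  the nonnegative product \<open>(1 - |t|^2) (1 - |x|^2)\<close>.\<close>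

lemma cmod_diff_le_one_minus_product:
  assumes "cmod t < 1" "cmod x < 1"
  shows "cmod (t - x) \<le> cmod (1 - t * cnj x)"
proof (rule power2_le_imp_le)
  have "0 \<le> (1 - (cmod t)\<^sup>2) * (1 - (cmod x)\<^sup>2)"
    using sq_less_1[OF assms(1)] sq_less_1[OF assms(2)] by simp
  then show "(cmod (t - x))\<^sup>2 \<le> (cmod (1 - t * cnj x))\<^sup>2" unfolding one_minus_product_sq by simp
qed simp

lemma cmod_one_minus_product_sym: "cmod (1 - t * cnj x) = cmod (1 - x * cnj t)"
proof -
  have "cmod (1 - t * cnj x) = cmod (cnj (1 - t * cnj x))" by (rule complex_mod_cnj[symmetric])
  also have "cnj (1 - t * cnj x) = 1 - x * cnj t" by (simp add: mult.commute)
  finally show ?thesis .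
qed

text \<open>Replacing \<open>t\<close> by \<open>x\<close> in \<open>1 - s cnj t\<close> costs at
  most \<open>|t - x|\<close>, which \<open>|1 - t cnj x|\<close> dominates.\<close>

lemma one_minus_product_triangle:
  assumes "cmod s < 1" "cmod x < 1" "cmod t < 1"
  shows "cmod (1 - s * cnj x) \<le> cmod (1 - t * cnj s) + cmod (1 - t * cnj x)"
proof -
  have "1 - s * cnj x = (1 - s * cnj t) + s * cnj (t - x)" by (simp add: algebra_simps)
  also have "cmod \<dots> \<le> cmod (1 - s * cnj t) + cmod (s * cnj (t - x))" by (rule norm_triangle_ineq)
  also have "cmod (s * cnj (t - x)) = cmod s * cmod (t - x)" by (simp only: norm_mult complex_mod_cnj)
  also have "\<dots> \<le> 1 * cmod (1 - t * cnj x)"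
    using assms by (intro mult_mono cmod_diff_le_one_minus_product) auto
  finally show ?thesis using cmod_one_minus_product_sym[of s t] by simp
qed

lemma one_minus_product_ge: 
  assumes "cmod t < 1" "cmod s < 1"
  shows "1 - cmod s \<le> cmod (1 - t * cnj s)" "0 < cmod (1 - t * cnj s)"
proof -
  have "cmod t * cmod s \<le> 1 * cmod s" using assms by (intro mult_right_mono) auto
  then have "1 - cmod s \<le> cmod 1 - cmod (t * cnj s)" by (simp add: norm_mult)
  also have "\<dots> \<le> cmod (1 - t * cnj s)" by (rule norm_triangle_ineq2)
  finally show "1 - cmod s \<le> cmod (1 - t * cnj s)" .
  then show "0 < cmod (1 - t * cnj s)" using assms(2) by linarith
qed

text \<open>Half of the kernel \<open>(1 - \<bar>t\<bar>\<^sup>2 \<bar>s\<bar>\<^sup>2) / \<bar>1 - t cnj s\<bar>\<^sup>2\<close> of the harmonic embedding: its composition with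
  its own transpose is again dominated by it plus its transpose, hence \<open>T\<^sup>* T \<le> C (T + T\<^sup>*)\<close> and
  \<open>T\<close> is bounded.\<close>

definition vs_kernel :: "complex \<Rightarrow> complex \<Rightarrow> real" where
  "vs_kernel t s = (if cmod s \<le> cmod t then (1 - (cmod s)\<^sup>2) / (cmod (1 - t * cnj s))\<^sup>2 else 0)"

lemma vs_kernel_measurable [measurable]:
  assumes [measurable]: "f \<in> borel_measurable M" "g \<in> borel_measurable M"
  shows "(\<lambda>x. vs_kernel (f x) (g x)) \<in> borel_measurable M"
  unfolding vs_kernel_def by measurable

lemma vs_kernel_nonneg: "cmod s < 1 \<Longrightarrow> 0 \<le> vs_kernel t s"
  using sq_less_1[of s] by (auto simp: vs_kernel_def intro!: divide_nonneg_nonneg)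

lemma vs_kernel_le:
  assumes "cmod s < 1"
  shows "vs_kernel t s \<le> (1 - (cmod s)\<^sup>2) / (cmod (1 - t * cnj s))\<^sup>2"
  using sq_less_1[OF assms] by (auto simp: vs_kernel_def intro!: divide_nonneg_nonneg)

text \<open>Of qualitative use: it makes the integrals in \<open>quadratic_form_bound\<close>
  finite, and it degenerates as \<open>r\<close> tends to 1.\<close>

lemma vs_kernel_bound:
  assumes "cmod t < 1" "cmod s \<le> r" "r < 1"
  shows "vs_kernel t s \<le> 2 / (1 - r)"
proof -
  have s1: "cmod s < 1" using assms by simp
  have "vs_kernel t s \<le> (1 - (cmod s)\<^sup>2) / (cmod (1 - t * cnj s))\<^sup>2" by (rule vs_kernel_le[OF s1])
  also have "\<dots> \<le> (1 - (cmod s)\<^sup>2) / (1 - cmod s)\<^sup>2"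
    using sq_less_1[OF s1] s1 one_minus_product_ge[OF assms(1) s1]
    by (intro divide_left_mono power_mono mult_pos_pos zero_less_power) auto
  also have "\<dots> = (1 + cmod s) / (1 - cmod s)"
  proof -
    have "1 - (cmod s)\<^sup>2 = (1 + cmod s) * (1 - cmod s)" by (simp add: power2_eq_square algebra_simps)
    then show ?thesis using s1 by (simp add: power2_eq_square)
  qed
  also have "\<dots> \<le> 2 / (1 - r)" using assms s1 by (intro frac_le) auto
  finally show ?thesis .
qed

text \<open>The triangle inequality gives \<open>?D^2 <= 2 (?A^2 + ?B^2)\<close>, which bounds
  \<open>1 / (?A^2 ?B^2)\<close> by \<open>2 / ?D^2\<close> times
  \<open>1 / ?A^2 + 1 / ?B^2\<close>. The product of two kernels thus splits into terms that contain
  \<open>t\<close> in a single factor, ready to be integrated by the kernel test.\<close>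

lemma vs_kernel_product_le:
  assumes s: "cmod s < 1" and x: "cmod x < 1" and t: "cmod t < 1"
  shows "vs_kernel t s * vs_kernel t x \<le>
    2 / (cmod (1 - s * cnj x))\<^sup>2 * ((1 - (cmod x)\<^sup>2) * ((1 - (cmod s)\<^sup>2) / (cmod (1 - t * cnj s))\<^sup>2)
       + (1 - (cmod s)\<^sup>2) * ((1 - (cmod x)\<^sup>2) / (cmod (1 - t * cnj x))\<^sup>2))"
proof -
  let ?A = "cmod (1 - t * cnj s)" and ?B = "cmod (1 - t * cnj x)" and ?D = "cmod (1 - s * cnj x)"
  let ?es = "1 - (cmod s)\<^sup>2" and ?ex = "1 - (cmod x)\<^sup>2"
  have pos: "0 < ?A" "0 < ?B" "0 < ?D"
    using one_minus_product_ge assms by auto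
  have e: "0 \<le> ?es" "0 \<le> ?ex" using sq_less_1 s x by (auto intro: less_imp_le)
  have "?D\<^sup>2 \<le> (?A + ?B)\<^sup>2"
    using one_minus_product_triangle[OF s x t] by (intro power_mono) auto
  also have "\<dots> \<le> 2 * (?A\<^sup>2 + ?B\<^sup>2)"
    using sum_squares_bound[of ?A ?B] by (simp add: power2_sum)
  finally have D: "?D\<^sup>2 \<le> 2 * (?A\<^sup>2 + ?B\<^sup>2)" .
  have "vs_kernel t s * vs_kernel t x \<le> (?es / ?A\<^sup>2) * (?ex / ?B\<^sup>2)"
    using vs_kernel_le[OF s] vs_kernel_le[OF x] vs_kernel_nonneg[OF x] e
    by (intro mult_mono divide_nonneg_nonneg) auto
  also have "\<dots> = ?es * ?ex * (?D\<^sup>2 / (?D\<^sup>2 * ?A\<^sup>2 * ?B\<^sup>2))" using pos by simp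
  also have "\<dots> \<le> ?es * ?ex * (2 * (?A\<^sup>2 + ?B\<^sup>2) / (?D\<^sup>2 * ?A\<^sup>2 * ?B\<^sup>2))"
    using e pos by (intro mult_left_mono divide_right_mono D) auto
  also have "2 * (?A\<^sup>2 + ?B\<^sup>2) / (?D\<^sup>2 * ?A\<^sup>2 * ?B\<^sup>2) = 2 / ?D\<^sup>2 * (1 / ?A\<^sup>2 + 1 / ?B\<^sup>2)"
    using pos by (simp add: field_simps)
  also have "?es * ?ex * (2 / ?D\<^sup>2 * (1 / ?A\<^sup>2 + 1 / ?B\<^sup>2)) = 2 / ?D\<^sup>2 * (?ex * (?es / ?A\<^sup>2) + ?es * (?ex / ?B\<^sup>2))"
  proof -
    have *: "u * v * (2 / d * (1 / a + 1 / b)) = 2 / d * (v * (u / a) + u * (v / b))"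
      if "0 < a" "0 < b" "0 < d" for u v a b d :: real
      using that by (simp add: field_simps)
    show ?thesis by (rule *) (use pos in auto)
  qed
  finally show ?thesis .
qed

text \<open>Of the two defects \<open>1 - |x|^2\<close> and \<open>1 - |s|^2\<close>, the larger
  belongs to the point of smaller modulus, and that is the one which the cutoff in
  \<open>vs_kernel\<close> retains.\<close>

lemma vs_kernel_sum_ge:
  assumes s: "cmod s < 1" and x: "cmod x < 1"
  shows "((1 - (cmod x)\<^sup>2) + (1 - (cmod s)\<^sup>2)) / (cmod (1 - s * cnj x))\<^sup>2 \<le> 2 * (vs_kernel s x + vs_kernel x s)"
proof (cases "cmod x \<le> cmod s")
  case True
  then have le: "(cmod x)\<^sup>2 \<le> (cmod s)\<^sup>2" by (intro power_mono) auto
  have "((1 - (cmod x)\<^sup>2) + (1 - (cmod s)\<^sup>2)) / (cmod (1 - s * cnj x))\<^sup>2 \<le> 2 * (1 - (cmod x)\<^sup>2) / (cmod (1 - s * cnj x))\<^sup>2"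
    using le by (intro divide_right_mono) auto
  also have "\<dots> = 2 * vs_kernel s x" using True by (simp add: vs_kernel_def)
  finally show ?thesis using vs_kernel_nonneg[OF s, of x] by simp
next
  case False
  then have le: "(cmod s)\<^sup>2 \<le> (cmod x)\<^sup>2" by (intro power_mono) auto
  have "((1 - (cmod x)\<^sup>2) + (1 - (cmod s)\<^sup>2)) / (cmod (1 - s * cnj x))\<^sup>2 \<le> 2 * (1 - (cmod s)\<^sup>2) / (cmod (1 - s * cnj x))\<^sup>2"
    using le by (intro divide_right_mono) auto
  also have "\<dots> = 2 * vs_kernel x s" using False by (simp add: vs_kernel_def cmod_one_minus_product_sym[of s x])
  finally show ?thesis using vs_kernel_nonneg[OF x, of s] by simp
qed

text \<open>The Poisson kernel \<open>1 + 2 Re (u + u^2 + ...)\<close> at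
  \<open>u = z cnj w\<close>, that is, the sum of the two-sided geometric series.\<close>

definition poisson_pair :: "complex \<Rightarrow> complex \<Rightarrow> real" where
  "poisson_pair z w = (1 - (cmod z)\<^sup>2 * (cmod w)\<^sup>2) / (cmod (1 - z * cnj w))\<^sup>2"

lemma poisson_pair_le:
  assumes z: "cmod z < 1" and w: "cmod w < 1"
  shows "poisson_pair z w \<le> 2 * (vs_kernel z w + vs_kernel w z)"
proof -
  have "1 - (cmod z)\<^sup>2 * (cmod w)\<^sup>2 \<le> (1 - (cmod w)\<^sup>2) + (1 - (cmod z)\<^sup>2)"
  proof -
    have "0 \<le> (1 - (cmod z)\<^sup>2) * (1 - (cmod w)\<^sup>2)" using sq_less_1[OF z] sq_less_1[OF w] by simp
    then show ?thesis by (simp add: algebra_simps)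
  qed
  then have "poisson_pair z w \<le> ((1 - (cmod w)\<^sup>2) + (1 - (cmod z)\<^sup>2)) / (cmod (1 - z * cnj w))\<^sup>2"
    unfolding poisson_pair_def by (intro divide_right_mono) auto
  also have "\<dots> \<le> 2 * (vs_kernel z w + vs_kernel w z)" by (rule vs_kernel_sum_ge[OF z w])
  finally show ?thesis .
qed

section \<open>Boundedness of the half kernel under the kernel test\<close>

locale disc_measure = finite_measure \<sigma> for \<sigma> :: "complex measure" +
  assumes sets_\<sigma>: "sets \<sigma> = sets disc_borel"
begin

lemma space_\<sigma>: "space \<sigma> = unit_disc"
  using sets_eq_imp_space_eq[OF sets_\<sigma>] by (simp add: space_restrict_space)

lemma id_measurable [measurable]: "(\<lambda>z. z) \<in> borel_measurable \<sigma>"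
  by (subst measurable_cong_sets[OF sets_\<sigma> refl]) (rule measurable_restrict_space1, simp)

lemma continuous_measurable:
  "continuous_on unit_disc f \<Longrightarrow> f \<in> borel_measurable \<sigma>"
  for f :: "complex \<Rightarrow> 'b::topological_space"
  by (subst measurable_cong_sets[OF sets_\<sigma> refl]) (rule continuous_disc_measurable)

lemma pair_measurable [measurable]:
  "(\<lambda>p. fst p) \<in> borel_measurable (\<sigma> \<Otimes>\<^sub>M \<sigma>)" "(\<lambda>p. snd p) \<in> borel_measurable (\<sigma> \<Otimes>\<^sub>M \<sigma>)"
  using measurable_compose[OF measurable_fst id_measurable] measurable_compose[OF measurable_snd id_measurable]
  by auto

sublocale pair: pair_sigma_finite \<sigma> \<sigma> ..

end

text \<open>The integrand of \<open>kernel_test\<close> is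
  \<open>|szego w z|^2 / H2.sqnorm (szego w)\<close>, the square of a normalized Szego
  kernel.\<close>

locale kernel_test = disc_measure +
  fixes K :: real
  assumes K_pos: "0 < K"
    and kernel_test: "cmod w < 1 \<Longrightarrow> (\<integral>\<^sup>+z. ennreal ((1 - (cmod w)\<^sup>2) / (cmod (1 - z * cnj w))\<^sup>2) \<partial>\<sigma>) \<le> ennreal K"
begin

text \<open>Each term of \<open>vs_kernel_product_le\<close> integrates to at most \<open>K\<close>
  times a defect, and \<open>vs_kernel_sum_ge\<close> turns the sum of defects back into kernels.
  Both lemmas contribute a factor 2 to the constant.\<close>

lemma vs_kernel_composition:
  assumes s: "cmod s < 1" and x: "cmod x < 1"
  shows "(\<integral>\<^sup>+t. ennreal (vs_kernel t s) * ennreal (vs_kernel t x) \<partial>\<sigma>) \<le>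
    ennreal (4 * K) * (ennreal (vs_kernel s x) + ennreal (vs_kernel x s))"
proof -
  let ?es = "1 - (cmod s)\<^sup>2" and ?ex = "1 - (cmod x)\<^sup>2" and ?D = "(cmod (1 - s * cnj x))\<^sup>2"
  have e: "0 \<le> ?es" "0 \<le> ?ex" using sq_less_1 s x by (auto intro: less_imp_le)
  let ?q = "\<lambda>w z. (1 - (cmod w)\<^sup>2) / (cmod (1 - z * cnj w))\<^sup>2"
  have "(\<integral>\<^sup>+t. ennreal (vs_kernel t s) * ennreal (vs_kernel t x) \<partial>\<sigma>) \<le>
     (\<integral>\<^sup>+t. ennreal (2 / ?D) * (ennreal ?ex * ennreal (?q s t) + ennreal ?es * ennreal (?q x t)) \<partial>\<sigma>)"
  proof (rule nn_integral_mono)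
    fix t assume "t \<in> space \<sigma>"
    then have t: "cmod t < 1" by (simp add: space_\<sigma>)
    have "ennreal (vs_kernel t s) * ennreal (vs_kernel t x) = ennreal (vs_kernel t s * vs_kernel t x)"
      using vs_kernel_nonneg s x by (simp add: ennreal_mult)
    also have "\<dots> \<le> ennreal (2 / ?D * (?ex * ?q s t + ?es * ?q x t))"
      by (intro ennreal_leI vs_kernel_product_le s x t)
    also have "\<dots> = ennreal (2 / ?D) * (ennreal ?ex * ennreal (?q s t) + ennreal ?es * ennreal (?q x t))"
      using e by (simp add: ennreal_mult[symmetric] ennreal_plus[symmetric] del: ennreal_plus)
    finally show "ennreal (vs_kernel t s) * ennreal (vs_kernel t x) \<le>
      ennreal (2 / ?D) * (ennreal ?ex * ennreal (?q s t) + ennreal ?es * ennreal (?q x t))" .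
  qed
  also have "\<dots> = ennreal (2 / ?D) * (ennreal ?ex * (\<integral>\<^sup>+t. ennreal (?q s t) \<partial>\<sigma>) + ennreal ?es * (\<integral>\<^sup>+t. ennreal (?q x t) \<partial>\<sigma>))"
    by (simp add: nn_integral_cmult nn_integral_add)
  also have "\<dots> \<le> ennreal (2 / ?D) * (ennreal ?ex * ennreal K + ennreal ?es * ennreal K)"
    by (intro mult_left_mono add_mono kernel_test s x) auto
  also have "\<dots> = ennreal (2 * K * ((?ex + ?es) / ?D))"
  proof -
    have "ennreal (2 / ?D) * (ennreal ?ex * ennreal K + ennreal ?es * ennreal K) = ennreal (2 / ?D * (?ex * K + ?es * K))"
      using e K_pos by (simp add: ennreal_mult[symmetric] ennreal_plus[symmetric] del: ennreal_plus)
    also have "2 / ?D * (?ex * K + ?es * K) = 2 * K * ((?ex + ?es) / ?D)"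
    proof -
      have "2 / d * (v * k + u * k) = 2 * k * ((v + u) / d)" for u v d k :: real
        by (simp add: algebra_simps add_divide_distrib)
      then show ?thesis .
    qed
    finally show ?thesis .
  qed
  also have "\<dots> \<le> ennreal (2 * K * (2 * (vs_kernel s x + vs_kernel x s)))"
    using K_pos by (intro ennreal_leI mult_left_mono vs_kernel_sum_ge s x) auto
  also have "\<dots> = ennreal (4 * K) * (ennreal (vs_kernel s x) + ennreal (vs_kernel x s))"
    using vs_kernel_nonneg[OF s] vs_kernel_nonneg[OF x] K_pos
    by (simp add: ennreal_mult[symmetric] ennreal_plus[symmetric] algebra_simps del: ennreal_plus)
  finally show ?thesis .
qed

text \<open>With \<open>A\<close> the squared norm of \<open>T \<phi>\<close> and \<open>J\<close>
  the pairing of \<open>T \<phi>\<close> with \<open>\<phi>\<close>, the composition bound gives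
  \<open>A <= 8 K J\<close>, while Young's inequality gives
  \<open>8 K J <= A / 2 + 32 K^2 \<Phi>\<close>. Absorbing \<open>A / 2\<close> yields
  \<open>J <= 8 K \<Phi>\<close>; the cutoff at radius \<open>r\<close> provides the finiteness that
  the absorption requires.\<close>

lemma quadratic_form_bound:
  fixes \<phi> :: "complex \<Rightarrow> ennreal"
  assumes [measurable]: "\<phi> \<in> borel_measurable \<sigma>"
    and bound: "\<And>z. cmod z < 1 \<Longrightarrow> \<phi> z \<le> ennreal B * indicator (cball 0 r) z"
    and r: "r < 1"
  shows "(\<integral>\<^sup>+t. \<phi> t * (\<integral>\<^sup>+s. ennreal (vs_kernel t s) * \<phi> s \<partial>\<sigma>) \<partial>\<sigma>) \<le> ennreal (8 * K) * (\<integral>\<^sup>+z. (\<phi> z)\<^sup>2 \<partial>\<sigma>)"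
proof -
  let ?k = "\<lambda>t s. ennreal (vs_kernel t s)"
  define T where "T t = (\<integral>\<^sup>+s. ?k t s * \<phi> s \<partial>\<sigma>)" for t
  define A where "A = (\<integral>\<^sup>+t. (T t)\<^sup>2 \<partial>\<sigma>)"
  define J where "J = (\<integral>\<^sup>+t. \<phi> t * T t \<partial>\<sigma>)"
  define \<Phi> where "\<Phi> = (\<integral>\<^sup>+z. (\<phi> z)\<^sup>2 \<partial>\<sigma>)"
  have [measurable]: "(\<lambda>p. \<phi> (fst p)) \<in> borel_measurable (\<sigma> \<Otimes>\<^sub>M \<sigma>)"
    "(\<lambda>p. \<phi> (snd p)) \<in> borel_measurable (\<sigma> \<Otimes>\<^sub>M \<sigma>)" by measurable
  have Tm[measurable]: "T \<in> borel_measurable \<sigma>"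
    unfolding T_def by measurable
  define c where "c = ennreal (2 / (1 - r)) * ennreal B * emeasure \<sigma> (space \<sigma>)"
  have c_fin: "c < top"
    unfolding c_def by (simp add: emeasure_eq_measure ennreal_mult_less_top)
  have T_le: "T t \<le> c" if t: "cmod t < 1" for t
  proof -
    have "T t \<le> (\<integral>\<^sup>+s. ennreal (2 / (1 - r)) * ennreal B \<partial>\<sigma>)"
      unfolding T_def
    proof (rule nn_integral_mono)
      fix s assume "s \<in> space \<sigma>"
      then have s: "cmod s < 1" by (simp add: space_\<sigma>)
      show "?k t s * \<phi> s \<le> ennreal (2 / (1 - r)) * ennreal B"
      proof (cases "cmod s \<le> r")
        case True
        then show ?thesis
          using bound[OF s] vs_kernel_bound[OF t True r] by (intro mult_mono ennreal_leI) auto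
      next
        case False
        then show ?thesis using bound[OF s] by simp
      qed
    qed
    also have "\<dots> = c" by (simp add: c_def)
    finally show ?thesis .
  qed
  have \<phi>_le: "\<phi> z \<le> ennreal B" if "cmod z < 1" for z
    using order_trans[OF bound[OF that], of "ennreal B"] by (auto simp: indicator_def)
  have A_fin: "A < top"
  proof -
    have "A \<le> (\<integral>\<^sup>+t. c\<^sup>2 \<partial>\<sigma>)"
      unfolding A_def by (intro nn_integral_mono power_mono T_le) (auto simp: space_\<sigma>)
    also have "\<dots> < top"
      using c_fin by (simp add: emeasure_eq_measure ennreal_mult_less_top power2_eq_square)
    finally show ?thesis .
  qed
  \<comment> \<open>The square is expanded so that the common variable \<open>t\<close> can be
    integrated first and the composed kernel appears.\<close>
  have "A = (\<integral>\<^sup>+t. (\<integral>\<^sup>+s. ?k t s * \<phi> s * T t \<partial>\<sigma>) \<partial>\<sigma>)"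
    unfolding A_def power2_eq_square
    by (subst (1) T_def) (simp add: nn_integral_multc)
  also have "\<dots> = (\<integral>\<^sup>+s. (\<integral>\<^sup>+t. ?k t s * \<phi> s * T t \<partial>\<sigma>) \<partial>\<sigma>)"
    by (rule pair.Fubini'[symmetric]) measurable
  also have "\<dots> = (\<integral>\<^sup>+s. (\<integral>\<^sup>+t. (\<integral>\<^sup>+x. \<phi> s * \<phi> x * (?k t s * ?k t x) \<partial>\<sigma>) \<partial>\<sigma>) \<partial>\<sigma>)"
    unfolding T_def by (intro nn_integral_cong) (simp add: nn_integral_cmult[symmetric] mult_ac)
  also have "\<dots> = (\<integral>\<^sup>+s. (\<integral>\<^sup>+x. (\<integral>\<^sup>+t. \<phi> s * \<phi> x * (?k t s * ?k t x) \<partial>\<sigma>) \<partial>\<sigma>) \<partial>\<sigma>)"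
    by (intro nn_integral_cong pair.Fubini') measurable
  also have "\<dots> = (\<integral>\<^sup>+s. (\<integral>\<^sup>+x. \<phi> s * \<phi> x * (\<integral>\<^sup>+t. ?k t s * ?k t x \<partial>\<sigma>) \<partial>\<sigma>) \<partial>\<sigma>)"
    by (intro nn_integral_cong) (simp add: nn_integral_cmult)
  also have "\<dots> \<le> (\<integral>\<^sup>+s. (\<integral>\<^sup>+x. \<phi> s * \<phi> x * (ennreal (4 * K) * (?k s x + ?k x s)) \<partial>\<sigma>) \<partial>\<sigma>)"
    by (intro nn_integral_mono mult_left_mono vs_kernel_composition) (auto simp: space_\<sigma>)
  also have "\<dots> = (\<integral>\<^sup>+s. ennreal (4 * K) * (\<phi> s * T s) + ennreal (4 * K) * (\<integral>\<^sup>+x. \<phi> x * (?k x s * \<phi> s) \<partial>\<sigma>) \<partial>\<sigma>)"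
    unfolding T_def
    by (intro nn_integral_cong)
      (simp add: nn_integral_cmult[symmetric] nn_integral_add[symmetric] distrib_left mult_ac)
  also have "\<dots> = ennreal (4 * K) * J + ennreal (4 * K) * (\<integral>\<^sup>+s. (\<integral>\<^sup>+x. \<phi> x * (?k x s * \<phi> s) \<partial>\<sigma>) \<partial>\<sigma>)"
    unfolding J_def by (simp add: nn_integral_cmult nn_integral_add)
  also have "(\<integral>\<^sup>+s. (\<integral>\<^sup>+x. \<phi> x * (?k x s * \<phi> s) \<partial>\<sigma>) \<partial>\<sigma>) = (\<integral>\<^sup>+x. (\<integral>\<^sup>+s. \<phi> x * (?k x s * \<phi> s) \<partial>\<sigma>) \<partial>\<sigma>)"
    by (rule pair.Fubini') measurable
  also have "\<dots> = J"
    unfolding J_def T_def by (simp add: nn_integral_cmult)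
  finally have AJ: "A \<le> ennreal (4 * K) * J + ennreal (4 * K) * J" .
  have J_fin: "J < top"
  proof -
    have "J \<le> (\<integral>\<^sup>+t. ennreal B * c \<partial>\<sigma>)"
      unfolding J_def by (intro nn_integral_mono mult_mono T_le \<phi>_le) (auto simp: space_\<sigma>)
    also have "\<dots> < top"
      using c_fin by (simp add: emeasure_eq_measure ennreal_mult_less_top)
    finally show ?thesis .
  qed
  have \<Phi>_fin: "\<Phi> < top"
  proof -
    have "\<Phi> \<le> (\<integral>\<^sup>+t. (ennreal B)\<^sup>2 \<partial>\<sigma>)"
      unfolding \<Phi>_def by (intro nn_integral_mono power_mono \<phi>_le) (auto simp: space_\<sigma>)
    also have "\<dots> < top"
      by (simp add: emeasure_eq_measure ennreal_mult_less_top power2_eq_square)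
    finally show ?thesis .
  qed
  have "ennreal (8 * K) * J = (\<integral>\<^sup>+t. ennreal (8 * K) * (\<phi> t * T t) \<partial>\<sigma>)"
    unfolding J_def by (simp add: nn_integral_cmult)
  also have "\<dots> \<le> (\<integral>\<^sup>+t. ennreal (1 / 2) * (T t)\<^sup>2 + ennreal (32 * K\<^sup>2) * (\<phi> t)\<^sup>2 \<partial>\<sigma>)"
  proof (rule nn_integral_mono)
    fix t assume "t \<in> space \<sigma>"
    then have t: "cmod t < 1" by (simp add: space_\<sigma>)
    obtain x where x: "\<phi> t = ennreal x" "0 \<le> x"
      using \<phi>_le[OF t] by (cases "\<phi> t") (auto simp: top_unique)
    obtain y where y: "T t = ennreal y" "0 \<le> y"
      using T_le[OF t] c_fin by (cases "T t") (auto simp: top_unique)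
    have "0 \<le> (y - 8 * K * x)\<^sup>2 / 2" by simp
    also have "\<dots> = 1 / 2 * y\<^sup>2 + 32 * K\<^sup>2 * x\<^sup>2 - 8 * K * (x * y)"
      by (simp add: power2_eq_square algebra_simps diff_divide_distrib add_divide_distrib)
    finally have "8 * K * (x * y) \<le> 1 / 2 * y\<^sup>2 + 32 * K\<^sup>2 * x\<^sup>2" by simp
    from ennreal_leI[OF this]
    show "ennreal (8 * K) * (\<phi> t * T t) \<le> ennreal (1 / 2) * (T t)\<^sup>2 + ennreal (32 * K\<^sup>2) * (\<phi> t)\<^sup>2"
    proof -
      have 1: "ennreal (8 * K * (x * y)) = ennreal (8 * K) * (ennreal x * ennreal y)"
        using K_pos x(2) y(2) by (simp only: ennreal_mult mult_nonneg_nonneg less_imp_le zero_le_numeral)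
      have 2: "ennreal (1 / 2 * y\<^sup>2) = ennreal (1 / 2) * (ennreal y)\<^sup>2"
        using y(2) by (subst ennreal_mult) (simp_all add: ennreal_power)
      have 3: "ennreal (32 * K\<^sup>2 * x\<^sup>2) = ennreal (32 * K\<^sup>2) * (ennreal x)\<^sup>2"
        using x(2) by (subst ennreal_mult) (simp_all add: ennreal_power)
      have "ennreal (1 / 2 * y\<^sup>2 + 32 * K\<^sup>2 * x\<^sup>2) = ennreal (1 / 2 * y\<^sup>2) + ennreal (32 * K\<^sup>2 * x\<^sup>2)"
        by (rule ennreal_plus) auto
      with \<open>ennreal (8 * K * (x * y)) \<le> _\<close> show ?thesis unfolding x(1) y(1) 1 2 3 by simp
    qed
  qed
  also have "\<dots> = ennreal (1 / 2) * A + ennreal (32 * K\<^sup>2) * \<Phi>"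
    unfolding A_def \<Phi>_def by (simp add: nn_integral_cmult nn_integral_add)
  finally have JA: "ennreal (8 * K) * J \<le> ennreal (1 / 2) * A + ennreal (32 * K\<^sup>2) * \<Phi>" .
  obtain A' where A': "A = ennreal A'" "0 \<le> A'" using A_fin by (cases A) auto
  obtain J' where J': "J = ennreal J'" "0 \<le> J'" using J_fin by (cases J) auto
  obtain \<Phi>' where \<Phi>': "\<Phi> = ennreal \<Phi>'" "0 \<le> \<Phi>'" using \<Phi>_fin by (cases \<Phi>) auto
  have "ennreal A' \<le> ennreal (8 * K * J')"
    using AJ K_pos J' A' by (simp add: ennreal_mult[symmetric] ennreal_plus[symmetric] mult_ac del: ennreal_plus)
  then have 1: "A' \<le> 8 * K * J'" using K_pos J' by (subst (asm) ennreal_le_iff) (auto simp: mult_ac)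
  have "ennreal (8 * K * J') \<le> ennreal (1 / 2 * A' + 32 * K\<^sup>2 * \<Phi>')"
  proof -
    have 1: "ennreal (8 * K * J') = ennreal (8 * K) * ennreal J'" using K_pos J' by (intro ennreal_mult) auto
    have 2: "ennreal (1 / 2 * A') = ennreal (1 / 2) * ennreal A'" using A' by (intro ennreal_mult) auto
    have 3: "ennreal (32 * K\<^sup>2 * \<Phi>') = ennreal (32 * K\<^sup>2) * ennreal \<Phi>'" using \<Phi>' by (intro ennreal_mult) auto
    have "ennreal (1 / 2 * A' + 32 * K\<^sup>2 * \<Phi>') = ennreal (1 / 2 * A') + ennreal (32 * K\<^sup>2 * \<Phi>')"
      using A' \<Phi>' by (intro ennreal_plus) auto
    then show ?thesis unfolding 1 2 3 using JA J' A' \<Phi>' by simp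
  qed
  then have 2: "8 * K * J' \<le> 1 / 2 * A' + 32 * K\<^sup>2 * \<Phi>'" using K_pos A' \<Phi>' by (subst (asm) ennreal_le_iff) auto
  from 1 2 have "8 * K * J' \<le> 64 * K\<^sup>2 * \<Phi>'" by linarith
  then have "8 * K * J' \<le> 8 * K * (8 * K * \<Phi>')" by (simp add: power2_eq_square)
  then have "J' \<le> 8 * K * \<Phi>'" using K_pos by (subst (asm) mult_le_cancel_left_pos) auto
  then have "J \<le> ennreal (8 * K) * \<Phi>"
    unfolding J' \<Phi>' using K_pos \<Phi>' by (simp add: ennreal_mult[symmetric])
  then show ?thesis unfolding J_def \<Phi>_def T_def .
qed

end

section \<open>Moments and the embedding of the Hardy space\<close>

lemma two_sided_geometric_sum:
  assumes u: "cmod u < 1"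
  shows "cmod ((\<Sum>k<Suc n. u ^ k) + (\<Sum>k<n. cnj u ^ Suc k)) \<le>
    (1 - (cmod u)\<^sup>2) / (cmod (1 - u))\<^sup>2 + 2 * cmod u ^ n / (1 - cmod u)"
proof -
  have nz: "1 - u \<noteq> 0" using u by auto
  then have nzc: "1 - cnj u \<noteq> 0" by (metis complex_cnj_diff complex_cnj_one complex_cnj_zero_iff)
  have 1: "(\<Sum>k<Suc n. u ^ k) = 1 / (1 - u) - u ^ Suc n / (1 - u)"
    using sum_gp_strict[of u "Suc n"] nz by (auto simp: diff_divide_distrib)
  have 2: "(\<Sum>k<n. cnj u ^ Suc k) = cnj u / (1 - cnj u) - cnj u ^ Suc n / (1 - cnj u)"
  proof -
    have "(\<Sum>k<n. cnj u ^ Suc k) = cnj u * (\<Sum>k<n. cnj u ^ k)" by (simp add: sum_distrib_left)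
    also have "(\<Sum>k<n. cnj u ^ k) = (1 - cnj u ^ n) / (1 - cnj u)"
      using sum_gp_strict[of "cnj u" n] nzc by auto
    finally show ?thesis by (simp add: algebra_simps diff_divide_distrib)
  qed
  \<comment> \<open>The two infinite geometric series add up to the Poisson kernel; what the
    truncation cuts off is the remainder estimated in \<open>b\<close>.\<close>
  have 3: "1 / (1 - u) + cnj u / (1 - cnj u) = of_real ((1 - (cmod u)\<^sup>2) / (cmod (1 - u))\<^sup>2)"
  proof -
    have "1 / (1 - u) + cnj u / (1 - cnj u) = (1 - u * cnj u) / ((1 - u) * cnj (1 - u))"
      using nz nzc by (simp add: field_simps)
    then show ?thesis by (simp only: complex_norm_square[symmetric]) simp
  qed
  have eq: "(\<Sum>k<Suc n. u ^ k) + (\<Sum>k<n. cnj u ^ Suc k) =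
      of_real ((1 - (cmod u)\<^sup>2) / (cmod (1 - u))\<^sup>2) - (u ^ Suc n / (1 - u) + cnj u ^ Suc n / (1 - cnj u))"
    by (simp only: 1 2 3[symmetric] add_diff_add)
  have b: "cmod (v ^ Suc n / (1 - v)) \<le> cmod u ^ n / (1 - cmod u)" if "cmod v = cmod u" for v
  proof -
    have "1 - cmod u \<le> cmod (1 - v)" using norm_triangle_ineq2[of 1 v] that by simp
    then have "cmod v ^ Suc n / cmod (1 - v) \<le> cmod u ^ n / (1 - cmod u)"
      using u by (intro frac_le) (auto simp: that mult_left_le_one_le)
    then show ?thesis by (simp only: norm_divide norm_power)
  qed
  have "cmod ((\<Sum>k<Suc n. u ^ k) + (\<Sum>k<n. cnj u ^ Suc k)) \<le>
      cmod (of_real ((1 - (cmod u)\<^sup>2) / (cmod (1 - u))\<^sup>2)) + cmod (u ^ Suc n / (1 - u) + cnj u ^ Suc n / (1 - cnj u))"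
    unfolding eq by (rule norm_triangle_ineq4)
  also have "\<dots> \<le> (1 - (cmod u)\<^sup>2) / (cmod (1 - u))\<^sup>2 + (cmod u ^ n / (1 - cmod u) + cmod u ^ n / (1 - cmod u))"
  proof (rule add_mono)
    show "cmod (of_real ((1 - (cmod u)\<^sup>2) / (cmod (1 - u))\<^sup>2)) \<le> (1 - (cmod u)\<^sup>2) / (cmod (1 - u))\<^sup>2"
      unfolding norm_of_real using sq_less_1[OF u] by (simp add: abs_of_nonneg)
    show "cmod (u ^ Suc n / (1 - u) + cnj u ^ Suc n / (1 - cnj u)) \<le> cmod u ^ n / (1 - cmod u) + cmod u ^ n / (1 - cmod u)"
      by (rule order_trans[OF norm_triangle_ineq add_mono[OF b b]]) auto
  qed
  finally show ?thesis by simp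
qed

context kernel_test
begin

text \<open>The moments of \<open>\<psi>\<close> and of its conjugate together form the two-sided sum whose kernel is the positive
  kernel \<open>poisson_pair\<close>; the analytic half alone would only give the complex-valued Szego kernel.\<close>

lemma moment_bound:
  fixes \<psi> :: "complex \<Rightarrow> complex"
  assumes \<psi>[measurable]: "\<psi> \<in> borel_measurable \<sigma>"
    and bound: "\<And>z. cmod z < 1 \<Longrightarrow> cmod (\<psi> z) \<le> B * indicator (cball 0 r) z"
    and r: "0 \<le> r" "r < 1"
  shows "ennreal (\<Sum>k<n. (cmod (\<integral>z. z ^ k * \<psi> z \<partial>\<sigma>))\<^sup>2) \<le> ennreal (32 * K) * (\<integral>\<^sup>+z. ennreal ((cmod (\<psi> z))\<^sup>2) \<partial>\<sigma>)"
proof -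
  have B: "cmod (\<psi> z) \<le> \<bar>B\<bar>" if "cmod z < 1" for z
    using bound[OF that] by (cases "cmod z \<le> r") auto
  have out: "\<psi> z = 0" if "cmod z < 1" "r < cmod z" for z
    using bound[OF that(1)] that(2) by simp
  have int: "integrable \<sigma> (\<lambda>z. h z * \<psi> z)" "integrable \<sigma> (\<lambda>z. h z * cnj (\<psi> z))"
    if [measurable]: "h \<in> borel_measurable borel" and h: "\<And>z. cmod z < 1 \<Longrightarrow> cmod (h z) \<le> 1" for h :: "complex \<Rightarrow> complex"
  proof -
    have hm[measurable]: "h \<in> borel_measurable \<sigma>" using measurable_compose[OF id_measurable that(1)] .
    have b: "cmod (h z) * cmod (\<psi> z) \<le> \<bar>B\<bar>" if "cmod z < 1" for z
      using mult_mono[OF h[OF that] B[OF that]] by simp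
    show "integrable \<sigma> (\<lambda>z. h z * \<psi> z)"
      by (rule integrable_const_bound[where B = "\<bar>B\<bar>"]) (auto simp: space_\<sigma> norm_mult b intro!: AE_I2)
    show "integrable \<sigma> (\<lambda>z. h z * cnj (\<psi> z))"
      by (rule integrable_const_bound[where B = "\<bar>B\<bar>"]) (auto simp: space_\<sigma> norm_mult b intro!: AE_I2)
  qed
  have pw: "(\<lambda>z::complex. z ^ k) \<in> borel_measurable borel" "(\<lambda>z. cnj z ^ k) \<in> borel_measurable borel"
    "cmod z < 1 \<Longrightarrow> cmod (z ^ k) \<le> 1" "cmod z < 1 \<Longrightarrow> cmod (cnj z ^ k) \<le> 1" for k z
    by (auto simp: norm_power power_le_one)
  have i1: "integrable \<sigma> (\<lambda>z. z ^ k * \<psi> z)" and i2: "integrable \<sigma> (\<lambda>z. cnj z ^ k * \<psi> z)"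
    and i3: "integrable \<sigma> (\<lambda>z. cnj z ^ k * cnj (\<psi> z))" and i4: "integrable \<sigma> (\<lambda>z. z ^ k * cnj (\<psi> z))" for k
    by (rule int; simp add: pw)+
  define b where "b k = (\<integral>z. z ^ k * \<psi> z \<partial>\<sigma>)" for k
  define b' where "b' k = (\<integral>z. z ^ k * cnj (\<psi> z) \<partial>\<sigma>)" for k
  define \<phi> where "\<phi> z = ennreal (cmod (\<psi> z))" for z
  have \<phi>m[measurable]: "\<phi> \<in> borel_measurable \<sigma>" unfolding \<phi>_def by measurable
  have cb: "cnj (b k) = (\<integral>z. cnj z ^ k * cnj (\<psi> z) \<partial>\<sigma>)" for k
    unfolding b_def Bochner_Integration.integral_cnj[symmetric] by simp
  have cb': "cnj (b' k) = (\<integral>z. cnj z ^ k * \<psi> z \<partial>\<sigma>)" for k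
    unfolding b'_def Bochner_Integration.integral_cnj[symmetric] by simp
  define S where "S = (\<integral>\<^sup>+z. \<phi> z \<partial>\<sigma>)"
  define J where "J = (\<integral>\<^sup>+z. \<phi> z * (\<integral>\<^sup>+w. ennreal (vs_kernel z w) * \<phi> w \<partial>\<sigma>) \<partial>\<sigma>)"
  have S_fin: "S < top"
  proof -
    have "S \<le> (\<integral>\<^sup>+z. ennreal \<bar>B\<bar> \<partial>\<sigma>)"
      unfolding S_def \<phi>_def by (intro nn_integral_mono ennreal_leI B) (auto simp: space_\<sigma>)
    also have "\<dots> < top" by (simp add: emeasure_eq_measure ennreal_mult_less_top)
    finally show ?thesis .
  qed
  \<comment> \<open>Bound for the remainder in \<open>two_sided_geometric_sum\<close> when both
    points lie in the disc of radius \<open>r\<close>.\<close>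
  define e where "e m = 2 * (r\<^sup>2) ^ m / (1 - r\<^sup>2)" for m
  have r2: "r\<^sup>2 < 1" using r by (simp add: abs_square_less_1)
  have e0: "0 \<le> e m" for m using r2 by (simp add: e_def)
  have step: "ennreal (\<Sum>k<Suc m. (cmod (b k))\<^sup>2) \<le> ennreal 4 * J + ennreal (e m) * (S * S)" for m
  proof -
    \<comment> \<open>Two-sided partial sum in \<open>z cnj w\<close>. The second sum starts at
      exponent 1, so that the constant term is counted once.\<close>
    let ?P = "\<lambda>z w. (\<Sum>k<Suc m. (z * cnj w) ^ k) + (\<Sum>k<m. cnj (z * cnj w) ^ Suc k)"
    let ?G = "\<lambda>z. (\<Sum>k<Suc m. z ^ k * cnj (b k)) + (\<Sum>k<m. cnj z ^ Suc k * b' (Suc k))"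
    have G: "?G z = (\<integral>w. ?P z w * cnj (\<psi> w) \<partial>\<sigma>)" for z
    proof -
      have "?P z w * cnj (\<psi> w) = (\<Sum>k<Suc m. z ^ k * (cnj w ^ k * cnj (\<psi> w))) + (\<Sum>k<m. cnj z ^ Suc k * (w ^ Suc k * cnj (\<psi> w)))" for w
        by (simp only: distrib_right sum_distrib_right power_mult_distrib complex_cnj_mult complex_cnj_cnj mult.assoc)
      then show ?thesis
        using i3 i4
        by (simp only: cb b'_def Bochner_Integration.integral_add Bochner_Integration.integral_sum
            integrable_mult_right Bochner_Integration.integrable_sum integral_mult_right_zero)
    qed
    have Geq: "?G z * \<psi> z = (\<Sum>k<Suc m. cnj (b k) * (z ^ k * \<psi> z)) + (\<Sum>k<m. b' (Suc k) * (cnj z ^ Suc k * \<psi> z))" for z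
      unfolding distrib_right sum_distrib_right by (simp only: mult_ac)
    have "complex_of_real ((\<Sum>k<Suc m. (cmod (b k))\<^sup>2) + (\<Sum>k<m. (cmod (b' (Suc k)))\<^sup>2)) =
       (\<Sum>k<Suc m. cnj (b k) * b k) + (\<Sum>k<m. b' (Suc k) * cnj (b' (Suc k)))"
      by (simp only: of_real_add of_real_sum complex_norm_square mult.commute)
    also have "\<dots> = (\<integral>z. ?G z * \<psi> z \<partial>\<sigma>)"
      unfolding Geq using i1 i2
      by (simp only: cb' b_def Bochner_Integration.integral_add Bochner_Integration.integral_sum
          integrable_mult_right Bochner_Integration.integrable_sum integral_mult_right_zero)
    finally have eq: "complex_of_real ((\<Sum>k<Suc m. (cmod (b k))\<^sup>2) + (\<Sum>k<m. (cmod (b' (Suc k)))\<^sup>2)) = (\<integral>z. ?G z * \<psi> z \<partial>\<sigma>)" .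
    have Gint: "integrable \<sigma> (\<lambda>z. ?G z * \<psi> z)"
      unfolding Geq
      by (intro Bochner_Integration.integrable_add Bochner_Integration.integrable_sum integrable_mult_right i1 i2)
    have Pb: "ennreal (cmod (?P z w)) * \<phi> w \<le> (ennreal 2 * (ennreal (vs_kernel z w) + ennreal (vs_kernel w z)) + ennreal (e m)) * \<phi> w"
      if z: "cmod z \<le> r" and w: "cmod w < 1" for z w
    proof (cases "cmod w \<le> r")
      case False
      then show ?thesis using out[OF w] by (simp add: \<phi>_def)
    next
      case True
      have z1: "cmod z < 1" using z r by simp
      have u: "cmod (z * cnj w) \<le> r\<^sup>2"
        unfolding norm_mult complex_mod_cnj power2_eq_square using z True r by (intro mult_mono) auto
      have "cmod (?P z w) \<le> (1 - (cmod (z * cnj w))\<^sup>2) / (cmod (1 - z * cnj w))\<^sup>2 + 2 * cmod (z * cnj w) ^ m / (1 - cmod (z * cnj w))"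
        using u r2 by (intro two_sided_geometric_sum) simp
      also have "(1 - (cmod (z * cnj w))\<^sup>2) / (cmod (1 - z * cnj w))\<^sup>2 = poisson_pair z w"
        by (simp add: poisson_pair_def norm_mult power_mult_distrib)
      also have "\<dots> \<le> 2 * (vs_kernel z w + vs_kernel w z)" by (rule poisson_pair_le[OF z1 w])
      also have "2 * cmod (z * cnj w) ^ m / (1 - cmod (z * cnj w)) \<le> e m"
        unfolding e_def using u r2 by (intro frac_le mult_left_mono power_mono) auto
      finally have "cmod (?P z w) \<le> 2 * (vs_kernel z w + vs_kernel w z) + e m" by simp
      from ennreal_leI[OF this] have "ennreal (cmod (?P z w)) \<le> ennreal 2 * (ennreal (vs_kernel z w) + ennreal (vs_kernel w z)) + ennreal (e m)"
        using vs_kernel_nonneg[OF z1] vs_kernel_nonneg[OF w] e0[of m] by (simp add: ennreal_mult)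
      then show ?thesis by (rule mult_right_mono) simp
    qed
    \<comment> \<open>Adding the moments of the conjugate only increases the sum, and it makes the
      kernel two-sided.\<close>
    have "ennreal (\<Sum>k<Suc m. (cmod (b k))\<^sup>2) \<le> ennreal ((\<Sum>k<Suc m. (cmod (b k))\<^sup>2) + (\<Sum>k<m. (cmod (b' (Suc k)))\<^sup>2))"
      by (intro ennreal_leI) (simp add: sum_nonneg)
    also have "\<dots> = ennreal (cmod (\<integral>z. ?G z * \<psi> z \<partial>\<sigma>))"
      unfolding eq[symmetric] norm_of_real by (subst abs_of_nonneg) (auto intro!: add_nonneg_nonneg sum_nonneg)
    also have "\<dots> \<le> (\<integral>\<^sup>+z. ennreal (cmod (?G z * \<psi> z)) \<partial>\<sigma>)"
      by (rule integral_norm_bound_ennreal[OF Gint])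
    also have "\<dots> \<le> (\<integral>\<^sup>+z. \<phi> z * (\<integral>\<^sup>+w. (ennreal 2 * (ennreal (vs_kernel z w) + ennreal (vs_kernel w z)) + ennreal (e m)) * \<phi> w \<partial>\<sigma>) \<partial>\<sigma>)"
    proof (rule nn_integral_mono)
      fix z assume "z \<in> space \<sigma>"
      then have z: "cmod z < 1" by (simp add: space_\<sigma>)
      show "ennreal (cmod (?G z * \<psi> z)) \<le> \<phi> z * (\<integral>\<^sup>+w. (ennreal 2 * (ennreal (vs_kernel z w) + ennreal (vs_kernel w z)) + ennreal (e m)) * \<phi> w \<partial>\<sigma>)"
      proof (cases "cmod z \<le> r")
        case False
        then show ?thesis using out[OF z] by simp
      next
        case True
        have "ennreal (cmod (?G z)) \<le> (\<integral>\<^sup>+w. ennreal (cmod (?P z w * cnj (\<psi> w))) \<partial>\<sigma>)"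
        proof (cases "integrable \<sigma> (\<lambda>w. ?P z w * cnj (\<psi> w))")
          case True
          then show ?thesis unfolding G by (rule integral_norm_bound_ennreal)
        next
          \<comment> \<open>A non-integrable function has Bochner integral 0.\<close>
          case False
          then show ?thesis unfolding G not_integrable_integral_eq[OF False] by simp
        qed
        also have "\<dots> = (\<integral>\<^sup>+w. ennreal (cmod (?P z w)) * \<phi> w \<partial>\<sigma>)"
          unfolding \<phi>_def norm_mult complex_mod_cnj by (simp add: ennreal_mult)
        also have "\<dots> \<le> (\<integral>\<^sup>+w. (ennreal 2 * (ennreal (vs_kernel z w) + ennreal (vs_kernel w z)) + ennreal (e m)) * \<phi> w \<partial>\<sigma>)"
          by (intro nn_integral_mono Pb True) (auto simp: space_\<sigma>)
        finally have "ennreal (cmod (?G z)) * \<phi> z \<le> (\<integral>\<^sup>+w. (ennreal 2 * (ennreal (vs_kernel z w) + ennreal (vs_kernel w z)) + ennreal (e m)) * \<phi> w \<partial>\<sigma>) * \<phi> z"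
          by (rule mult_right_mono) simp
        then show ?thesis by (simp only: norm_mult ennreal_mult norm_ge_zero \<phi>_def mult.commute)
      qed
    qed
    also have "\<dots> = (\<integral>\<^sup>+z. ennreal 2 * (\<phi> z * (\<integral>\<^sup>+w. ennreal (vs_kernel z w) * \<phi> w \<partial>\<sigma>))
        + ennreal 2 * (\<integral>\<^sup>+w. \<phi> w * (ennreal (vs_kernel w z) * \<phi> z) \<partial>\<sigma>) + ennreal (e m) * (\<phi> z * S) \<partial>\<sigma>)"
      unfolding S_def
      by (intro nn_integral_cong)
        (simp add: nn_integral_cmult[symmetric] nn_integral_add[symmetric] distrib_left distrib_right mult_ac)
    also have "\<dots> = ennreal 2 * J + ennreal 2 * (\<integral>\<^sup>+z. (\<integral>\<^sup>+w. \<phi> w * (ennreal (vs_kernel w z) * \<phi> z) \<partial>\<sigma>) \<partial>\<sigma>) + ennreal (e m) * (S * S)"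
      unfolding J_def by (simp add: nn_integral_cmult nn_integral_add nn_integral_multc S_def[symmetric])
    \<comment> \<open>By Fubini the transposed half of the kernel contributes the same form
      \<open>J\<close>, whence the coefficient 4.\<close>
    also have "(\<integral>\<^sup>+z. (\<integral>\<^sup>+w. \<phi> w * (ennreal (vs_kernel w z) * \<phi> z) \<partial>\<sigma>) \<partial>\<sigma>) = (\<integral>\<^sup>+w. (\<integral>\<^sup>+z. \<phi> w * (ennreal (vs_kernel w z) * \<phi> z) \<partial>\<sigma>) \<partial>\<sigma>)"
      by (rule pair.Fubini') measurable
    also have "\<dots> = J" unfolding J_def by (simp add: nn_integral_cmult)
    also have "ennreal 2 * J + ennreal 2 * J + ennreal (e m) * (S * S) = ennreal 4 * J + ennreal (e m) * (S * S)"
      by (simp add: distrib_right[symmetric])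
    finally show ?thesis .
  qed
  have J_le: "J \<le> ennreal (8 * K) * (\<integral>\<^sup>+z. (\<phi> z)\<^sup>2 \<partial>\<sigma>)"
    unfolding J_def
  proof (rule quadratic_form_bound[OF \<phi>m _ r(2), of B])
    fix z :: complex assume "cmod z < 1"
    from ennreal_leI[OF bound[OF this]] show "\<phi> z \<le> ennreal B * indicator (cball 0 r) z"
      unfolding \<phi>_def by (auto simp: indicator_def)
  qed
  have e_lim: "(\<lambda>m. ennreal 4 * J + ennreal (e m) * (S * S)) \<longlonglongrightarrow> ennreal 4 * J + ennreal 0 * (S * S)"
  proof (intro tendsto_add tendsto_const)
    have "e \<longlonglongrightarrow> 2 * 0 / (1 - r\<^sup>2)"
      unfolding e_def using r r2 by (intro tendsto_intros LIMSEQ_realpow_zero) auto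
    then have "(\<lambda>m. ennreal (e m)) \<longlonglongrightarrow> ennreal 0" by (intro tendsto_ennrealI) simp
    then show "(\<lambda>m. ennreal (e m) * (S * S)) \<longlonglongrightarrow> ennreal 0 * (S * S)"
      unfolding mult.commute[of _ "S * S"] using S_fin
      by (intro ennreal_tendsto_cmult) (auto simp: ennreal_mult_less_top)
  qed
  \<comment> \<open>The number \<open>n\<close> of moments is fixed while \<open>m\<close> grows;
    since \<open>S\<close> is finite, the truncation error disappears.\<close>
  have "ennreal (\<Sum>k<n. (cmod (b k))\<^sup>2) \<le> ennreal 4 * J + ennreal 0 * (S * S)"
  proof (rule LIMSEQ_le_const[OF e_lim], intro exI allI impI)
    fix m assume "n \<le> m"
    then have "ennreal (\<Sum>k<n. (cmod (b k))\<^sup>2) \<le> ennreal (\<Sum>k<Suc m. (cmod (b k))\<^sup>2)"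
      by (intro ennreal_leI sum_mono2) auto
    also note step
    finally show "ennreal (\<Sum>k<n. (cmod (b k))\<^sup>2) \<le> ennreal 4 * J + ennreal (e m) * (S * S)" .
  qed
  also have "\<dots> \<le> ennreal 4 * (ennreal (8 * K) * (\<integral>\<^sup>+z. (\<phi> z)\<^sup>2 \<partial>\<sigma>))"
    using J_le by (simp add: mult_left_mono)
  also have "\<dots> = ennreal (32 * K) * (\<integral>\<^sup>+z. (\<phi> z)\<^sup>2 \<partial>\<sigma>)"
  proof -
    have "ennreal 4 * ennreal (8 * K) = ennreal (32 * K)"
      using K_pos by (subst ennreal_mult[symmetric]) auto
    then show ?thesis by (simp only: mult.assoc[symmetric])
  qed
  finally show ?thesis by (simp only: b_def \<phi>_def ennreal_power norm_ge_zero)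
qed

text \<open>Duality: the pairing of \<open>g\<close> with \<open>\<psi>\<close>, its conjugate cut
  off at radius \<open>r\<close>, is the integral \<open>I\<close> to be bounded, and termwise
  integration writes it as a sum of Taylor coefficients times moments. Cauchy-Schwarz and
  \<open>moment_bound\<close> bound \<open>I^2\<close> by \<open>32 K I\<close> times
  \<open>H2.sqnorm g\<close>; the cutoff makes \<open>I\<close> finite, so one factor
  \<open>I\<close> can be divided out.\<close>

lemma embedding:
  assumes g: "g \<in> H2" and r: "0 \<le> r" "r < 1"
  shows "(\<integral>\<^sup>+z. ennreal ((cmod (g z))\<^sup>2) * indicator (cball 0 r) z \<partial>\<sigma>) \<le> ennreal (32 * K * H2.sqnorm g)"
proof -
  have hol: "g holomorphic_on unit_disc" using g by (simp add: H2_def)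
  have gm[measurable]: "g \<in> borel_measurable \<sigma>"
    by (intro continuous_measurable holomorphic_on_imp_continuous_on hol)
  have cbm: "cball 0 r \<in> sets \<sigma>"
    unfolding sets_\<sigma> using r by (auto simp: sets_restrict_space_iff)
  define \<psi> where "\<psi> z = cnj (g z) * of_real (indicator (cball 0 r) z)" for z
  define B where "B = sqrt (H2.sqnorm g / (1 - r\<^sup>2))"
  have r2: "r\<^sup>2 < 1" using r by (simp add: abs_square_less_1)
  have \<psi>m[measurable]: "\<psi> \<in> borel_measurable \<sigma>"
    unfolding \<psi>_def using cbm by (intro borel_measurable_times measurable_compose[OF gm cnj_measurable]
        measurable_compose[OF borel_measurable_indicator of_real_measurable])
  have gB: "cmod (g z) \<le> B" if "cmod z \<le> r" for z
  proof -
    have "(cmod (g z))\<^sup>2 \<le> H2.sqnorm g / (1 - (cmod z)\<^sup>2)"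
      using that r by (intro H2_eval_bound g) auto
    also have "\<dots> \<le> H2.sqnorm g / (1 - r\<^sup>2)"
    proof -
      have "(cmod z)\<^sup>2 \<le> r\<^sup>2" using that by (intro power_mono) auto
      then show ?thesis using H2.sqnorm_nonneg[OF g] r2 by (intro divide_left_mono mult_pos_pos) auto
    qed
    finally show ?thesis unfolding B_def by (rule real_le_rsqrt)
  qed
  have \<psi>b: "cmod (\<psi> z) \<le> B * indicator (cball 0 r) z" for z
    using gB[of z] by (auto simp: \<psi>_def indicator_def)
  have \<psi>B: "cmod (\<psi> z) \<le> \<bar>B\<bar>" for z using \<psi>b[of z] by (cases "cmod z \<le> r") auto
  define I where "I = (\<integral>z. (cmod (\<psi> z))\<^sup>2 \<partial>\<sigma>)"
  have I_int: "integrable \<sigma> (\<lambda>z. (cmod (\<psi> z))\<^sup>2)"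
  proof (rule integrable_const_bound[where B = "B\<^sup>2"])
    have "(cmod (\<psi> z))\<^sup>2 \<le> B\<^sup>2" for z
      using power_mono[OF \<psi>B[of z] norm_ge_zero, of 2] by simp
    then show "AE z in \<sigma>. norm ((cmod (\<psi> z))\<^sup>2) \<le> B\<^sup>2" by (intro AE_I2) simp
  qed measurable
  have I_nn: "(\<integral>\<^sup>+z. ennreal ((cmod (\<psi> z))\<^sup>2) \<partial>\<sigma>) = ennreal I"
    unfolding I_def by (rule nn_integral_eq_integral[OF I_int]) auto
  have I0: "0 \<le> I" unfolding I_def by simp
  define b where "b k = (\<integral>z. z ^ k * \<psi> z \<partial>\<sigma>)" for k
  let ?c = "taylor_coeff g"
  have "summable (\<lambda>k. ?c k * complex_of_real ((r + 1) / 2) ^ k)"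
    using taylor_sums[OF hol, of "complex_of_real ((r + 1) / 2)"] r by (auto simp: sums_iff norm_divide)
  then have sm: "summable (\<lambda>k. cmod (?c k * complex_of_real r ^ k))"
    by (rule powser_insidea) (use r in auto)
  define M where "M = (\<Sum>k. cmod (?c k * complex_of_real r ^ k))"
  have M: "cmod (\<Sum>k<n. ?c k * z ^ k) \<le> M" if "cmod z \<le> r" for n z
  proof -
    have "cmod (\<Sum>k<n. ?c k * z ^ k) \<le> (\<Sum>k<n. cmod (?c k * complex_of_real r ^ k))"
      using that r by (intro sum_norm_le) (auto simp: norm_mult norm_power intro!: mult_left_mono power_mono)
    also have "\<dots> \<le> M" unfolding M_def by (intro sum_le_suminf sm) auto
    finally show ?thesis .
  qed
  \<comment> \<open>Termwise integration of the Taylor series, which is dominated on the support of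
    \<open>\<psi>\<close>.\<close>
  have "(\<lambda>n. \<integral>z. (\<Sum>k<n. ?c k * z ^ k) * \<psi> z \<partial>\<sigma>) \<longlonglongrightarrow> (\<integral>z. g z * \<psi> z \<partial>\<sigma>)"
  proof (rule integral_dominated_convergence[where w = "\<lambda>_. M * \<bar>B\<bar>"])
    show "AE z in \<sigma>. (\<lambda>n. (\<Sum>k<n. ?c k * z ^ k) * \<psi> z) \<longlonglongrightarrow> g z * \<psi> z"
      using taylor_sums[OF hol] by (intro AE_I2 tendsto_mult tendsto_const) (simp add: sums_def space_\<sigma>)
    show "AE z in \<sigma>. norm ((\<Sum>k<n. ?c k * z ^ k) * \<psi> z) \<le> M * \<bar>B\<bar>" for n
    proof (intro AE_I2)
      fix z assume "z \<in> space \<sigma>"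
      show "norm ((\<Sum>k<n. ?c k * z ^ k) * \<psi> z) \<le> M * \<bar>B\<bar>"
      proof (cases "cmod z \<le> r")
        case True
        then show ?thesis unfolding norm_mult
          using M[OF True] \<psi>B by (intro mult_mono) (auto intro: order_trans[OF norm_ge_zero])
      next
        case False
        then have "\<psi> z = 0" by (simp add: \<psi>_def)
        moreover have "0 \<le> M" unfolding M_def by (intro suminf_nonneg sm) auto
        ultimately show ?thesis by simp
      qed
    qed
  qed (auto intro!: borel_measurable_times borel_measurable_sum borel_measurable_power)
  also have "(\<lambda>n. \<integral>z. (\<Sum>k<n. ?c k * z ^ k) * \<psi> z \<partial>\<sigma>) = (\<lambda>n. \<Sum>k<n. ?c k * b k)"
  proof
    fix n
    have int: "integrable \<sigma> (\<lambda>z. z ^ k * \<psi> z)" for k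
    proof (rule integrable_const_bound[where B = "\<bar>B\<bar>"])
      show "AE z in \<sigma>. norm (z ^ k * \<psi> z) \<le> \<bar>B\<bar>"
        using \<psi>B by (intro AE_I2) (auto simp: space_\<sigma> norm_mult norm_power power_le_one intro: mult_left_le_one_le[THEN order_trans])
    qed measurable
    show "(\<integral>z. (\<Sum>k<n. ?c k * z ^ k) * \<psi> z \<partial>\<sigma>) = (\<Sum>k<n. ?c k * b k)"
      unfolding sum_distrib_right mult.assoc b_def
      by (subst Bochner_Integration.integral_sum) (auto intro: integrable_mult_right int)
  qed
  also have "(\<integral>z. g z * \<psi> z \<partial>\<sigma>) = of_real I"
  proof -
    have "g z * \<psi> z = of_real ((cmod (\<psi> z))\<^sup>2)" for z
      unfolding complex_norm_square by (simp add: \<psi>_def indicator_def)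
    then show ?thesis by (simp only: I_def integral_complex_of_real)
  qed
  finally have lim: "(\<lambda>n. \<Sum>k<n. ?c k * b k) \<longlonglongrightarrow> complex_of_real I" .
  have "(cmod (\<Sum>k<n. ?c k * b k))\<^sup>2 \<le> H2.sqnorm g * (32 * K * I)" for n
  proof -
    have "ennreal (\<Sum>k<n. (cmod (b k))\<^sup>2) \<le> ennreal (32 * K) * ennreal I"
      unfolding I_nn[symmetric] b_def by (rule moment_bound[OF \<psi>m \<psi>b r])
    also have "\<dots> = ennreal (32 * K * I)"
      using K_pos I0 by (intro ennreal_mult[symmetric]) auto
    finally have "(\<Sum>k<n. (cmod (b k))\<^sup>2) \<le> 32 * K * I"
      using K_pos I0 by (subst (asm) ennreal_le_iff) auto
    moreover have "(\<Sum>k<n. (cmod (?c k))\<^sup>2) \<le> H2.sqnorm g"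
      using sum_le_suminf[of "\<lambda>k. (cmod (?c k))\<^sup>2" "{..<n}"] H2_sqnorm_sums[OF g] by (simp add: sums_iff)
    moreover have "(cmod (\<Sum>k<n. ?c k * b k))\<^sup>2 \<le> (\<Sum>k<n. cmod (?c k) * cmod (b k))\<^sup>2"
      by (intro power_mono order_trans[OF norm_sum]) (auto simp: norm_mult)
    moreover have "(\<Sum>k<n. cmod (?c k) * cmod (b k))\<^sup>2 \<le> (\<Sum>k<n. (cmod (?c k))\<^sup>2) * (\<Sum>k<n. (cmod (b k))\<^sup>2)"
      by (rule Cauchy_Schwarz_ineq_sum)
    moreover have "(\<Sum>k<n. (cmod (?c k))\<^sup>2) * (\<Sum>k<n. (cmod (b k))\<^sup>2) \<le> H2.sqnorm g * (32 * K * I)"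
      using calculation(1,2) H2.sqnorm_nonneg[OF g] by (intro mult_mono) (auto intro: sum_nonneg)
    ultimately show ?thesis by linarith
  qed
  moreover have "(\<lambda>n. (cmod (\<Sum>k<n. ?c k * b k))\<^sup>2) \<longlonglongrightarrow> (cmod (complex_of_real I))\<^sup>2"
    by (intro tendsto_intros lim)
  ultimately have "(cmod (complex_of_real I))\<^sup>2 \<le> H2.sqnorm g * (32 * K * I)"
    by (intro LIMSEQ_le_const2) auto
  then have "I * I \<le> (32 * K * H2.sqnorm g) * I" by (simp add: power2_eq_square mult_ac)
  then have "I \<le> 32 * K * H2.sqnorm g"
    using I0 K_pos H2.sqnorm_nonneg[OF g] by (cases "I = 0") auto
  have "(\<integral>\<^sup>+z. ennreal ((cmod (g z))\<^sup>2) * indicator (cball 0 r) z \<partial>\<sigma>) = (\<integral>\<^sup>+z. ennreal ((cmod (\<psi> z))\<^sup>2) \<partial>\<sigma>)"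
    by (intro nn_integral_cong) (auto simp: \<psi>_def indicator_def)
  also have "\<dots> \<le> ennreal (32 * K * H2.sqnorm g)"
    unfolding I_nn by (rule ennreal_leI) fact
  finally show ?thesis .
qed

end

section \<open>The reproducing kernel and its approximation\<close>

context atomic_dirichlet
begin

section \<open>Existence of the reproducing kernel\<close>

lemma D_one: "(\<lambda>_. 1) \<in> D"
  by (rule represents_imp(3)[where c = "\<lambda>_. 1" and g = "\<lambda>_ _. 0"])
    (auto simp: represents_def H2_const)

lemma D_sqnorm_split:
  assumes "f \<in> D"
  shows "D.sqnorm f = H2.sqnorm f + E.sqnorm f"
  by (simp add: D.sqnorm_def dirichlet_inner_eq H2.sqnorm_def E.sqnorm_def)

text \<open>The finitely many Taylor coefficients in \<open>X M\<close> converge, so they are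
  subtracted from the bound before Fatou's lemma is applied to the energy. In this way the sum of
  both parts, and not just each of them, stays below \<open>d\<close>; then \<open>M\<close>
  grows.\<close>

lemma D_lower_semicontinuous:
  assumes F: "\<And>n. F n \<in> D" and bd: "\<And>n. D.sqnorm (F n) \<le> \<delta> n" and \<delta>: "\<delta> \<longlonglongrightarrow> d"
    and g: "g holomorphic_on unit_disc"
    and ul: "\<And>K. \<lbrakk>compact K; K \<subseteq> unit_disc\<rbrakk> \<Longrightarrow> uniform_limit K F g sequentially"
  shows "g \<in> D" "D.sqnorm g \<le> d"
proof -
  have lim: "(\<lambda>n. (deriv ^^ k) (F n) z) \<longlonglongrightarrow> (deriv ^^ k) g z" if z: "cmod z < 1" for z k
  proof -
    obtain r where r: "cmod z < r" "r < 1" using dense[OF z] by blast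
    show ?thesis
    proof (rule higher_deriv_complex_uniform_limit)
      show "uniform_limit (ball 0 r) F g sequentially"
        by (rule uniform_limit_on_subset[OF ul[of "cball 0 r"]]) (use r in auto)
      show "\<forall>\<^sub>F n in sequentially. F n holomorphic_on ball 0 r"
        using r by (intro always_eventually allI holomorphic_on_subset[OF D_imp(1)[OF F]] subset_ball) simp
    qed (use r in simp_all)
  qed
  define x where "x M n = (\<Sum>k<M. (cmod (taylor_coeff (F n) k))\<^sup>2)" for M n
  define X where "X M = (\<Sum>k<M. (cmod (taylor_coeff g k))\<^sup>2)" for M
  have xX: "x M \<longlonglongrightarrow> X M" for M
    unfolding x_def X_def taylor_coeff_def by (intro tendsto_intros lim) auto
  have x_le: "x M n \<le> H2.sqnorm (F n)" for M n
    unfolding x_def using sum_le_suminf[of "\<lambda>k. (cmod (taylor_coeff (F n) k))\<^sup>2" "{..<M}"]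
      H2_sqnorm_sums[OF D_imp(2)[OF F[of n]]] by (simp add: sums_iff)
  have xE: "x M n + E.sqnorm (F n) \<le> \<delta> n" for M n
    using x_le[of M n] bd[of n] D_sqnorm_split[OF F[of n]] by simp
  have Xd: "X M \<le> d" for M
  proof (rule LIMSEQ_le[OF xX \<delta>], intro exI allI impI)
    show "x M n \<le> \<delta> n" for n using xE[of M n] E.sqnorm_nonneg[OF F[of n]] by linarith
  qed
  have Y: "dirichlet_integral \<mu> g \<le> ennreal (d - X M)" for M
  proof -
    let ?h = "\<lambda>f z. ennreal ((cmod (deriv f z))\<^sup>2 * poisson \<mu> z)"
    have "dirichlet_integral \<mu> g = (\<integral>\<^sup>+z. liminf (\<lambda>n. ?h (F n) z) \<partial>disc_area)"
      unfolding dirichlet_integral_def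
    proof (rule nn_integral_cong)
      fix z assume "z \<in> space disc_area"
      then have z: "cmod z < 1" by simp
      have "(\<lambda>n. ?h (F n) z) \<longlonglongrightarrow> ?h g z"
        using lim[OF z, of 1] by (intro tendsto_ennrealI tendsto_intros) simp
      then show "?h g z = liminf (\<lambda>n. ?h (F n) z)"
        by (rule lim_imp_Liminf[OF sequentially_bot, symmetric])
    qed
    also have "\<dots> \<le> liminf (\<lambda>n. dirichlet_integral \<mu> (F n))"
      unfolding dirichlet_integral_def
    proof (rule nn_integral_liminf)
      show "?h (F n) \<in> borel_measurable disc_area" for n
        using deriv_measurable[OF D_imp(1)[OF F[of n]]] poisson_measurable by measurable
    qed
    also have "\<dots> \<le> liminf (\<lambda>n. ennreal (\<delta> n - x M n))"
      using xE[of M] by (intro Liminf_mono always_eventually allI)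
        (simp add: energy_self(2)[OF F] E.sqnorm_def[symmetric] ennreal_leI algebra_simps)
    also have "\<dots> = ennreal (d - X M)"
      by (intro lim_imp_Liminf tendsto_ennrealI tendsto_diff \<delta> xX) auto
    finally show ?thesis .
  qed
  have "dirichlet_integral \<mu> g < \<infinity>"
    using Y[of 0] by (rule order_le_less_trans) simp
  then show gD: "g \<in> D" using g by (simp add: dirichlet_space_def)
  have "X M \<le> d - E.sqnorm g" for M
  proof -
    have "ennreal (E.sqnorm g) \<le> ennreal (d - X M)"
      using Y[of M] energy_self(2)[OF gD] by (simp add: E.sqnorm_def)
    then show ?thesis using Xd[of M] by (subst (asm) ennreal_le_iff) auto
  qed
  then have "H2.sqnorm g \<le> d - E.sqnorm g"
    using H2_sqnorm_sums[OF D_imp(2)[OF gD]] unfolding X_def sums_def by (intro LIMSEQ_le_const2) auto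
  then show "D.sqnorm g \<le> d" using D_sqnorm_split[OF gD] by simp
qed

text \<open>The direct method, in place of completeness and the Riesz theorem: point evaluations
  bound a minimizing sequence on compact sets, so Montel's theorem yields a limit, and lower
  semicontinuity makes the limit a minimizer.\<close>

lemma minimizer_exists:
  assumes w: "cmod w < 1"
  obtains g where "g \<in> D" "g w = 1" "\<And>f. f \<in> D \<Longrightarrow> f w = 1 \<Longrightarrow> D.sqnorm g \<le> D.sqnorm f"
proof -
  define S where "S = {f \<in> D. f w = 1}"
  have S1: "(\<lambda>_. 1) \<in> S" using D_one by (simp add: S_def)
  define d where "d = (INF f\<in>S. D.sqnorm f)"
  have bdd: "bdd_below (D.sqnorm ` S)"
    by (rule bdd_belowI[of _ 0]) (auto simp: S_def D.sqnorm_nonneg)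
  have d_le: "d \<le> D.sqnorm f" if "f \<in> S" for f
    unfolding d_def using bdd that by (rule cINF_lower)
  have "\<exists>f\<in>S. D.sqnorm f < d + 1 / (real n + 1)" for n
  proof -
    have "d < d + 1 / (real n + 1)" by simp
    then show ?thesis unfolding d_def using cINF_less_iff[OF _ bdd] S1 by blast
  qed
  then obtain F where F: "\<And>n. F n \<in> S" "\<And>n. D.sqnorm (F n) < d + 1 / (real n + 1)" by metis
  have FD: "F n \<in> D" and Fw: "F n w = 1" for n using F(1)[of n] by (auto simp: S_def)
  let ?H = "{f \<in> D. D.sqnorm f \<le> d + 1}"
  obtain g r where g: "g holomorphic_on unit_disc" and r: "strict_mono (r :: nat \<Rightarrow> nat)"
    and pt: "\<And>x. x \<in> unit_disc \<Longrightarrow> ((\<lambda>n. F (r n) x) \<longlongrightarrow> g x) sequentially"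
    and ul: "\<And>K. \<lbrakk>compact K; K \<subseteq> unit_disc\<rbrakk> \<Longrightarrow> uniform_limit K (F \<circ> r) g sequentially"
  proof (rule Montel[of unit_disc ?H F])
    show "h holomorphic_on unit_disc" if "h \<in> ?H" for h using that D_imp by simp
    show "\<exists>B. \<forall>h\<in>?H. \<forall>z\<in>K. cmod (h z) \<le> B" if K: "compact K" "K \<subseteq> unit_disc" for K
    proof (cases "K = {}")
      case False
      \<comment> \<open>The evaluation bound is worst at the point of largest modulus.\<close>
      obtain z0 where z0: "z0 \<in> K" "\<And>z. z \<in> K \<Longrightarrow> cmod z \<le> cmod z0"
        using continuous_attains_sup[OF K(1) False, of cmod] by (auto intro: continuous_intros)
      have z01: "cmod z0 < 1" using z0(1) K(2) by auto
      have "cmod (h z) \<le> sqrt ((d + 1) / (1 - (cmod z0)\<^sup>2))" if h: "h \<in> ?H" and z: "z \<in> K" for h z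
      proof (rule real_le_rsqrt)
        have z1: "cmod z < 1" using z K(2) by auto
        have "(cmod (h z))\<^sup>2 \<le> D.sqnorm h / (1 - (cmod z)\<^sup>2)"
          using h z1 by (intro D_eval_bound) auto
        also have "\<dots> \<le> (d + 1) / (1 - (cmod z0)\<^sup>2)"
        proof (rule frac_le)
          show "0 \<le> d + 1" using h D.sqnorm_nonneg[of h] by simp
          show "D.sqnorm h \<le> d + 1" using h by simp
          show "0 < 1 - (cmod z0)\<^sup>2" using sq_less_1[OF z01] by simp
          show "1 - (cmod z0)\<^sup>2 \<le> 1 - (cmod z)\<^sup>2" using z0(2)[OF z] by (simp add: power_mono)
        qed
        finally show "(cmod (h z))\<^sup>2 \<le> (d + 1) / (1 - (cmod z0)\<^sup>2)" .
      qed
      then show ?thesis by blast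
    qed auto
    show "range F \<subseteq> ?H"
    proof safe
      fix n
      show "F n \<in> D" by (rule FD)
      have "1 / (real n + 1) \<le> 1" by simp
      then show "D.sqnorm (F n) \<le> d + 1" using F(2)[of n] by linarith
    qed
  qed auto
  have \<delta>: "(\<lambda>n. d + 1 / (real (r n) + 1)) \<longlonglongrightarrow> d"
  proof -
    have "(\<lambda>n. d + 1 / (real n + 1)) \<longlonglongrightarrow> d + 0"
      using LIMSEQ_inverse_real_of_nat by (intro tendsto_add tendsto_const) (simp add: inverse_eq_divide add.commute)
    from LIMSEQ_subseq_LIMSEQ[OF this r] show ?thesis by (simp add: o_def)
  qed
  have gD: "g \<in> D" and gd: "D.sqnorm g \<le> d"
    using D_lower_semicontinuous[of "F \<circ> r" "\<lambda>n. d + 1 / (real (r n) + 1)" d g] FD F(2) \<delta> g ul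
    by (auto intro: less_imp_le)
  have "g w = 1"
    using pt[of w] w by (simp add: Fw LIMSEQ_const_iff)
  then show ?thesis using that[of g] gD gd d_le by (force simp: S_def)
qed

text \<open>The minimizer \<open>g\<close> is orthogonal to every function vanishing at
  \<open>w\<close>. As \<open>f - f(w) g\<close> is such a function, pairing \<open>f\<close> with
  \<open>g\<close> returns \<open>f(w)\<close> times \<open>D.sqnorm g\<close>, and division
  normalizes.\<close>

lemma kernel_exists:
  assumes w: "cmod w < 1"
  shows "\<exists>k. k \<in> D \<and> (\<forall>f\<in>D. f w = dirichlet_inner \<mu> f k)"
proof -
  obtain g where g: "g \<in> D" "g w = 1" and min: "\<And>f. f \<in> D \<Longrightarrow> f w = 1 \<Longrightarrow> D.sqnorm g \<le> D.sqnorm f"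
    using minimizer_exists[OF w] by blast
  have "(cmod (g w))\<^sup>2 \<le> D.sqnorm g / (1 - (cmod w)\<^sup>2)" by (rule D_eval_bound[OF g(1) w])
  then have pos: "0 < D.sqnorm g" using g(2) sq_less_1[OF w] by (simp add: field_simps)
  have orth: "dirichlet_inner \<mu> g h = 0" if h: "h \<in> D" "h w = 0" for h
  proof (rule ccontr)
    let ?b = "dirichlet_inner \<mu> g h"
    assume nz: "?b \<noteq> 0"
    \<comment> \<open>Small enough for the quadratic term of the perturbation to stay below the
      linear gain.\<close>
    define s where "s = 1 / (1 + D.sqnorm h)"
    have s: "0 < s" "s * D.sqnorm h < 1" using D.sqnorm_nonneg[OF h(1)] by (auto simp: s_def field_simps)
    have "D.sqnorm g \<le> D.sqnorm (\<lambda>z. g z - (of_real s * ?b) * h z)"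
      by (rule min) (use D.mem_diff[OF g(1) D.mem_cmult[OF h(1)]] g h in auto)
    also have "\<dots> = D.sqnorm g + (cmod (of_real s * ?b))\<^sup>2 * D.sqnorm h - 2 * Re (cnj (of_real s * ?b) * ?b)"
      by (rule D.sqnorm_diff_scaled[OF g(1) h(1)])
    also have "cnj (of_real s * ?b) * ?b = of_real (s * (cmod ?b)\<^sup>2)"
      by (simp only: of_real_mult complex_norm_square) simp
    also have "(cmod (of_real s * ?b))\<^sup>2 = s\<^sup>2 * (cmod ?b)\<^sup>2"
      by (simp add: norm_mult power_mult_distrib)
    finally have "2 * (s * (cmod ?b)\<^sup>2) \<le> s * (cmod ?b)\<^sup>2 * (s * D.sqnorm h)"
      by (simp add: power2_eq_square mult_ac)
    moreover have "0 < s * (cmod ?b)\<^sup>2" using s nz by simp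
    then have "s * (cmod ?b)\<^sup>2 * (s * D.sqnorm h) < s * (cmod ?b)\<^sup>2 * 1"
      using s(2) by (intro mult_strict_left_mono)
    ultimately show False using \<open>0 < s * (cmod ?b)\<^sup>2\<close> by linarith
  qed
  let ?k = "\<lambda>z. of_real (1 / D.sqnorm g) * g z"
  have "f w = dirichlet_inner \<mu> f ?k" if f: "f \<in> D" for f
  proof -
    have fg: "(\<lambda>z. f z - f w * g z) \<in> D" by (intro D.mem_diff D.mem_cmult f g)
    have "dirichlet_inner \<mu> (\<lambda>z. f z - f w * g z) g = cnj (dirichlet_inner \<mu> g (\<lambda>z. f z - f w * g z))"
      by (rule D.inner_commute[OF g(1) fg])
    also have "\<dots> = 0" using orth[OF fg] g(2) by simp
    finally have "dirichlet_inner \<mu> f g = f w * of_real (D.sqnorm g)"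
      by (simp add: D.inner_diff_left[OF f D.mem_cmult[OF g(1)] g(1)] D.inner_cmult_left[OF g(1) g(1)]
          D.inner_self[OF g(1)])
    then show ?thesis using pos by (subst D.inner_cmult_right[OF g(1) f]) simp
  qed
  then show ?thesis using D.mem_cmult[OF g(1)] by blast
qed

abbreviation "ker \<equiv> repr_kernel \<mu>"

lemma ker:
  assumes "cmod w < 1"
  shows "ker w \<in> D" "f \<in> D \<Longrightarrow> dirichlet_inner \<mu> f (ker w) = f w"
  using someI_ex[OF kernel_exists[OF assms]] unfolding repr_kernel_def by auto

end

text \<open>This is the Blaschke factor of \<open>w\<close>, of modulus 1 on the circle, hence of
  norm 1; the computation here uses the reproducing property.\<close>

lemma szego_shift_sqnorm:
  assumes w: "cmod w < 1"
  shows "(\<lambda>z. (z - w) * szego w z) \<in> H2" "H2.sqnorm (\<lambda>z. (z - w) * szego w z) = 1"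
proof -
  note s = szego_H2[OF w] and zs = H2_mult_z[OF szego_H2(1)[OF w]]
  have eq: "(\<lambda>z. (z - w) * szego w z) = (\<lambda>z. z * szego w z - w * szego w z)" by (auto simp: algebra_simps)
  show "(\<lambda>z. (z - w) * szego w z) \<in> H2"
    unfolding eq by (intro H2.mem_diff zs(1) H2_cmult s(1))
  have d: "0 < 1 - (cmod w)\<^sup>2" using sq_less_1[OF w] by simp
  have sw: "szego w w = of_real (1 / (1 - (cmod w)\<^sup>2))"
    by (simp only: szego_def of_real_divide of_real_diff complex_norm_square) (simp add: mult.commute)
  have "cnj w * H2_inner (\<lambda>z. z * szego w z) (szego w) = of_real ((cmod w)\<^sup>2 * (1 / (1 - (cmod w)\<^sup>2)))"
    unfolding szego_reproducing[OF zs(1) w] sw of_real_mult complex_norm_square by (simp only: mult_ac)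
  then have r: "Re (cnj w * H2_inner (\<lambda>z. z * szego w z) (szego w)) = (cmod w)\<^sup>2 * (1 / (1 - (cmod w)\<^sup>2))"
    by (simp only: Re_complex_of_real)
  show "H2.sqnorm (\<lambda>z. (z - w) * szego w z) = 1"
    unfolding eq H2.sqnorm_diff_scaled[OF zs(1) s(1)] zs(2) s(2) r
  proof -
    have "y + x * y - 2 * (x * y) = (1 - x) * y" for x y :: real by (simp add: algebra_simps)
    from this[of "1 / (1 - (cmod w)\<^sup>2)" "(cmod w)\<^sup>2"]
    show "1 / (1 - (cmod w)\<^sup>2) + (cmod w)\<^sup>2 * (1 / (1 - (cmod w)\<^sup>2)) - 2 * ((cmod w)\<^sup>2 * (1 / (1 - (cmod w)\<^sup>2))) = 1"
      using d by simp
  qed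
qed

section \<open>Polynomials with simple zeros on the circle\<close>

definition root_prod :: "complex set \<Rightarrow> complex \<Rightarrow> complex" where
  "root_prod P z = (\<Prod>l\<in>P. z - l)"

lemma root_prod_insert: "finite P \<Longrightarrow> l \<notin> P \<Longrightarrow> root_prod (insert l P) z = (z - l) * root_prod P z"
  by (simp add: root_prod_def)

lemma root_prod_le:
  assumes "finite P" "\<And>l. l \<in> P \<Longrightarrow> cmod l = 1" "cmod z \<le> 1"
  shows "cmod (root_prod P z) \<le> 2 ^ card P"
proof -
  have "cmod (root_prod P z) = (\<Prod>l\<in>P. cmod (z - l))" by (simp add: root_prod_def prod_norm)
  also have "\<dots> \<le> (\<Prod>l\<in>P. 2)"
  proof (rule prod_mono)
    fix l assume "l \<in> P"
    then show "0 \<le> cmod (z - l) \<and> cmod (z - l) \<le> 2"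
      using norm_triangle_ineq4[of z l] assms by auto
  qed
  finally show ?thesis by simp
qed

text \<open>Each linear factor costs 4 by \<open>H2_mult_linear\<close>.\<close>

lemma root_prod_H2:
  assumes "finite P" "\<And>l. l \<in> P \<Longrightarrow> cmod l = 1" "h \<in> H2"
  shows "(\<lambda>z. root_prod P z * h z) \<in> H2 \<and> H2.sqnorm (\<lambda>z. root_prod P z * h z) \<le> 4 ^ card P * H2.sqnorm h"
  using assms(1,2)
proof (induction P rule: finite_induct)
  case empty
  then show ?case using assms(3) by (simp add: root_prod_def)
next
  case (insert l P)
  then have IH: "(\<lambda>z. root_prod P z * h z) \<in> H2" "H2.sqnorm (\<lambda>z. root_prod P z * h z) \<le> 4 ^ card P * H2.sqnorm h"
    by auto
  have "cmod l = 1" using insert by auto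
  note m = H2_mult_linear[OF IH(1) this]
  have eq: "(\<lambda>z. root_prod (insert l P) z * h z) = (\<lambda>z. (z - l) * (root_prod P z * h z))"
    using insert by (simp add: root_prod_insert mult.assoc)
  have "H2.sqnorm (\<lambda>z. (z - l) * (root_prod P z * h z)) \<le> 4 * (4 ^ card P * H2.sqnorm h)"
    using m(2) IH(2) by linarith
  then show ?case unfolding eq using m(1) insert by simp
qed

text \<open>Replacing \<open>P z\<close> by \<open>P w\<close> in front of the Szego kernel costs polynomial multiples of
  \<open>(z - w) / (1 - cnj w z)\<close>, which has norm 1 for every \<open>w\<close>.\<close>

lemma root_prod_szego_commutator:
  assumes "finite P" "\<And>l. l \<in> P \<Longrightarrow> cmod l = 1"
  shows "\<exists>C\<ge>0. \<forall>w. cmod w < 1 \<longrightarrow> (\<lambda>z. root_prod P z * szego w z - root_prod P w * szego w z) \<in> H2 \<and>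
    H2.sqnorm (\<lambda>z. root_prod P z * szego w z - root_prod P w * szego w z) \<le> C"
  using assms
proof (induction P rule: finite_induct)
  case empty
  then show ?case using H2_const[of 0] by (auto simp: root_prod_def intro!: exI[of _ 0])
next
  case (insert l P)
  then obtain C where C: "0 \<le> C" "\<And>w. cmod w < 1 \<Longrightarrow> (\<lambda>z. root_prod P z * szego w z - root_prod P w * szego w z) \<in> H2"
    "\<And>w. cmod w < 1 \<Longrightarrow> H2.sqnorm (\<lambda>z. root_prod P z * szego w z - root_prod P w * szego w z) \<le> C" by auto
  have l: "cmod l = 1" using insert by auto
  have "(\<lambda>z. root_prod (insert l P) z * szego w z - root_prod (insert l P) w * szego w z) \<in> H2 \<and>
    H2.sqnorm (\<lambda>z. root_prod (insert l P) z * szego w z - root_prod (insert l P) w * szego w z) \<le> 8 * C + 2 * (2 ^ card P)\<^sup>2"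
    if w: "cmod w < 1" for w
  proof -
    let ?e = "\<lambda>z. root_prod P z * szego w z - root_prod P w * szego w z"
    \<comment> \<open>Product rule for differences: the old error is multiplied by
      \<open>z - l\<close>, and the new term carries the Blaschke factor of norm 1.\<close>
    have eq: "(\<lambda>z. root_prod (insert l P) z * szego w z - root_prod (insert l P) w * szego w z) =
        (\<lambda>z. (z - l) * ?e z + root_prod P w * ((z - w) * szego w z))"
      unfolding root_prod_insert[OF insert(1,2)] by (auto simp: algebra_simps)
    note m = H2_mult_linear[OF C(2)[OF w] l] and s = szego_shift_sqnorm[OF w]
    have "H2.sqnorm (\<lambda>z. (z - l) * ?e z + root_prod P w * ((z - w) * szego w z))
      \<le> 2 * H2.sqnorm (\<lambda>z. (z - l) * ?e z) + 2 * H2.sqnorm (\<lambda>z. root_prod P w * ((z - w) * szego w z))"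
      by (rule H2.sqnorm_add_le[OF m(1) H2_cmult[OF s(1)]])
    also have "H2.sqnorm (\<lambda>z. root_prod P w * ((z - w) * szego w z)) = (cmod (root_prod P w))\<^sup>2"
      unfolding H2.sqnorm_cmult[OF s(1)] s(2) by simp
    also have "2 * H2.sqnorm (\<lambda>z. (z - l) * ?e z) + 2 * (cmod (root_prod P w))\<^sup>2 \<le> 8 * C + 2 * (2 ^ card P)\<^sup>2"
    proof -
      have "(cmod (root_prod P w))\<^sup>2 \<le> (2 ^ card P)\<^sup>2"
        using insert w by (intro power_mono root_prod_le) auto
      then show ?thesis using m(2) C(3)[OF w] by linarith
    qed
    finally show ?thesis unfolding eq using H2_add[OF m(1) H2_cmult[OF s(1)]] by simp
  qed
  then show ?case using C(1) by (intro exI[of _ "8 * C + 2 * (2 ^ card P)\<^sup>2"]) auto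
qed

context atomic_dirichlet
begin

section \<open>Comparison of the reproducing kernel with the test functions\<close>

definition p :: "complex \<Rightarrow> complex" where "p = root_prod Lam"
definition pl :: "complex \<Rightarrow> complex \<Rightarrow> complex" where "pl l = root_prod (Lam - {l})"
definition W :: "complex \<Rightarrow> real" where "W z = (cmod (p z))\<^sup>2 + (\<Sum>l\<in>Lam. a l * (cmod (pl l z))\<^sup>2)"

lemma p_factor: "l \<in> Lam \<Longrightarrow> p z = (z - l) * pl l z"
  using root_prod_insert[of "Lam - {l}" l z] finite_Lam by (simp add: p_def pl_def insert_absorb)

lemma p_nonzero: "cmod w < 1 \<Longrightarrow> p w \<noteq> 0"
  using finite_Lam Lam_circle by (auto simp: p_def root_prod_def)

lemma p_le: "cmod z \<le> 1 \<Longrightarrow> cmod (p z) \<le> 2 ^ card Lam"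
  unfolding p_def by (rule root_prod_le[OF finite_Lam Lam_circle])

lemma pl_le: "cmod z \<le> 1 \<Longrightarrow> cmod (pl l z) \<le> 2 ^ card Lam"
proof -
  assume "cmod z \<le> 1"
  then have "cmod (pl l z) \<le> 2 ^ card (Lam - {l})"
    unfolding pl_def using finite_Lam Lam_circle by (intro root_prod_le) auto
  also have "\<dots> \<le> 2 ^ card Lam" using finite_Lam by (intro power_increasing card_mono) auto
  finally show ?thesis .
qed

text \<open>The polynomials \<open>p\<close> and \<open>pl l\<close> have no common zero: a zero of
  \<open>p\<close> is an atom, and the \<open>pl\<close> of that atom does not vanish there.
  Compactness of the closed disc gives the uniform bound.\<close>

lemma W_lower_bound: obtains m where "0 < m" "\<And>z. cmod z \<le> 1 \<Longrightarrow> m \<le> W z"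
proof -
  have cont: "continuous_on (cball 0 1) W"
    unfolding W_def p_def pl_def root_prod_def by (intro continuous_intros)
  obtain z0 where z0: "cmod z0 \<le> 1" "\<And>z. cmod z \<le> 1 \<Longrightarrow> W z0 \<le> W z"
    using continuous_attains_inf[OF compact_cball _ cont] by (auto simp: mem_cball)
  have nn: "0 \<le> (\<Sum>l\<in>Lam. a l * (cmod (pl l z0))\<^sup>2)"
    using weight_pos by (intro sum_nonneg mult_nonneg_nonneg) (auto intro: less_imp_le)
  have "0 < W z0"
  proof (cases "p z0 = 0")
    case False
    then show ?thesis unfolding W_def using nn by (intro add_pos_nonneg) auto
  next
    case True
    then have l: "z0 \<in> Lam" using finite_Lam by (auto simp: p_def root_prod_def)
    have "pl z0 z0 \<noteq> 0" using finite_Lam by (auto simp: pl_def root_prod_def)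
    then have "0 < (\<Sum>l\<in>Lam. a l * (cmod (pl l z0))\<^sup>2)"
      using weight_pos finite_Lam l by (intro sum_pos2[OF finite_Lam l]) (auto intro!: mult_nonneg_nonneg intro: less_imp_le)
    then show ?thesis unfolding W_def by (intro add_nonneg_pos) auto
  qed
  then show ?thesis using that z0(2) by blast
qed

text \<open>Its conjugate \<open>p w / W w\<close> is the factor that turns the main term of the
  pairing of \<open>f\<close> with \<open>test w\<close> into \<open>f w\<close>.\<close>

definition testc :: "complex \<Rightarrow> complex" where "testc w = cnj (p w) / of_real (W w)"
definition test :: "complex \<Rightarrow> complex \<Rightarrow> complex" where "test w z = testc w * (p z * szego w z)"

lemma represents_test:
  assumes w: "cmod w < 1"
  shows "represents (test w) (\<lambda>_. 0) (\<lambda>l z. testc w * (pl l z * szego w z))"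
proof -
  have "(\<lambda>z. pl l z * szego w z) \<in> H2" for l
    using root_prod_H2[of "Lam - {l}" "szego w"] finite_Lam Lam_circle szego_H2[OF w]
    by (auto simp: pl_def)
  then show ?thesis
    unfolding represents_def test_def
    by (intro ballI conjI allI impI H2_cmult) (simp_all add: p_factor mult_ac)
qed

text \<open>The difference of kernel and test function represents the functional
  \<open>f w - dirichlet_inner \<mu> f (test w)\<close>, so a bound for this functional on
  \<open>D\<close>, uniform in \<open>w\<close>, bounds the norm of the difference. The functional
  has two sources: \<open>X\<close>, from freezing the polynomials at \<open>w\<close>, and
  \<open>Y\<close>, from the constants \<open>c l\<close>.\<close>

lemma test_approximates_kernel:
  obtains C where "0 \<le> C" "\<And>w. cmod w < 1 \<Longrightarrow> D.sqnorm (\<lambda>z. ker w z - test w z) \<le> C"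
proof -
  obtain m where m: "0 < m" "\<And>z. cmod z \<le> 1 \<Longrightarrow> m \<le> W z" using W_lower_bound by blast
  obtain C0 where C0': "0 \<le> C0 \<and> (\<forall>w. cmod w < 1 \<longrightarrow> (\<lambda>z. p z * szego w z - p w * szego w z) \<in> H2 \<and>
    H2.sqnorm (\<lambda>z. p z * szego w z - p w * szego w z) \<le> C0)"
    unfolding p_def by (rule exE[OF root_prod_szego_commutator[OF finite_Lam Lam_circle]])
  have C0: "0 \<le> C0" "\<And>w. cmod w < 1 \<Longrightarrow> (\<lambda>z. p z * szego w z - p w * szego w z) \<in> H2"
    "\<And>w. cmod w < 1 \<Longrightarrow> H2.sqnorm (\<lambda>z. p z * szego w z - p w * szego w z) \<le> C0"
    using C0' by simp_all
  have "\<exists>C. 0 \<le> C \<and> (\<forall>w. cmod w < 1 \<longrightarrow> (\<lambda>z. pl l z * szego w z - pl l w * szego w z) \<in> H2 \<and>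
    H2.sqnorm (\<lambda>z. pl l z * szego w z - pl l w * szego w z) \<le> C)" for l
    unfolding pl_def by (rule root_prod_szego_commutator) (use finite_Lam Lam_circle in simp_all)
  then obtain C1 where C1': "\<forall>l. 0 \<le> C1 l \<and> (\<forall>w. cmod w < 1 \<longrightarrow> (\<lambda>z. pl l z * szego w z - pl l w * szego w z) \<in> H2 \<and>
    H2.sqnorm (\<lambda>z. pl l z * szego w z - pl l w * szego w z) \<le> C1 l)"
    by (rule exE[OF choice[OF allI]])
  have C1: "\<And>l. 0 \<le> C1 l" "\<And>w l. cmod w < 1 \<Longrightarrow> (\<lambda>z. pl l z * szego w z - pl l w * szego w z) \<in> H2"
    "\<And>w l. cmod w < 1 \<Longrightarrow> H2.sqnorm (\<lambda>z. pl l z * szego w z - pl l w * szego w z) \<le> C1 l"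
    using C1' by simp_all
  define q where "q = (2 ^ card Lam :: real)"
  define C where "C = (q / m) * (sqrt C0 + (\<Sum>l\<in>Lam. a l * (1 / sqrt (a l) * sqrt (C1 l))))
      + (1 / m) * (\<Sum>l\<in>Lam. a l * q\<^sup>2 * (1 + 1 / sqrt (a l)))"
  have q: "0 < q" by (simp add: q_def)
  have C_nn: "0 \<le> C"
    unfolding C_def using m q C0(1) C1(1) weight_pos
    by (intro add_nonneg_nonneg mult_nonneg_nonneg sum_nonneg divide_nonneg_nonneg) (auto intro: less_imp_le)
  have main: "cmod (f w - dirichlet_inner \<mu> f (test w)) \<le> C * sqrt (D.sqnorm f)"
    if w: "cmod w < 1" and f: "f \<in> D" for f w
  proof -
    obtain c g where rep: "represents f c g" using representation_exists[OF f] by blast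
    define N where "N = sqrt (D.sqnorm f)"
    note gH = representsD(1)[OF rep] and fH = D_imp(2)[OF f]
    have gn: "0 \<le> a l * H2.sqnorm (g l)" if "l \<in> Lam" for l
      using weight_pos[OF that] H2.sqnorm_nonneg[OF gH[OF that]] by simp
    have Nf: "sqrt (H2.sqnorm f) \<le> N"
      unfolding N_def sqnorm_represents[OF rep] using gn by (simp add: sum_nonneg)
    have Ng: "sqrt (H2.sqnorm (g l)) \<le> 1 / sqrt (a l) * N" if l: "l \<in> Lam" for l
    proof -
      have "a l * H2.sqnorm (g l) \<le> (\<Sum>l\<in>Lam. a l * H2.sqnorm (g l))"
        using gn by (intro member_le_sum l finite_Lam) auto
      also have "\<dots> \<le> D.sqnorm f"
        unfolding sqnorm_represents[OF rep] using H2.sqnorm_nonneg[OF fH] by simp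
      finally have "sqrt (a l * H2.sqnorm (g l)) \<le> N" unfolding N_def by simp
      then show ?thesis using weight_pos[OF l] by (simp add: real_sqrt_mult field_simps)
    qed
    have N0: "0 \<le> N" unfolding N_def using D.sqnorm_nonneg[OF f] by simp
    have at0: "cmod (h 0) \<le> sqrt (H2.sqnorm h)" if "h \<in> H2" for h
      using H2_eval_bound[OF that, of 0] by (intro real_le_rsqrt) simp
    \<comment> \<open>The constants are bounded functionals of \<open>f\<close>: the decomposition
      is evaluated at \<open>0\<close> instead of at the boundary point \<open>l\<close>.\<close>
    have cl: "cmod (c l) \<le> (1 + 1 / sqrt (a l)) * N" if l: "l \<in> Lam" for l
    proof -
      have "c l = f 0 + l * g l 0" using representsD(2)[OF rep l, of 0] by simp
      then have "cmod (c l) \<le> cmod (f 0) + cmod (g l 0)"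
        using norm_triangle_ineq[of "f 0" "l * g l 0"] Lam_circle[OF l] by (simp add: norm_mult)
      also have "\<dots> \<le> N + 1 / sqrt (a l) * N"
        by (intro add_mono order_trans[OF at0[OF fH] Nf] order_trans[OF at0[OF gH[OF l]] Ng[OF l]])
      finally show ?thesis by (simp add: algebra_simps)
    qed
    have CS: "cmod (H2_inner h e) \<le> sqrt (H2.sqnorm h) * sqrt (H2.sqnorm e)" if "h \<in> H2" "e \<in> H2" for h e
      using H2.Cauchy_Schwarz[OF that] unfolding real_sqrt_mult[symmetric] by (rule real_le_rsqrt)
    let ?e = "\<lambda>z. p z * szego w z - p w * szego w z"
    let ?el = "\<lambda>l z. pl l z * szego w z - pl l w * szego w z"
    have psz: "(\<lambda>z. p z * szego w z) \<in> H2"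
      using root_prod_H2[OF finite_Lam Lam_circle szego_H2(1)[OF w]] by (simp add: p_def)
    have plsz: "(\<lambda>z. pl l z * szego w z) \<in> H2" for l
      using root_prod_H2[of "Lam - {l}" "szego w"] finite_Lam Lam_circle szego_H2[OF w]
      by (auto simp: pl_def)
    have split: "H2_inner h (\<lambda>z. q' z * szego w z) = H2_inner h (\<lambda>z. q' z * szego w z - q' w * szego w z) + cnj (q' w) * h w"
      if "h \<in> H2" "(\<lambda>z. q' z * szego w z) \<in> H2" for h q'
      using H2.inner_diff_right[OF that(2) H2_cmult[OF szego_H2(1)[OF w], of "q' w"] that(1)]
        H2.inner_cmult_right[OF szego_H2(1)[OF w] that(1), of "q' w"] szego_reproducing[OF that(1) w] by simp
    define X where "X = H2_inner f ?e + (\<Sum>l\<in>Lam. of_real (a l) * H2_inner (g l) (?el l))"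
    define Y where "Y = (\<Sum>l\<in>Lam. of_real (a l * (cmod (pl l w))\<^sup>2) * c l)"
    have Wm: "m \<le> W w" using m(2) w by simp
    then have Wp: "0 < W w" using m(1) by linarith
    have "dirichlet_inner \<mu> f (test w) = H2_inner f (\<lambda>z. testc w * (p z * szego w z))
        + (\<Sum>l\<in>Lam. of_real (a l) * H2_inner (g l) (\<lambda>z. testc w * (pl l z * szego w z)))"
      unfolding dirichlet_inner_eq energy_represents[OF rep represents_test[OF w]] by (simp add: test_def[abs_def])
    also have "\<dots> = cnj (testc w) * (H2_inner f (\<lambda>z. p z * szego w z) + (\<Sum>l\<in>Lam. of_real (a l) * H2_inner (g l) (\<lambda>z. pl l z * szego w z)))"
      unfolding H2.inner_cmult_right[OF psz fH] distrib_left sum_distrib_left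
      by (intro arg_cong2[of _ _ _ _ "(+)"] sum.cong refl)
        (subst H2.inner_cmult_right[OF plsz gH], assumption, rule mult.left_commute)
    also have "H2_inner f (\<lambda>z. p z * szego w z) + (\<Sum>l\<in>Lam. of_real (a l) * H2_inner (g l) (\<lambda>z. pl l z * szego w z))
       = X + (cnj (p w) * f w + (\<Sum>l\<in>Lam. of_real (a l) * (cnj (pl l w) * g l w)))"
      unfolding X_def split[OF fH psz]
      by (simp add: split[OF gH plsz] distrib_left sum.distrib cong: sum.cong)
    finally have inner: "dirichlet_inner \<mu> f (test w) = cnj (testc w) * X
       + cnj (testc w) * (cnj (p w) * f w + (\<Sum>l\<in>Lam. of_real (a l) * (cnj (pl l w) * g l w)))"
      by (simp only: distrib_left)
    \<comment> \<open>The factor \<open>p w\<close> contains \<open>w - l\<close>, which converts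
      \<open>g l w\<close> into \<open>f w - c l\<close>; the coefficients of \<open>f w\<close>
      then add up to \<open>W w\<close>.\<close>
    have "p w * (cnj (p w) * f w + (\<Sum>l\<in>Lam. of_real (a l) * (cnj (pl l w) * g l w))) = of_real (W w) * f w - Y"
    proof -
      have "p w * (\<Sum>l\<in>Lam. of_real (a l) * (cnj (pl l w) * g l w)) = (\<Sum>l\<in>Lam. of_real (a l * (cmod (pl l w))\<^sup>2) * (f w - c l))"
        unfolding sum_distrib_left
      proof (intro sum.cong refl)
        fix l assume l: "l \<in> Lam"
        have "f w - c l = (w - l) * g l w" using representsD(2)[OF rep l w] by simp
        then show "p w * (of_real (a l) * (cnj (pl l w) * g l w)) = of_real (a l * (cmod (pl l w))\<^sup>2) * (f w - c l)"
          unfolding p_factor[OF l] of_real_mult complex_norm_square by (simp add: mult_ac)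
      qed
      also have "\<dots> = of_real (\<Sum>l\<in>Lam. a l * (cmod (pl l w))\<^sup>2) * f w - Y"
        unfolding Y_def by (simp add: right_diff_distrib sum_subtractf sum_distrib_right)
      finally show ?thesis
        unfolding W_def of_real_add complex_norm_square distrib_left distrib_right by (simp add: mult.assoc)
    qed
    then have "cnj (testc w) * (cnj (p w) * f w + (\<Sum>l\<in>Lam. of_real (a l) * (cnj (pl l w) * g l w))) = f w - Y / of_real (W w)"
      using Wp by (simp add: testc_def field_simps)
    with inner have "f w - dirichlet_inner \<mu> f (test w) = Y / of_real (W w) - cnj (testc w) * X" by simp
    also have "cmod \<dots> \<le> cmod (Y / of_real (W w)) + cmod (cnj (testc w) * X)" by (rule norm_triangle_ineq4)
    also have "cmod (Y / of_real (W w)) \<le> (1 / m) * ((\<Sum>l\<in>Lam. a l * q\<^sup>2 * (1 + 1 / sqrt (a l))) * N)"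
    proof -
      have "cmod Y \<le> (\<Sum>l\<in>Lam. a l * q\<^sup>2 * (1 + 1 / sqrt (a l)) * N)"
        unfolding Y_def
      proof (rule sum_norm_le)
        fix l assume l: "l \<in> Lam"
        have "cmod (of_real (a l * (cmod (pl l w))\<^sup>2) * c l) = a l * (cmod (pl l w))\<^sup>2 * cmod (c l)"
          unfolding norm_mult norm_of_real using weight_pos[OF l] by simp
        also have "\<dots> \<le> a l * q\<^sup>2 * ((1 + 1 / sqrt (a l)) * N)"
          using weight_pos[OF l] pl_le[of w l] w cl[OF l] unfolding q_def
          by (intro mult_mono power_mono mult_nonneg_nonneg) auto
        finally show "cmod (of_real (a l * (cmod (pl l w))\<^sup>2) * c l) \<le> a l * q\<^sup>2 * (1 + 1 / sqrt (a l)) * N"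
          by (simp only: mult.assoc)
      qed
      moreover have "cmod (Y / of_real (W w)) \<le> cmod Y / m"
        unfolding norm_divide norm_of_real using Wp Wm m(1) by (intro frac_le) auto
      ultimately have "cmod (Y / of_real (W w)) \<le> (\<Sum>l\<in>Lam. a l * q\<^sup>2 * (1 + 1 / sqrt (a l)) * N) / m"
        using m(1) by (meson divide_right_mono less_imp_le order_trans)
      then show ?thesis by (simp add: sum_distrib_right)
    qed
    also have "cmod (cnj (testc w) * X) \<le> (q / m) * ((sqrt C0 + (\<Sum>l\<in>Lam. a l * (1 / sqrt (a l) * sqrt (C1 l)))) * N)"
    proof -
      have "cmod X \<le> cmod (H2_inner f ?e) + cmod (\<Sum>l\<in>Lam. of_real (a l) * H2_inner (g l) (?el l))"
        unfolding X_def by (rule norm_triangle_ineq)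
      also have "cmod (H2_inner f ?e) \<le> N * sqrt C0"
        using Nf C0 w N0 H2.sqnorm_nonneg[OF C0(2)[OF w]] by (intro order_trans[OF CS[OF fH C0(2)[OF w]]] mult_mono) auto
      also have "cmod (\<Sum>l\<in>Lam. of_real (a l) * H2_inner (g l) (?el l)) \<le> (\<Sum>l\<in>Lam. a l * ((1 / sqrt (a l) * N) * sqrt (C1 l)))"
      proof (rule sum_norm_le)
        fix l assume l: "l \<in> Lam"
        have "cmod (H2_inner (g l) (?el l)) \<le> (1 / sqrt (a l) * N) * sqrt (C1 l)"
          using Ng[OF l] C1(1)[of l] C1(3)[OF w, of l] w N0 weight_pos[OF l] H2.sqnorm_nonneg[OF C1(2)[OF w, of l]]
          by (intro order_trans[OF CS[OF gH[OF l] C1(2)[OF w]]] mult_mono) auto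
        then have "a l * cmod (H2_inner (g l) (?el l)) \<le> a l * ((1 / sqrt (a l) * N) * sqrt (C1 l))"
          using weight_pos[OF l] by (intro mult_left_mono) auto
        then show "cmod (of_real (a l) * H2_inner (g l) (?el l)) \<le> a l * ((1 / sqrt (a l) * N) * sqrt (C1 l))"
          unfolding norm_mult norm_of_real using weight_pos[OF l] by simp
      qed
      also have "N * sqrt C0 + (\<Sum>l\<in>Lam. a l * ((1 / sqrt (a l) * N) * sqrt (C1 l)))
         = (sqrt C0 + (\<Sum>l\<in>Lam. a l * (1 / sqrt (a l) * sqrt (C1 l)))) * N"
        unfolding distrib_right sum_distrib_right by (simp only: mult_ac)
      finally have X: "cmod X \<le> (sqrt C0 + (\<Sum>l\<in>Lam. a l * (1 / sqrt (a l) * sqrt (C1 l)))) * N" by simp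
      have "cmod (cnj (testc w)) = cmod (p w) / W w"
        unfolding testc_def complex_mod_cnj norm_divide norm_of_real using Wp by simp
      also have "\<dots> \<le> q / m"
        using p_le[of w] w Wm m(1) q unfolding q_def by (intro frac_le) auto
      finally show ?thesis
        unfolding norm_mult using X q m(1) by (intro mult_mono) auto
    qed
    finally have "cmod (f w - dirichlet_inner \<mu> f (test w)) \<le> C * N"
      unfolding C_def by (simp add: algebra_simps)
    then show ?thesis unfolding N_def .
  qed
  have "D.sqnorm (\<lambda>z. ker w z - test w z) \<le> C\<^sup>2" if w: "cmod w < 1" for w
  proof -
    let ?d = "\<lambda>z. ker w z - test w z"
    have tD: "test w \<in> D" by (rule represents_imp(3)[OF represents_test[OF w]])
    have dD: "?d \<in> D" by (rule D.mem_diff[OF ker(1)[OF w] tD])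
    \<comment> \<open>The bound for the functional is applied to the difference itself, which gives
      \<open>D.sqnorm ?d <= C * sqrt (D.sqnorm ?d)\<close>.\<close>
    have "dirichlet_inner \<mu> ?d ?d = ?d w - dirichlet_inner \<mu> ?d (test w)"
      using D.inner_diff_right[OF ker(1)[OF w] tD dD] ker(2)[OF w dD] by simp
    then have "D.sqnorm ?d \<le> cmod (?d w - dirichlet_inner \<mu> ?d (test w))"
      unfolding D.sqnorm_def by (simp only: complex_Re_le_cmod)
    also have "\<dots> \<le> C * sqrt (D.sqnorm ?d)" by (rule main[OF w dD])
    finally have le: "sqrt (D.sqnorm ?d) * sqrt (D.sqnorm ?d) \<le> C * sqrt (D.sqnorm ?d)"
      using D.sqnorm_nonneg[OF dD] by simp
    have "sqrt (D.sqnorm ?d) \<le> C"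
    proof (cases "sqrt (D.sqnorm ?d) = 0")
      case False
      then have "0 < sqrt (D.sqnorm ?d)" using D.sqnorm_nonneg[OF dD] by simp
      then show ?thesis by (rule mult_right_le_imp_le[OF le])
    qed (use C_nn in simp)
    then have "(sqrt (D.sqnorm ?d))\<^sup>2 \<le> C\<^sup>2" using D.sqnorm_nonneg[OF dD] by (intro power_mono) auto
    then show ?thesis using D.sqnorm_nonneg[OF dD] by simp
  qed
  then show ?thesis using that[of "C\<^sup>2"] by auto
qed

text \<open>The factor \<open>|p w|^2\<close> comes from \<open>testc\<close>, the factor
  \<open>1 / (1 - |w|^2)\<close> from the Szego kernel; multiplication by the polynomials costs a
  constant.\<close>

lemma test_sqnorm_bound:
  obtains C where "0 \<le> C" "\<And>w. cmod w < 1 \<Longrightarrow> D.sqnorm (test w) \<le> C * (cmod (p w))\<^sup>2 / (1 - (cmod w)\<^sup>2)"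
proof -
  obtain m where m: "0 < m" "\<And>z. cmod z \<le> 1 \<Longrightarrow> m \<le> W z" using W_lower_bound by blast
  define Q where "Q = (4 ^ card Lam :: real) * (1 + (\<Sum>l\<in>Lam. a l))"
  have suma: "0 \<le> (\<Sum>l\<in>Lam. a l)" using weight_pos by (intro sum_nonneg) (auto intro: less_imp_le)
  have "D.sqnorm (test w) \<le> Q / m\<^sup>2 * (cmod (p w))\<^sup>2 / (1 - (cmod w)\<^sup>2)" if w: "cmod w < 1" for w
  proof -
    note sz = szego_H2[OF w]
    have d: "0 < 1 - (cmod w)\<^sup>2" using sq_less_1[OF w] by simp
    have Wm: "m \<le> W w" using m(2) w by simp
    have b1: "(\<lambda>z. p z * szego w z) \<in> H2 \<and> H2.sqnorm (\<lambda>z. p z * szego w z) \<le> 4 ^ card Lam * (1 / (1 - (cmod w)\<^sup>2))"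
      using root_prod_H2[OF finite_Lam Lam_circle sz(1)] unfolding p_def sz(2) .
    have b2: "(\<lambda>z. pl l z * szego w z) \<in> H2 \<and> H2.sqnorm (\<lambda>z. pl l z * szego w z) \<le> 4 ^ card Lam * (1 / (1 - (cmod w)\<^sup>2))" for l
    proof -
      have "(\<lambda>z. pl l z * szego w z) \<in> H2 \<and> H2.sqnorm (\<lambda>z. pl l z * szego w z) \<le> 4 ^ card (Lam - {l}) * (1 / (1 - (cmod w)\<^sup>2))"
        using root_prod_H2[of "Lam - {l}", OF _ _ sz(1)] finite_Lam Lam_circle unfolding pl_def sz(2) by auto
      moreover have "(4 :: real) ^ card (Lam - {l}) \<le> 4 ^ card Lam" using finite_Lam by (intro power_increasing card_mono) auto
      then have "(4 :: real) ^ card (Lam - {l}) * (1 / (1 - (cmod w)\<^sup>2)) \<le> 4 ^ card Lam * (1 / (1 - (cmod w)\<^sup>2))"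
        using d by (intro mult_right_mono) auto
      ultimately show ?thesis by linarith
    qed
    have "D.sqnorm (test w) = H2.sqnorm (\<lambda>z. testc w * (p z * szego w z)) + (\<Sum>l\<in>Lam. a l * H2.sqnorm (\<lambda>z. testc w * (pl l z * szego w z)))"
      using sqnorm_represents[OF represents_test[OF w]] by (simp add: test_def[abs_def])
    also have "\<dots> = (cmod (testc w))\<^sup>2 * (H2.sqnorm (\<lambda>z. p z * szego w z) + (\<Sum>l\<in>Lam. a l * H2.sqnorm (\<lambda>z. pl l z * szego w z)))"
      unfolding H2.sqnorm_cmult[OF conjunct1[OF b1]] H2.sqnorm_cmult[OF conjunct1[OF b2]] distrib_left sum_distrib_left
      by (simp only: mult_ac)
    also have "\<dots> \<le> (cmod (p w) / m)\<^sup>2 * (4 ^ card Lam * (1 / (1 - (cmod w)\<^sup>2)) + (\<Sum>l\<in>Lam. a l * (4 ^ card Lam * (1 / (1 - (cmod w)\<^sup>2)))))"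
    proof (intro mult_mono add_mono sum_mono power_mono)
      show "cmod (testc w) \<le> cmod (p w) / m"
        unfolding testc_def norm_divide norm_of_real complex_mod_cnj using Wm m(1) by (intro frac_le) auto
      show "0 \<le> H2.sqnorm (\<lambda>z. p z * szego w z) + (\<Sum>l\<in>Lam. a l * H2.sqnorm (\<lambda>z. pl l z * szego w z))"
        using b1 b2 weight_pos by (intro add_nonneg_nonneg sum_nonneg mult_nonneg_nonneg H2.sqnorm_nonneg) (auto intro: less_imp_le)
    qed (use b1 b2 weight_pos H2.sqnorm_nonneg in \<open>auto intro: less_imp_le\<close>)
    also have "\<dots> = Q / m\<^sup>2 * (cmod (p w))\<^sup>2 / (1 - (cmod w)\<^sup>2)"
      unfolding Q_def sum_distrib_right[symmetric] by (simp add: power_divide algebra_simps add_divide_distrib)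
    finally show ?thesis .
  qed
  moreover have "0 \<le> Q / m\<^sup>2" unfolding Q_def using suma by simp
  ultimately show ?thesis using that by blast
qed

end

section \<open>From the kernel test to the Carleson embedding\<close>

lemma root_prod_lipschitz:
  assumes "finite P" "\<And>l. l \<in> P \<Longrightarrow> cmod l = 1"
  shows "\<exists>L\<ge>0. \<forall>z w. cmod z \<le> 1 \<longrightarrow> cmod w \<le> 1 \<longrightarrow> cmod (root_prod P z - root_prod P w) \<le> L * cmod (z - w)"
  using assms
proof (induction P rule: finite_induct)
  case empty
  then show ?case by (auto simp: root_prod_def intro!: exI[of _ 0])
next
  case (insert l P)
  then obtain L where L: "0 \<le> L"
    "\<And>z w. cmod z \<le> 1 \<Longrightarrow> cmod w \<le> 1 \<Longrightarrow> cmod (root_prod P z - root_prod P w) \<le> L * cmod (z - w)" by auto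
  have "cmod (root_prod (insert l P) z - root_prod (insert l P) w) \<le> (2 * L + 2 ^ card P) * cmod (z - w)"
    if z: "cmod z \<le> 1" and w: "cmod w \<le> 1" for z w
  proof -
    have "root_prod (insert l P) z - root_prod (insert l P) w =
        (z - l) * (root_prod P z - root_prod P w) + root_prod P w * (z - w)"
      unfolding root_prod_insert[OF insert(1,2)] by (simp add: algebra_simps)
    also have "cmod \<dots> \<le> cmod (z - l) * cmod (root_prod P z - root_prod P w) + cmod (root_prod P w) * cmod (z - w)"
      by (metis norm_mult norm_triangle_ineq)
    also have "\<dots> \<le> 2 * (L * cmod (z - w)) + 2 ^ card P * cmod (z - w)"
    proof (intro add_mono mult_mono L(2) z w root_prod_le)
      show "cmod (z - l) \<le> 2" using norm_triangle_ineq4[of z l] z insert.prems[of l] by simp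
    qed (use insert in auto)
    finally show ?thesis by (simp add: algebra_simps)
  qed
  then show ?case using L(1) by (intro exI[of _ "2 * L + 2 ^ card P"]) auto
qed

lemma three_squares_le: "(x + y + z)\<^sup>2 \<le> 3 * (x\<^sup>2 + y\<^sup>2 + z\<^sup>2)" for x y z :: real
proof -
  have "0 \<le> (x - y)\<^sup>2 + (y - z)\<^sup>2 + (x - z)\<^sup>2" by simp
  then show ?thesis by (simp add: power2_eq_square algebra_simps)
qed

context atomic_dirichlet
begin

text \<open>The last bound again evaluates the decomposition at \<open>0\<close>; it is what makes
  the constants harmless in the Carleson integral.\<close>

lemma component_bounds:
  assumes rep: "represents f c g" and l: "l \<in> Lam"
  shows "H2.sqnorm f \<le> D.sqnorm f" "a l * H2.sqnorm (g l) \<le> D.sqnorm f"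
    "(cmod (c l))\<^sup>2 \<le> 2 * (1 + 1 / a l) * D.sqnorm f"
proof -
  note gH = representsD(1)[OF rep] and fH = represents_imp(2)[OF rep]
  have gn: "0 \<le> a l * H2.sqnorm (g l)" if "l \<in> Lam" for l
    using weight_pos[OF that] H2.sqnorm_nonneg[OF gH[OF that]] by simp
  show 1: "H2.sqnorm f \<le> D.sqnorm f"
    unfolding sqnorm_represents[OF rep] using gn by (simp add: sum_nonneg)
  have "a l * H2.sqnorm (g l) \<le> (\<Sum>l\<in>Lam. a l * H2.sqnorm (g l))"
    using gn by (intro member_le_sum l finite_Lam) auto
  then show 2: "a l * H2.sqnorm (g l) \<le> D.sqnorm f"
    unfolding sqnorm_represents[OF rep] using H2.sqnorm_nonneg[OF fH] by simp
  have "c l = f 0 + l * g l 0" using representsD(2)[OF rep l, of 0] by simp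
  then have "(cmod (c l))\<^sup>2 \<le> 2 * (cmod (f 0))\<^sup>2 + 2 * (cmod (l * g l 0))\<^sup>2" by (simp only: cmod_add_squared_le)
  also have "\<dots> \<le> 2 * D.sqnorm f + 2 * (1 / a l * D.sqnorm f)"
  proof (intro add_mono mult_left_mono)
    show "(cmod (f 0))\<^sup>2 \<le> D.sqnorm f" using H2_eval_bound[OF fH, of 0] 1 by simp
    have "(cmod (l * g l 0))\<^sup>2 \<le> H2.sqnorm (g l)"
      using H2_eval_bound[OF gH[OF l], of 0] Lam_circle[OF l] by (simp add: norm_mult)
    also have "\<dots> \<le> 1 / a l * D.sqnorm f" using 2 weight_pos[OF l] by (simp add: field_simps)
    finally show "(cmod (l * g l 0))\<^sup>2 \<le> 1 / a l * D.sqnorm f" .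
  qed auto
  finally show "(cmod (c l))\<^sup>2 \<le> 2 * (1 + 1 / a l) * D.sqnorm f" by (simp add: algebra_simps)
qed

text \<open>The idea is to expand \<open>W f\<close> by means of \<open>f = c l + (z - l) g l\<close> instead of interpolating \<open>f\<close> by a
  polynomial at the points of \<open>Lam\<close>.\<close>

lemma pointwise_decomposition:
  assumes m: "0 < m" "\<And>z. cmod z \<le> 1 \<Longrightarrow> m \<le> W z"
    and rep: "represents f c g" and z: "cmod z < 1"
  shows "(cmod (f z))\<^sup>2 \<le> 3 / m\<^sup>2 * ((2 ^ card Lam)\<^sup>2 * ((cmod (p z))\<^sup>2 * (cmod (f z))\<^sup>2)
     + real (card Lam) * (2 ^ card Lam) ^ 4 * (\<Sum>l\<in>Lam. (a l)\<^sup>2 * (cmod (c l))\<^sup>2)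
     + (\<Sum>l\<in>Lam. real (card Lam) * (2 ^ card Lam)\<^sup>2 * (a l)\<^sup>2 * ((cmod (p z))\<^sup>2 * (cmod (g l z))\<^sup>2)))"
proof -
  define q where "q = (2 ^ card Lam :: real)"
  have q: "0 < q" by (simp add: q_def)
  have pq: "cmod (p z) \<le> q" "\<And>l. cmod (pl l z) \<le> q" unfolding q_def using p_le pl_le z by auto
  \<comment> \<open>For each atom, \<open>|pl l z|^2 (f z - c l)\<close> equals
    \<open>cnj (pl l z) p z g l z\<close>. Hence every part except the constants carries the factor
    \<open>p z\<close> that the weighted embedding provides.\<close>
  have eq: "of_real (W z) * f z = cnj (p z) * (p z * f z) + (\<Sum>l\<in>Lam. of_real (a l * (cmod (pl l z))\<^sup>2) * c l)
     + (\<Sum>l\<in>Lam. of_real (a l) * cnj (pl l z) * (p z * g l z))"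
  proof -
    have "of_real (a l * (cmod (pl l z))\<^sup>2) * f z = of_real (a l * (cmod (pl l z))\<^sup>2) * c l + of_real (a l) * cnj (pl l z) * (p z * g l z)"
      if l: "l \<in> Lam" for l
      unfolding representsD(2)[OF rep l z] p_factor[OF l] of_real_mult complex_norm_square by (simp add: algebra_simps)
    then have "of_real (\<Sum>l\<in>Lam. a l * (cmod (pl l z))\<^sup>2) * f z =
      (\<Sum>l\<in>Lam. of_real (a l * (cmod (pl l z))\<^sup>2) * c l) + (\<Sum>l\<in>Lam. of_real (a l) * cnj (pl l z) * (p z * g l z))"
      unfolding of_real_sum sum_distrib_right sum.distrib[symmetric] by (intro sum.cong refl)
    then show ?thesis
      unfolding W_def of_real_add distrib_right complex_norm_square by (simp add: mult_ac)
  qed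
  let ?x = "q * (cmod (p z) * cmod (f z))"
  let ?y = "\<Sum>l\<in>Lam. q\<^sup>2 * (a l * cmod (c l))"
  let ?z = "\<Sum>l\<in>Lam. q * (a l * (cmod (p z) * cmod (g l z)))"
  have "m * cmod (f z) \<le> W z * cmod (f z)" using m(2)[of z] z by (intro mult_right_mono) auto
  also have "\<dots> = cmod (of_real (W z) * f z)"
    using m(1) m(2)[of z] z by (simp add: norm_mult)
  also have "\<dots> \<le> cmod (cnj (p z) * (p z * f z)) + cmod (\<Sum>l\<in>Lam. of_real (a l * (cmod (pl l z))\<^sup>2) * c l)
     + cmod (\<Sum>l\<in>Lam. of_real (a l) * cnj (pl l z) * (p z * g l z))"
    unfolding eq by (rule order_trans[OF norm_triangle_ineq add_right_mono[OF norm_triangle_ineq]])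
  also have "\<dots> \<le> ?x + ?y + ?z"
  proof (intro add_mono sum_norm_le)
    show "cmod (cnj (p z) * (p z * f z)) \<le> ?x"
      unfolding norm_mult complex_mod_cnj using pq(1) by (intro mult_right_mono) auto
    fix l assume l: "l \<in> Lam"
    have al: "0 \<le> a l" using weight_pos[OF l] by simp
    have "cmod (of_real (a l * (cmod (pl l z))\<^sup>2) * c l) = (cmod (pl l z))\<^sup>2 * (a l * cmod (c l))"
      unfolding norm_mult norm_of_real using al by simp
    also have "\<dots> \<le> q\<^sup>2 * (a l * cmod (c l))" using pq(2)[of l] al by (intro mult_right_mono power_mono) auto
    finally show "cmod (of_real (a l * (cmod (pl l z))\<^sup>2) * c l) \<le> q\<^sup>2 * (a l * cmod (c l))" .
    have "cmod (of_real (a l) * cnj (pl l z) * (p z * g l z)) = cmod (pl l z) * (a l * (cmod (p z) * cmod (g l z)))"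
      unfolding norm_mult norm_of_real complex_mod_cnj using al by simp
    also have "\<dots> \<le> q * (a l * (cmod (p z) * cmod (g l z)))" using pq(2)[of l] al by (intro mult_right_mono) auto
    finally show "cmod (of_real (a l) * cnj (pl l z) * (p z * g l z)) \<le> q * (a l * (cmod (p z) * cmod (g l z)))" .
  qed
  finally have "(m * cmod (f z))\<^sup>2 \<le> (?x + ?y + ?z)\<^sup>2" using m(1) by (intro power_mono) auto
  also have "\<dots> \<le> 3 * (?x\<^sup>2 + ?y\<^sup>2 + ?z\<^sup>2)" by (rule three_squares_le)
  also have "\<dots> \<le> 3 * (?x\<^sup>2 + (\<Sum>l\<in>Lam. (q\<^sup>2 * (a l * cmod (c l)))\<^sup>2) * card Lam
      + (\<Sum>l\<in>Lam. (q * (a l * (cmod (p z) * cmod (g l z))))\<^sup>2) * card Lam)"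
    by (intro mult_left_mono add_mono sum_squared_le_sum_of_squares order_refl) simp
  also have "\<dots> = 3 * (q\<^sup>2 * ((cmod (p z))\<^sup>2 * (cmod (f z))\<^sup>2)
     + card Lam * q ^ 4 * (\<Sum>l\<in>Lam. (a l)\<^sup>2 * (cmod (c l))\<^sup>2)
     + (\<Sum>l\<in>Lam. card Lam * q\<^sup>2 * (a l)\<^sup>2 * ((cmod (p z))\<^sup>2 * (cmod (g l z))\<^sup>2)))"
    by (simp add: power_mult_distrib sum_distrib_left sum_distrib_right mult_ac power_mult[symmetric])
  finally have "m\<^sup>2 * (cmod (f z))\<^sup>2 \<le> 3 * (q\<^sup>2 * ((cmod (p z))\<^sup>2 * (cmod (f z))\<^sup>2)
     + card Lam * q ^ 4 * (\<Sum>l\<in>Lam. (a l)\<^sup>2 * (cmod (c l))\<^sup>2)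
     + (\<Sum>l\<in>Lam. card Lam * q\<^sup>2 * (a l)\<^sup>2 * ((cmod (p z))\<^sup>2 * (cmod (g l z))\<^sup>2)))" (is "_ \<le> 3 * ?R")
    by (simp only: power_mult_distrib)
  then have "(cmod (f z))\<^sup>2 \<le> 3 / m\<^sup>2 * ?R" using m(1) by (simp add: field_simps)
  then show ?thesis unfolding q_def .
qed

end

section \<open>The bootstrap over truncated discs\<close>

locale kernel_carleson = atomic_dirichlet \<mu> Lam a + disc_measure \<nu>
  for \<mu> Lam a and \<nu> :: "complex measure" +
  fixes C :: real
  assumes C_pos: "0 < C"
    and kernel_bound: "cmod w < 1 \<Longrightarrow> (\<integral>\<^sup>+z. ennreal ((cmod (ker w z))\<^sup>2) \<partial>\<nu>) \<le> ennreal C * dirichlet_norm_sq \<mu> (ker w)"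
begin

text \<open>The embedding on a smaller disc, where some constant is known to exist. The condition
  \<open>0 <= A\<close> is part of it since \<open>ennreal\<close> would hide a negative
  constant.\<close>

definition truncated_carleson :: "real \<Rightarrow> real \<Rightarrow> bool" where
  "truncated_carleson r A \<longleftrightarrow> 0 \<le> A \<and>
    (\<forall>f\<in>D. (\<integral>\<^sup>+z. ennreal ((cmod (f z))\<^sup>2) * indicator (cball 0 r) z \<partial>\<nu>) \<le> ennreal (A * D.sqnorm f))"

text \<open>The kernel test for the measure with density \<open>|p|^2\<close> relative to
  \<open>\<nu>\<close>, restricted to the closed disc of radius \<open>r\<close>.\<close>

definition szego_integral :: "real \<Rightarrow> complex \<Rightarrow> ennreal" where
  "szego_integral r w =
    (\<integral>\<^sup>+z. ennreal ((cmod (p z))\<^sup>2) * indicator (cball 0 r) z * ennreal ((1 - (cmod w)\<^sup>2) / (cmod (1 - z * cnj w))\<^sup>2) \<partial>\<nu>)"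

abbreviation "v \<equiv> measure \<nu> (space \<nu>)"

lemma holomorphic_measurable: "f holomorphic_on unit_disc \<Longrightarrow> f \<in> borel_measurable \<nu>"
  by (intro continuous_measurable holomorphic_on_imp_continuous_on)

lemma cball_measurable:
  assumes "r < 1" shows "cball 0 r \<in> sets \<nu>"
  unfolding sets_\<sigma> using assms by (auto simp: sets_restrict_space_iff)

text \<open>A crude bound from point evaluation. It may blow up as \<open>r\<close> tends to 1, but
  the bootstrap uses only that it is finite.\<close>

lemma truncated_carleson_initial:
  assumes r: "0 \<le> r" "r < 1"
  shows "truncated_carleson r (v / (1 - r\<^sup>2))"
  unfolding truncated_carleson_def
proof (intro conjI ballI)
  have r2: "r\<^sup>2 < 1" using r by (simp add: abs_square_less_1)
  then show "0 \<le> v / (1 - r\<^sup>2)" by simp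
  fix f assume f: "f \<in> D"
  have "(\<integral>\<^sup>+z. ennreal ((cmod (f z))\<^sup>2) * indicator (cball 0 r) z \<partial>\<nu>) \<le> (\<integral>\<^sup>+z. ennreal (D.sqnorm f / (1 - r\<^sup>2)) \<partial>\<nu>)"
  proof (rule nn_integral_mono)
    fix z assume "z \<in> space \<nu>"
    show "ennreal ((cmod (f z))\<^sup>2) * indicator (cball 0 r) z \<le> ennreal (D.sqnorm f / (1 - r\<^sup>2))"
    proof (cases "cmod z \<le> r")
      case True
      have "(cmod (f z))\<^sup>2 \<le> D.sqnorm f / (1 - (cmod z)\<^sup>2)" using True r by (intro D_eval_bound f) auto
      also have "\<dots> \<le> D.sqnorm f / (1 - r\<^sup>2)"
        using power_mono[OF True norm_ge_zero, of 2] r2 D.sqnorm_nonneg[OF f] by (intro frac_le) auto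
      finally show ?thesis using True by (simp add: ennreal_leI)
    qed simp
  qed
  also have "\<dots> = ennreal (v / (1 - r\<^sup>2) * D.sqnorm f)"
    using r2 D.sqnorm_nonneg[OF f] by (simp add: emeasure_eq_measure ennreal_mult[symmetric] mult.commute)
  finally show "(\<integral>\<^sup>+z. ennreal ((cmod (f z))\<^sup>2) * indicator (cball 0 r) z \<partial>\<nu>) \<le> ennreal (v / (1 - r\<^sup>2) * D.sqnorm f)" .
qed

text \<open>Up to the factor \<open>T\<close>, the integrand of \<open>szego_integral\<close> is
  \<open>|test w|^2\<close>, and the test function is kernel minus error. The kernel is controlled
  by \<open>kernel_bound\<close>, with \<open>T\<close> compensating the growth of its norm. The
  error has bounded norm and is estimated by the embedding constant \<open>A\<close> itself, with
  the gain \<open>T <= Wm^2 / M\<close> from the lower bound for \<open>|p w|^2\<close>.\<close>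

lemma szego_test_bound:
  obtains c1 c2 where "0 \<le> c1" "0 \<le> c2"
    "\<And>M r A w. \<lbrakk>0 < M; truncated_carleson r A; r < 1; cmod w < 1; M * (1 - (cmod w)\<^sup>2) \<le> (cmod (p w))\<^sup>2\<rbrakk> \<Longrightarrow>
      szego_integral r w \<le> ennreal (c1 + (c1 + c2 * A) / M)"
proof -
  obtain C0 where C0: "0 \<le> C0" "\<And>w. cmod w < 1 \<Longrightarrow> D.sqnorm (\<lambda>z. ker w z - test w z) \<le> C0"
    using test_approximates_kernel by blast
  obtain C3 where C3: "0 \<le> C3" "\<And>w. cmod w < 1 \<Longrightarrow> D.sqnorm (test w) \<le> C3 * (cmod (p w))\<^sup>2 / (1 - (cmod w)\<^sup>2)"
    using test_sqnorm_bound by blast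
  obtain m where m: "0 < m" "\<And>z. cmod z \<le> 1 \<Longrightarrow> m \<le> W z" using W_lower_bound by blast
  define Wm where "Wm = (2 ^ card Lam)\<^sup>2 + (\<Sum>l\<in>Lam. a l * (2 ^ card Lam)\<^sup>2)"
  have W_le: "W w \<le> Wm" if "cmod w < 1" for w
    unfolding W_def Wm_def using p_le[of w] pl_le[of w] that weight_pos
    by (intro add_mono sum_mono mult_left_mono power_mono) (auto intro: less_imp_le)
  \<comment> \<open>Independent of \<open>M\<close>, \<open>r\<close>, \<open>A\<close> and
    \<open>w\<close>, as the choice of \<open>M\<close> in the bootstrap requires.\<close>
  define c1 where "c1 = Wm\<^sup>2 * (4 * C * (C3 + C0))"
  define c2 where "c2 = Wm\<^sup>2 * (2 * C0)"
  have c: "0 \<le> c1" "0 \<le> c2" unfolding c1_def c2_def using C_pos C3(1) C0(1) by auto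
  have "szego_integral r w \<le> ennreal (c1 + (c1 + c2 * A) / M)"
    if M: "0 < M" and A: "truncated_carleson r A" and r: "r < 1" and w: "cmod w < 1" and big: "M * (1 - (cmod w)\<^sup>2) \<le> (cmod (p w))\<^sup>2"
    for M r A w
  proof -
    let ?d = "1 - (cmod w)\<^sup>2" and ?P = "(cmod (p w))\<^sup>2" and ?e = "\<lambda>z. ker w z - test w z"
    have A0: "0 \<le> A" using A by (simp add: truncated_carleson_def)
    have d: "0 < ?d" using sq_less_1[OF w] by simp
    have P: "0 < ?P" using p_nonzero[OF w] by simp
    have Wp: "0 < W w" using m(1) m(2)[of w] w by simp
    define T where "T = ?d * (W w)\<^sup>2 / ?P"
    have T0: "0 \<le> T" unfolding T_def using d P by simp
    have tD: "test w \<in> D" by (rule represents_imp(3)[OF represents_test[OF w]])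
    have kD: "ker w \<in> D" by (rule ker(1)[OF w])
    have eD: "?e \<in> D" by (rule D.mem_diff[OF kD tD])
    have km: "ker w \<in> borel_measurable \<nu>" and em: "?e \<in> borel_measurable \<nu>"
      by (intro holomorphic_measurable D_imp(1) kD eD)+
    have ind: "(\<lambda>z. indicator (cball 0 r) z :: ennreal) \<in> borel_measurable \<nu>"
      by (intro borel_measurable_indicator cball_measurable r)
    have kn: "D.sqnorm (ker w) \<le> 2 * (C3 * ?P / ?d) + 2 * C0"
    proof -
      have "D.sqnorm (\<lambda>z. test w z + ?e z) \<le> 2 * D.sqnorm (test w) + 2 * D.sqnorm ?e"
        by (rule D.sqnorm_add_le[OF tD eD])
      then show ?thesis using C3(2)[OF w] C0(2)[OF w] by simp
    qed
    have "szego_integral r w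
       \<le> (\<integral>\<^sup>+z. ennreal (2 * T) * ennreal ((cmod (ker w z))\<^sup>2) + ennreal (2 * T) * (ennreal ((cmod (?e z))\<^sup>2) * indicator (cball 0 r) z) \<partial>\<nu>)"
      unfolding szego_integral_def
    proof (rule nn_integral_mono)
      fix z assume "z \<in> space \<nu>"
      have "(cmod (p z))\<^sup>2 * (?d / (cmod (1 - z * cnj w))\<^sup>2) = T * (cmod (test w z))\<^sup>2"
      proof -
        have "(cmod (test w z))\<^sup>2 = (?P / (W w)\<^sup>2) * ((cmod (p z))\<^sup>2 * (1 / (cmod (1 - z * cnj w))\<^sup>2))"
          unfolding test_def testc_def szego_def norm_mult norm_divide norm_of_real complex_mod_cnj
          using Wp by (simp add: power_mult_distrib power_divide mult.commute)
        then show ?thesis unfolding T_def using P Wp by (simp add: mult_ac)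
      qed
      also have "\<dots> \<le> T * (2 * (cmod (ker w z))\<^sup>2 + 2 * (cmod (?e z))\<^sup>2)"
        using cmod_diff_squared_le[of "ker w z" "?e z"] T0 by (intro mult_left_mono) auto
      finally have le: "(cmod (p z))\<^sup>2 * (?d / (cmod (1 - z * cnj w))\<^sup>2) \<le> 2 * T * (cmod (ker w z))\<^sup>2 + 2 * T * (cmod (?e z))\<^sup>2"
        by (simp add: algebra_simps)
      show "ennreal ((cmod (p z))\<^sup>2) * indicator (cball 0 r) z * ennreal (?d / (cmod (1 - z * cnj w))\<^sup>2)
         \<le> ennreal (2 * T) * ennreal ((cmod (ker w z))\<^sup>2) + ennreal (2 * T) * (ennreal ((cmod (?e z))\<^sup>2) * indicator (cball 0 r) z)"
      proof (cases "cmod z \<le> r")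
        case True
        have "ennreal ((cmod (p z))\<^sup>2) * ennreal (?d / (cmod (1 - z * cnj w))\<^sup>2) = ennreal ((cmod (p z))\<^sup>2 * (?d / (cmod (1 - z * cnj w))\<^sup>2))"
          using d by (intro ennreal_mult[symmetric]) auto
        also have "\<dots> \<le> ennreal (2 * T * (cmod (ker w z))\<^sup>2 + 2 * T * (cmod (?e z))\<^sup>2)"
          by (rule ennreal_leI[OF le])
        also have "\<dots> = ennreal (2 * T) * ennreal ((cmod (ker w z))\<^sup>2) + ennreal (2 * T) * ennreal ((cmod (?e z))\<^sup>2)"
          using T0 by (simp only: ennreal_plus ennreal_mult mult_nonneg_nonneg zero_le_numeral zero_le_power2)
        finally show ?thesis using True by simp
      qed simp
    qed
    also have "\<dots> = ennreal (2 * T) * (\<integral>\<^sup>+z. ennreal ((cmod (ker w z))\<^sup>2) \<partial>\<nu>)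
        + ennreal (2 * T) * (\<integral>\<^sup>+z. ennreal ((cmod (?e z))\<^sup>2) * indicator (cball 0 r) z \<partial>\<nu>)"
      using km em ind by (simp add: nn_integral_add nn_integral_cmult)
    also have "\<dots> \<le> ennreal (2 * T) * ennreal (C * (2 * (C3 * ?P / ?d) + 2 * C0)) + ennreal (2 * T) * ennreal (A * C0)"
    proof (intro add_mono mult_left_mono)
      have "(\<integral>\<^sup>+z. ennreal ((cmod (ker w z))\<^sup>2) \<partial>\<nu>) \<le> ennreal (C * D.sqnorm (ker w))"
        using kernel_bound[OF w] C_pos D.sqnorm_nonneg[OF kD] by (simp add: dirichlet_norm_sq_eq[OF kD] ennreal_mult)
      also have "\<dots> \<le> ennreal (C * (2 * (C3 * ?P / ?d) + 2 * C0))"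
        using kn C_pos by (intro ennreal_leI mult_left_mono) auto
      finally show "(\<integral>\<^sup>+z. ennreal ((cmod (ker w z))\<^sup>2) \<partial>\<nu>) \<le> ennreal (C * (2 * (C3 * ?P / ?d) + 2 * C0))" .
      have "(\<integral>\<^sup>+z. ennreal ((cmod (?e z))\<^sup>2) * indicator (cball 0 r) z \<partial>\<nu>) \<le> ennreal (A * D.sqnorm ?e)"
        using A eD by (simp add: truncated_carleson_def)
      also have "\<dots> \<le> ennreal (A * C0)" using C0(2)[OF w] A0 by (intro ennreal_leI mult_left_mono) auto
      finally show "(\<integral>\<^sup>+z. ennreal ((cmod (?e z))\<^sup>2) * indicator (cball 0 r) z \<partial>\<nu>) \<le> ennreal (A * C0)" .
    qed auto
    also have "\<dots> = ennreal (2 * T * (C * (2 * (C3 * ?P / ?d) + 2 * C0)) + 2 * T * (A * C0))"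
      using T0 C_pos C3(1) C0(1) A0 d P
      by (subst ennreal_plus) (auto simp: ennreal_mult[symmetric] intro!: mult_nonneg_nonneg add_nonneg_nonneg divide_nonneg_nonneg)
    also have "\<dots> \<le> ennreal (c1 + (c1 + c2 * A) / M)"
    proof (rule ennreal_leI)
      have W2: "(W w)\<^sup>2 \<le> Wm\<^sup>2" using W_le[OF w] Wp by (intro power_mono) auto
      have TM: "T \<le> Wm\<^sup>2 / M"
      proof -
        have "?d / ?P \<le> 1 / M" using big M P by (simp add: field_simps)
        then have "(W w)\<^sup>2 * (?d / ?P) \<le> Wm\<^sup>2 * (1 / M)" using W2 d P by (intro mult_mono) auto
        then show ?thesis unfolding T_def by (simp add: mult.commute)
      qed
      have TP: "T * (?P / ?d) \<le> Wm\<^sup>2" unfolding T_def using W2 d P by simp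
      have "2 * T * (C * (2 * (C3 * ?P / ?d) + 2 * C0)) + 2 * T * (A * C0)
          = 4 * C * C3 * (T * (?P / ?d)) + (4 * C * C0 + 2 * C0 * A) * T"
        by (simp add: algebra_simps)
      also have "\<dots> \<le> 4 * C * C3 * Wm\<^sup>2 + (4 * C * C0 + 2 * C0 * A) * (Wm\<^sup>2 / M)"
        using TP TM C_pos C3(1) C0(1) A0 by (intro add_mono mult_left_mono) auto
      also have "\<dots> \<le> c1 + (c1 + c2 * A) / M"
      proof (rule add_mono)
        show "4 * C * C3 * Wm\<^sup>2 \<le> c1"
          unfolding c1_def using C_pos C0(1) by (simp add: algebra_simps)
        have "(4 * C * C0 + 2 * C0 * A) * Wm\<^sup>2 \<le> c1 + c2 * A"
          unfolding c1_def c2_def using C_pos C3(1) by (simp add: algebra_simps)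
        then show "(4 * C * C0 + 2 * C0 * A) * (Wm\<^sup>2 / M) \<le> (c1 + c2 * A) / M"
          using M by (simp add: divide_right_mono)
      qed
      finally show "2 * T * (C * (2 * (C3 * ?P / ?d) + 2 * C0)) + 2 * T * (A * C0) \<le> c1 + (c1 + c2 * A) / M" .
    qed
    finally show ?thesis .
  qed
  then show ?thesis using that[OF c] by blast
qed

text \<open>The two constants follow the splitting of \<open>p z\<close> into \<open>p w\<close> and
  \<open>p z - p w\<close>: the first part gives \<open>8 M\<close>, by
  \<open>1 - |w|^2 <= 2 |1 - z cnj w|\<close>; the second gives \<open>2 L^2\<close>, since the
  Lipschitz bound cancels the denominator.\<close>

lemma szego_test_trivial:
  obtains L where "0 \<le> L"
    "\<And>M r w. \<lbrakk>0 < M; cmod w < 1; (cmod (p w))\<^sup>2 < M * (1 - (cmod w)\<^sup>2)\<rbrakk> \<Longrightarrow>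
      szego_integral r w \<le> ennreal ((8 * M + 2 * L\<^sup>2) * v)"
proof -
  obtain L where L: "0 \<le> L" "\<And>z w. cmod z \<le> 1 \<Longrightarrow> cmod w \<le> 1 \<Longrightarrow> cmod (p z - p w) \<le> L * cmod (z - w)"
    unfolding p_def using root_prod_lipschitz[OF finite_Lam Lam_circle] by blast
  have "szego_integral r w \<le> ennreal ((8 * M + 2 * L\<^sup>2) * v)"
    if M: "0 < M" and w: "cmod w < 1" and small: "(cmod (p w))\<^sup>2 < M * (1 - (cmod w)\<^sup>2)" for M r w
  proof -
    let ?d = "1 - (cmod w)\<^sup>2"
    have d: "0 < ?d" "?d \<le> 1" using sq_less_1[OF w] by auto
    have "szego_integral r w
        \<le> (\<integral>\<^sup>+z. ennreal (8 * M + 2 * L\<^sup>2) \<partial>\<nu>)"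
      unfolding szego_integral_def
    proof (rule nn_integral_mono)
      fix z assume "z \<in> space \<nu>"
      then have z: "cmod z < 1" by (simp add: space_\<sigma>)
      let ?b = "cmod (1 - z * cnj w)"
      have b: "0 < ?b" "1 - cmod w \<le> ?b" using one_minus_product_ge[OF z w] by auto
      have "cmod (p z - p w) \<le> L * cmod (z - w)" using z w by (intro L(2)) auto
      also have "\<dots> \<le> L * ?b" using L(1) cmod_diff_le_one_minus_product[OF z w] by (intro mult_left_mono)
      finally have "(cmod (p z - p w))\<^sup>2 \<le> (L * ?b)\<^sup>2" by (intro power_mono) auto
      moreover have "(cmod (p z))\<^sup>2 \<le> 2 * (cmod (p w))\<^sup>2 + 2 * (cmod (p z - p w))\<^sup>2"
        using cmod_add_squared_le[of "p w" "p z - p w"] by simp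
      ultimately have pz: "(cmod (p z))\<^sup>2 \<le> 2 * (M * ?d) + 2 * (L\<^sup>2 * ?b\<^sup>2)"
        using small by (simp add: power_mult_distrib)
      have "?d = (1 + cmod w) * (1 - cmod w)" by (simp add: power2_eq_square algebra_simps)
      also have "\<dots> \<le> 2 * ?b" using w b(2) by (intro mult_mono) auto
      finally have "?d\<^sup>2 \<le> (2 * ?b)\<^sup>2" using d by (intro power_mono) auto
      then have db: "?d\<^sup>2 / ?b\<^sup>2 \<le> 4" using b by (simp add: field_simps)
      have "(cmod (p z))\<^sup>2 * (?d / ?b\<^sup>2) \<le> (2 * (M * ?d) + 2 * (L\<^sup>2 * ?b\<^sup>2)) * (?d / ?b\<^sup>2)"
        using pz d by (intro mult_right_mono) auto
      also have "\<dots> = 2 * M * (?d\<^sup>2 / ?b\<^sup>2) + 2 * L\<^sup>2 * ?d"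
        unfolding distrib_right using b by (simp add: power2_eq_square)
      also have "\<dots> \<le> 2 * M * 4 + 2 * L\<^sup>2 * 1"
        using db d M by (intro add_mono mult_left_mono) auto
      finally have le: "(cmod (p z))\<^sup>2 * (?d / ?b\<^sup>2) \<le> 8 * M + 2 * L\<^sup>2" by simp
      show "ennreal ((cmod (p z))\<^sup>2) * indicator (cball 0 r) z * ennreal (?d / ?b\<^sup>2) \<le> ennreal (8 * M + 2 * L\<^sup>2)"
      proof (cases "cmod z \<le> r")
        case True
        have "ennreal ((cmod (p z))\<^sup>2) * ennreal (?d / ?b\<^sup>2) = ennreal ((cmod (p z))\<^sup>2 * (?d / ?b\<^sup>2))"
          using d by (intro ennreal_mult[symmetric]) auto
        also have "\<dots> \<le> ennreal (8 * M + 2 * L\<^sup>2)" by (rule ennreal_leI[OF le])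
        finally show ?thesis using True by simp
      qed simp
    qed
    also have "\<dots> = ennreal ((8 * M + 2 * L\<^sup>2) * v)"
      using M by (simp add: emeasure_eq_measure ennreal_mult del: ennreal_plus)
    finally show ?thesis .
  qed
  then show ?thesis using that[OF L(1)] by blast
qed

text \<open>The test theorem is applied to the truncated measure with density \<open>|p|^2\<close>.
  The indicator is idempotent, so the cutoff can be attached to the density and to \<open>g\<close>
  at the same time.\<close>

lemma weighted_embedding:
  assumes r: "0 \<le> r" "r < 1" and K: "0 < K"
    and test: "\<forall>w. cmod w < 1 \<longrightarrow> szego_integral r w \<le> ennreal K"
    and g: "g \<in> H2"
  shows "(\<integral>\<^sup>+z. ennreal ((cmod (p z))\<^sup>2 * (cmod (g z))\<^sup>2) * indicator (cball 0 r) z \<partial>\<nu>) \<le> ennreal (32 * K * H2.sqnorm g)"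
proof -
  define h where "h z = ennreal ((cmod (p z))\<^sup>2) * indicator (cball 0 r) z" for z
  have pm: "p \<in> borel_measurable \<nu>"
    unfolding p_def root_prod_def by (intro continuous_measurable continuous_intros)
  have gm[measurable]: "g \<in> borel_measurable \<nu>" using g by (intro holomorphic_measurable) (simp add: H2_def)
  have ind[measurable]: "(\<lambda>z. indicator (cball 0 r) z :: ennreal) \<in> borel_measurable \<nu>"
    by (intro borel_measurable_indicator cball_measurable r)
  have hm[measurable]: "h \<in> borel_measurable \<nu>" unfolding h_def using pm by measurable
  interpret S: kernel_test "density \<nu> h" K
  proof (intro kernel_test.intro disc_measure.intro finite_measureI disc_measure_axioms.intro kernel_test_axioms.intro)
    have "emeasure (density \<nu> h) (space (density \<nu> h)) = (\<integral>\<^sup>+z. h z \<partial>\<nu>)"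
      by (simp add: emeasure_density cong: nn_integral_cong)
    also have "\<dots> \<le> (\<integral>\<^sup>+z. ennreal ((2 ^ card Lam)\<^sup>2) \<partial>\<nu>)"
    proof (rule nn_integral_mono)
      fix z assume "z \<in> space \<nu>"
      then have "cmod (p z) \<le> 2 ^ card Lam" by (intro p_le) (simp add: space_\<sigma>)
      then have "(cmod (p z))\<^sup>2 \<le> (2 ^ card Lam)\<^sup>2" by (intro power_mono) auto
      from ennreal_leI[OF this] show "h z \<le> ennreal ((2 ^ card Lam)\<^sup>2)"
        unfolding h_def by (cases "cmod z \<le> r") simp_all
    qed
    also have "\<dots> < \<infinity>" by (simp add: emeasure_eq_measure ennreal_mult_less_top)
    finally show "emeasure (density \<nu> h) (space (density \<nu> h)) \<noteq> \<infinity>" by simp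
    show "sets (density \<nu> h) = sets disc_borel" by (simp add: sets_\<sigma>)
    show "0 < K" by (rule K)
    fix w :: complex assume w: "cmod w < 1"
    have "(\<lambda>z. ennreal ((1 - (cmod w)\<^sup>2) / (cmod (1 - z * cnj w))\<^sup>2)) \<in> borel_measurable \<nu>" by measurable
    then show "(\<integral>\<^sup>+z. ennreal ((1 - (cmod w)\<^sup>2) / (cmod (1 - z * cnj w))\<^sup>2) \<partial>density \<nu> h) \<le> ennreal K"
      using test w by (simp add: nn_integral_density h_def szego_integral_def)
  qed
  have "(\<integral>\<^sup>+z. ennreal ((cmod (p z))\<^sup>2 * (cmod (g z))\<^sup>2) * indicator (cball 0 r) z \<partial>\<nu>)
     = (\<integral>\<^sup>+z. h z * (ennreal ((cmod (g z))\<^sup>2) * indicator (cball 0 r) z) \<partial>\<nu>)"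
    by (intro nn_integral_cong) (auto simp: h_def indicator_def ennreal_mult)
  also have "\<dots> = (\<integral>\<^sup>+z. ennreal ((cmod (g z))\<^sup>2) * indicator (cball 0 r) z \<partial>density \<nu> h)"
    by (subst nn_integral_density) auto
  also have "\<dots> \<le> ennreal (32 * K * H2.sqnorm g)" by (rule S.embedding[OF g r])
  finally show ?thesis .
qed

text \<open>Integrates \<open>pointwise_decomposition\<close>. The terms with the factor
  \<open>|p|^2\<close> fall under the weighted embedding, because \<open>f\<close> and all
  \<open>g l\<close> lie in the Hardy space; the constants \<open>c l\<close> only cost the mass of
  \<open>\<nu>\<close>. The bootstrap relies on the linearity in \<open>K\<close>.\<close>

lemma carleson_from_embedding:
  obtains c1 c2 where "0 \<le> c1" "0 \<le> c2"
    "\<And>r K. \<lbrakk>0 \<le> r; r < 1; 0 < K; \<forall>w. cmod w < 1 \<longrightarrow> szego_integral r w \<le> ennreal K\<rbrakk>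
      \<Longrightarrow> truncated_carleson r (c1 + c2 * K)"
proof -
  obtain m where m: "0 < m" "\<And>z. cmod z \<le> 1 \<Longrightarrow> m \<le> W z" using W_lower_bound by blast
  define q where "q = (2 ^ card Lam :: real)"
  define n where "n = real (card Lam)"
  \<comment> \<open>Here \<open>3 / m^2\<close> stems from \<open>pointwise_decomposition\<close>,
    \<open>2 (1 + 1 / a l)\<close> from \<open>component_bounds\<close>, and the 32 in
    \<open>c2\<close> from \<open>weighted_embedding\<close>.\<close>
  define c1 where "c1 = 3 / m\<^sup>2 * (n * q ^ 4 * v * (\<Sum>l\<in>Lam. (a l)\<^sup>2 * (2 * (1 + 1 / a l))))"
  define c2 where "c2 = 3 / m\<^sup>2 * (q\<^sup>2 * 32 + n * q\<^sup>2 * 32 * (\<Sum>l\<in>Lam. a l))"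
  have q: "0 < q" and n: "0 \<le> n" by (simp_all add: q_def n_def)
  have al: "0 \<le> a l" if "l \<in> Lam" for l using weight_pos[OF that] by simp
  have c: "0 \<le> c1" "0 \<le> c2"
    unfolding c1_def c2_def using q n al
    by (auto intro!: mult_nonneg_nonneg add_nonneg_nonneg sum_nonneg divide_nonneg_nonneg)
  have "truncated_carleson r (c1 + c2 * K)"
    if r: "0 \<le> r" "r < 1" and K: "0 < K" and test: "\<forall>w. cmod w < 1 \<longrightarrow> szego_integral r w \<le> ennreal K"
    for r K
    unfolding truncated_carleson_def
  proof (intro conjI ballI)
    show "0 \<le> c1 + c2 * K" using c K by simp
    fix f assume f: "f \<in> D"
    obtain c g where rep: "represents f c g" using representation_exists[OF f] by blast
    let ?N = "D.sqnorm f"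
    have N0: "0 \<le> ?N" by (rule D.sqnorm_nonneg[OF f])
    note gH = representsD(1)[OF rep] and fH = D_imp(2)[OF f]
    obtain l0 where l0: "l0 \<in> Lam" using Lam_nonempty by blast
    define s where "s = (\<Sum>l\<in>Lam. (a l)\<^sup>2 * (cmod (c l))\<^sup>2)"
    have s0: "0 \<le> s" unfolding s_def by (intro sum_nonneg) auto
    let ?E = "\<lambda>h z. ennreal ((cmod (p z))\<^sup>2 * (cmod (h z))\<^sup>2) * indicator (cball 0 r) z"
    let ?k = "3 / m\<^sup>2"
    have pm[measurable]: "p \<in> borel_measurable \<nu>"
      unfolding p_def root_prod_def by (intro continuous_measurable continuous_intros)
    have ind[measurable]: "(\<lambda>z. indicator (cball 0 r) z :: ennreal) \<in> borel_measurable \<nu>"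
      by (intro borel_measurable_indicator cball_measurable r)
    have Em: "?E h \<in> borel_measurable \<nu>" if "h \<in> H2" for h
    proof -
      have [measurable]: "h \<in> borel_measurable \<nu>" using that by (intro holomorphic_measurable) (simp add: H2_def)
      show ?thesis by measurable
    qed
    have Eb: "(\<integral>\<^sup>+z. ?E h z \<partial>\<nu>) \<le> ennreal (32 * K * H2.sqnorm h)" if "h \<in> H2" for h
      by (rule weighted_embedding[OF r K test that])
    have "(\<integral>\<^sup>+z. ennreal ((cmod (f z))\<^sup>2) * indicator (cball 0 r) z \<partial>\<nu>) \<le>
      (\<integral>\<^sup>+z. ennreal (?k * q\<^sup>2) * ?E f z + ennreal (?k * (n * q ^ 4 * s))
        + (\<Sum>l\<in>Lam. ennreal (?k * (n * q\<^sup>2 * (a l)\<^sup>2)) * ?E (g l) z) \<partial>\<nu>)"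
    proof (rule nn_integral_mono)
      fix z assume "z \<in> space \<nu>"
      then have z: "cmod z < 1" by (simp add: space_\<sigma>)
      show "ennreal ((cmod (f z))\<^sup>2) * indicator (cball 0 r) z \<le> ennreal (?k * q\<^sup>2) * ?E f z + ennreal (?k * (n * q ^ 4 * s))
        + (\<Sum>l\<in>Lam. ennreal (?k * (n * q\<^sup>2 * (a l)\<^sup>2)) * ?E (g l) z)"
      proof (cases "cmod z \<le> r")
        case True
        have "(cmod (f z))\<^sup>2 \<le> ?k * (q\<^sup>2 * ((cmod (p z))\<^sup>2 * (cmod (f z))\<^sup>2) + n * q ^ 4 * s
            + (\<Sum>l\<in>Lam. n * q\<^sup>2 * (a l)\<^sup>2 * ((cmod (p z))\<^sup>2 * (cmod (g l z))\<^sup>2)))"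
          unfolding q_def n_def s_def by (rule pointwise_decomposition[OF m rep z])
        also have "\<dots> = ?k * q\<^sup>2 * ((cmod (p z))\<^sup>2 * (cmod (f z))\<^sup>2) + ?k * (n * q ^ 4 * s)
            + (\<Sum>l\<in>Lam. ?k * (n * q\<^sup>2 * (a l)\<^sup>2) * ((cmod (p z))\<^sup>2 * (cmod (g l z))\<^sup>2))"
          by (simp only: distrib_left sum_distrib_left mult.assoc)
        finally have "ennreal ((cmod (f z))\<^sup>2) \<le> ennreal \<dots>" by (rule ennreal_leI)
        also have "\<dots> = ennreal (?k * q\<^sup>2 * ((cmod (p z))\<^sup>2 * (cmod (f z))\<^sup>2)) + ennreal (?k * (n * q ^ 4 * s))
            + (\<Sum>l\<in>Lam. ennreal (?k * (n * q\<^sup>2 * (a l)\<^sup>2) * ((cmod (p z))\<^sup>2 * (cmod (g l z))\<^sup>2)))"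
          using q n s0 by (subst ennreal_plus ennreal_plus sum_ennreal
              | force intro!: add_nonneg_nonneg mult_nonneg_nonneg sum_nonneg divide_nonneg_nonneg)+
        also have "\<dots> = ennreal (?k * q\<^sup>2) * ?E f z + ennreal (?k * (n * q ^ 4 * s))
            + (\<Sum>l\<in>Lam. ennreal (?k * (n * q\<^sup>2 * (a l)\<^sup>2)) * ?E (g l) z)"
        proof -
          have e1: "ennreal (?k * q\<^sup>2 * ((cmod (p z))\<^sup>2 * (cmod (f z))\<^sup>2)) = ennreal (?k * q\<^sup>2) * ennreal ((cmod (p z))\<^sup>2 * (cmod (f z))\<^sup>2)"
            by (rule ennreal_mult) simp_all
          have e2: "ennreal (?k * (n * q\<^sup>2 * (a l)\<^sup>2) * ((cmod (p z))\<^sup>2 * (cmod (g l z))\<^sup>2))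
              = ennreal (?k * (n * q\<^sup>2 * (a l)\<^sup>2)) * ennreal ((cmod (p z))\<^sup>2 * (cmod (g l z))\<^sup>2)" for l
            using n by (intro ennreal_mult) simp_all
          show ?thesis unfolding e1 e2 using True by simp
        qed
        finally show ?thesis using True by simp
      qed simp
    qed
    also have "\<dots> = ennreal (?k * q\<^sup>2) * (\<integral>\<^sup>+z. ?E f z \<partial>\<nu>) + ennreal (?k * (n * q ^ 4 * s)) * ennreal v
        + (\<Sum>l\<in>Lam. ennreal (?k * (n * q\<^sup>2 * (a l)\<^sup>2)) * (\<integral>\<^sup>+z. ?E (g l) z \<partial>\<nu>))"
    proof -
      have "(\<lambda>z. \<Sum>l\<in>Lam. ennreal (?k * (n * q\<^sup>2 * (a l)\<^sup>2)) * ?E (g l) z) \<in> borel_measurable \<nu>"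
        by (intro borel_measurable_sum borel_measurable_times_ennreal borel_measurable_const Em gH)
      moreover have "(\<lambda>z. ennreal (?k * q\<^sup>2) * ?E f z) \<in> borel_measurable \<nu>"
        by (intro borel_measurable_times_ennreal borel_measurable_const Em fH)
      moreover have "(\<integral>\<^sup>+z. (\<Sum>l\<in>Lam. ennreal (?k * (n * q\<^sup>2 * (a l)\<^sup>2)) * ?E (g l) z) \<partial>\<nu>)
         = (\<Sum>l\<in>Lam. (\<integral>\<^sup>+z. ennreal (?k * (n * q\<^sup>2 * (a l)\<^sup>2)) * ?E (g l) z \<partial>\<nu>))"
        by (intro nn_integral_sum borel_measurable_times_ennreal borel_measurable_const Em gH)
      moreover have "(\<integral>\<^sup>+z. ennreal (?k * (n * q\<^sup>2 * (a l)\<^sup>2)) * ?E (g l) z \<partial>\<nu>) = ennreal (?k * (n * q\<^sup>2 * (a l)\<^sup>2)) * (\<integral>\<^sup>+z. ?E (g l) z \<partial>\<nu>)"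
        if "l \<in> Lam" for l
        by (rule nn_integral_cmult[OF Em[OF gH[OF that]]])
      moreover have "(\<integral>\<^sup>+z. ennreal (?k * q\<^sup>2) * ?E f z \<partial>\<nu>) = ennreal (?k * q\<^sup>2) * (\<integral>\<^sup>+z. ?E f z \<partial>\<nu>)"
        by (rule nn_integral_cmult[OF Em[OF fH]])
      ultimately show ?thesis
        by (simp only: nn_integral_add borel_measurable_add borel_measurable_const nn_integral_const emeasure_eq_measure cong: sum.cong)
    qed
    also have "\<dots> \<le> ennreal (?k * q\<^sup>2) * ennreal (32 * K * ?N) + ennreal (?k * (n * q ^ 4 * s)) * ennreal v
        + (\<Sum>l\<in>Lam. ennreal (?k * (n * q\<^sup>2 * (a l)\<^sup>2)) * ennreal (32 * K * H2.sqnorm (g l)))"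
    proof (intro add_mono mult_left_mono sum_mono order_refl Eb gH order_trans[OF Eb[OF fH]] ennreal_leI)
      show "H2.sqnorm f \<le> ?N" by (rule component_bounds(1)[OF rep l0])
    qed (use K in auto)
    also have "\<dots> = ennreal (?k * q\<^sup>2 * (32 * K * ?N) + ?k * (n * q ^ 4 * s) * v
        + (\<Sum>l\<in>Lam. ?k * (n * q\<^sup>2 * (a l)\<^sup>2) * (32 * K * H2.sqnorm (g l))))"
    proof -
      have e1: "ennreal (?k * q\<^sup>2 * (32 * K * ?N)) = ennreal (?k * q\<^sup>2) * ennreal (32 * K * ?N)"
        using K N0 by (intro ennreal_mult) auto
      have e2: "ennreal (?k * (n * q ^ 4 * s) * v) = ennreal (?k * (n * q ^ 4 * s)) * ennreal v"
        using n q s0 by (intro ennreal_mult) auto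
      have e3: "ennreal (?k * (n * q\<^sup>2 * (a l)\<^sup>2) * (32 * K * H2.sqnorm (g l))) = ennreal (?k * (n * q\<^sup>2 * (a l)\<^sup>2)) * ennreal (32 * K * H2.sqnorm (g l))"
        if "l \<in> Lam" for l
        using n K H2.sqnorm_nonneg[OF gH[OF that]] by (intro ennreal_mult) auto
      have n1: "0 \<le> ?k * q\<^sup>2 * (32 * K * ?N)" "0 \<le> ?k * (n * q ^ 4 * s) * v" using K N0 n q s0 by auto
      have n3: "0 \<le> ?k * (n * q\<^sup>2 * (a l)\<^sup>2) * (32 * K * H2.sqnorm (g l))" if "l \<in> Lam" for l
        using n K H2.sqnorm_nonneg[OF gH[OF that]] by auto
      have "(\<Sum>l\<in>Lam. ennreal (?k * (n * q\<^sup>2 * (a l)\<^sup>2)) * ennreal (32 * K * H2.sqnorm (g l)))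
          = ennreal (\<Sum>l\<in>Lam. ?k * (n * q\<^sup>2 * (a l)\<^sup>2) * (32 * K * H2.sqnorm (g l)))"
        using n3 by (subst sum_ennreal[symmetric]) (simp_all only: e3 cong: sum.cong)
      then show ?thesis
        unfolding e1[symmetric] e2[symmetric] using n1 n3
        by (simp only: ennreal_plus add_nonneg_nonneg sum_nonneg)
    qed
    also have "\<dots> \<le> ennreal ((c1 + c2 * K) * ?N)"
    proof (rule ennreal_leI)
      have b1: "s \<le> (\<Sum>l\<in>Lam. (a l)\<^sup>2 * (2 * (1 + 1 / a l))) * ?N"
        unfolding s_def sum_distrib_right mult.assoc[of "(_)\<^sup>2"]
        by (intro sum_mono mult_left_mono component_bounds(3)[OF rep]) auto
      have b2: "(\<Sum>l\<in>Lam. (a l)\<^sup>2 * H2.sqnorm (g l)) \<le> (\<Sum>l\<in>Lam. a l) * ?N"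
        unfolding sum_distrib_right power2_eq_square mult.assoc
        by (intro sum_mono mult_left_mono component_bounds(2)[OF rep] al)
      have "?k * q\<^sup>2 * (32 * K * ?N) + ?k * (n * q ^ 4 * s) * v
        + (\<Sum>l\<in>Lam. ?k * (n * q\<^sup>2 * (a l)\<^sup>2) * (32 * K * H2.sqnorm (g l)))
        = ?k * q\<^sup>2 * (32 * K * ?N) + ?k * (n * q ^ 4) * v * s + ?k * (n * q\<^sup>2) * (32 * K) * (\<Sum>l\<in>Lam. (a l)\<^sup>2 * H2.sqnorm (g l))"
        by (simp add: sum_distrib_left sum_divide_distrib mult_ac)
      also have "\<dots> \<le> ?k * q\<^sup>2 * (32 * K * ?N) + ?k * (n * q ^ 4) * v * ((\<Sum>l\<in>Lam. (a l)\<^sup>2 * (2 * (1 + 1 / a l))) * ?N)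
          + ?k * (n * q\<^sup>2) * (32 * K) * ((\<Sum>l\<in>Lam. a l) * ?N)"
        using n q K by (intro add_mono mult_left_mono b1 b2 order_refl) auto
      also have "\<dots> = (c1 + c2 * K) * ?N"
      proof -
        have "k * x * (32 * K * N) + k * y * v * (S * N) + k * (n * x) * (32 * K) * (T * N) =
           (k * (y * v * S) + k * (x * 32 + n * x * 32 * T) * K) * N" for k x y S T N :: real
          by (simp add: algebra_simps)
        then show ?thesis unfolding c1_def c2_def .
      qed
      finally show "?k * q\<^sup>2 * (32 * K * ?N) + ?k * (n * q ^ 4 * s) * v
        + (\<Sum>l\<in>Lam. ?k * (n * q\<^sup>2 * (a l)\<^sup>2) * (32 * K * H2.sqnorm (g l))) \<le> (c1 + c2 * K) * ?N" .
    qed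
    finally show "(\<integral>\<^sup>+z. ennreal ((cmod (f z))\<^sup>2) * indicator (cball 0 r) z \<partial>\<nu>) \<le> ennreal ((c1 + c2 * K) * ?N)" .
  qed
  then show ?thesis using that[OF c] by blast
qed

text \<open>The error of the approximation of the kernel contributes \<open>A / M\<close>; choosing the threshold \<open>M\<close> large
  halves the constant, while \<open>c\<close> does not depend on \<open>r\<close>.\<close>

lemma bootstrap_step:
  obtains c where "0 \<le> c" "\<And>r A. \<lbrakk>0 \<le> r; r < 1; truncated_carleson r A\<rbrakk> \<Longrightarrow> truncated_carleson r (c + A / 2)"
proof -
  obtain b1 b2 where b: "0 \<le> b1" "0 \<le> b2"
    "\<And>M r A w. \<lbrakk>0 < M; truncated_carleson r A; r < 1; cmod w < 1; M * (1 - (cmod w)\<^sup>2) \<le> (cmod (p w))\<^sup>2\<rbrakk> \<Longrightarrow>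
      szego_integral r w \<le> ennreal (b1 + (b1 + b2 * A) / M)"
    by (rule szego_test_bound) (rule that; assumption)
  obtain L where L: "0 \<le> L" "\<And>M r w. \<lbrakk>0 < M; cmod w < 1; (cmod (p w))\<^sup>2 < M * (1 - (cmod w)\<^sup>2)\<rbrakk> \<Longrightarrow>
      szego_integral r w \<le> ennreal ((8 * M + 2 * L\<^sup>2) * v)"
    by (rule szego_test_trivial) (rule that; assumption)
  obtain c1 c2 where c: "0 \<le> c1" "0 \<le> c2"
    "\<And>r K. \<lbrakk>0 \<le> r; r < 1; 0 < K; \<forall>w. cmod w < 1 \<longrightarrow> szego_integral r w \<le> ennreal K\<rbrakk>
      \<Longrightarrow> truncated_carleson r (c1 + c2 * K)"
    by (rule carleson_from_embedding) (rule that; assumption)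
  \<comment> \<open>Makes \<open>c2 * b2 / M\<close> at most \<open>1 / 2\<close>, the contraction
    factor; the summand 1 keeps \<open>M\<close> positive.\<close>
  define M where "M = 2 * c2 * b2 + 1"
  have M: "0 < M" unfolding M_def using b(2) c(2) by (simp add: add_nonneg_pos)
  \<comment> \<open>Covers the parts independent of \<open>A\<close> in both regions of
    \<open>w\<close>; the summand 1 makes it positive, as the embedding asks.\<close>
  define K0 where "K0 = b1 + b1 / M + (8 * M + 2 * L\<^sup>2) * v + 1"
  have tr: "0 \<le> (8 * M + 2 * L\<^sup>2) * v" using M by simp
  have K0: "0 < K0" unfolding K0_def using b(1) M tr by (simp add: add_nonneg_pos)
  have "truncated_carleson r ((c1 + c2 * K0) + A / 2)" if r: "0 \<le> r" "r < 1" and A: "truncated_carleson r A" for r A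
  proof -
    have A0: "0 \<le> A" using A by (simp add: truncated_carleson_def)
    have bA: "0 \<le> b2 * A / M" using b(2) A0 M by simp
    have bM: "0 \<le> b1 / M" using b(1) M by simp
    have T: "truncated_carleson r (c1 + c2 * (K0 + b2 * A / M))"
    proof (rule c(3)[OF r], use K0 bA in simp, intro allI impI)
      fix w :: complex assume w: "cmod w < 1"
      show "szego_integral r w \<le> ennreal (K0 + b2 * A / M)"
      proof (cases "M * (1 - (cmod w)\<^sup>2) \<le> (cmod (p w))\<^sup>2")
        case True
        have "b1 + (b1 + b2 * A) / M \<le> K0 + b2 * A / M"
          unfolding K0_def using tr by (simp add: add_divide_distrib)
        from order_trans[OF b(3)[OF M A r(2) w True] ennreal_leI[OF this]] show ?thesis .
      next
        case False
        have "(8 * M + 2 * L\<^sup>2) * v \<le> K0 + b2 * A / M"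
          unfolding K0_def using b(1) bM bA by linarith
        from order_trans[OF L(2)[OF M w] ennreal_leI[OF this]] False show ?thesis by simp
      qed
    qed
    have le: "c1 + c2 * (K0 + b2 * A / M) \<le> (c1 + c2 * K0) + A / 2"
    proof -
      have "c2 * b2 / M \<le> 1 / 2" using M unfolding M_def by (simp add: field_simps)
      from mult_right_mono[OF this A0] show ?thesis by (simp add: algebra_simps)
    qed
    show ?thesis
      unfolding truncated_carleson_def
    proof (intro conjI ballI)
      show "0 \<le> (c1 + c2 * K0) + A / 2" using c K0 A0 by simp
      fix f assume f: "f \<in> D"
      have "(\<integral>\<^sup>+z. ennreal ((cmod (f z))\<^sup>2) * indicator (cball 0 r) z \<partial>\<nu>) \<le> ennreal ((c1 + c2 * (K0 + b2 * A / M)) * D.sqnorm f)"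
        using T f by (simp add: truncated_carleson_def)
      also have "\<dots> \<le> ennreal (((c1 + c2 * K0) + A / 2) * D.sqnorm f)"
        by (intro ennreal_leI mult_right_mono le D.sqnorm_nonneg f)
      finally show "(\<integral>\<^sup>+z. ennreal ((cmod (f z))\<^sup>2) * indicator (cball 0 r) z \<partial>\<nu>) \<le> ennreal (((c1 + c2 * K0) + A / 2) * D.sqnorm f)" .
    qed
  qed
  moreover have "0 \<le> c1 + c2 * K0" using c K0 by simp
  ultimately show ?thesis using that by blast
qed

text \<open>Iteration from the crude constant \<open>A0\<close> of a truncation gives
  \<open>2 c + A0 / 2 ^ k\<close>. The part that depends on \<open>r\<close> disappears in the
  limit, and monotone convergence over the discs removes the truncation.\<close>

lemma carleson: "carleson_measure \<mu> \<nu>"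
proof -
  obtain c where c: "0 \<le> c" "\<And>r A. \<lbrakk>0 \<le> r; r < 1; truncated_carleson r A\<rbrakk> \<Longrightarrow> truncated_carleson r (c + A / 2)"
    by (rule bootstrap_step) (rule that; assumption)
  have trunc: "(\<integral>\<^sup>+z. ennreal ((cmod (f z))\<^sup>2) * indicator (cball 0 r) z \<partial>\<nu>) \<le> ennreal (2 * c * D.sqnorm f)"
    if r: "0 \<le> r" "r < 1" and f: "f \<in> D" for r f
  proof -
    define A0 where "A0 = v / (1 - r\<^sup>2)"
    \<comment> \<open>The number \<open>2 c\<close> is the fixed point of the map
      \<open>A -> c + A / 2\<close>, so the distance to it is halved at each step.\<close>
    have step: "truncated_carleson r (2 * c + A0 / 2 ^ k)" for k
    proof (induction k)
      case 0
      have T: "truncated_carleson r A0" unfolding A0_def by (rule truncated_carleson_initial[OF r])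
      show ?case
        unfolding truncated_carleson_def
      proof (intro conjI ballI)
        show "0 \<le> 2 * c + A0 / 2 ^ 0" using T c(1) by (simp add: truncated_carleson_def)
        fix f assume f: "f \<in> D"
        have "(\<integral>\<^sup>+z. ennreal ((cmod (f z))\<^sup>2) * indicator (cball 0 r) z \<partial>\<nu>) \<le> ennreal (A0 * D.sqnorm f)"
          using T f by (simp add: truncated_carleson_def)
        also have "\<dots> \<le> ennreal ((2 * c + A0 / 2 ^ 0) * D.sqnorm f)"
          using c(1) D.sqnorm_nonneg[OF f] by (intro ennreal_leI mult_right_mono) auto
        finally show "(\<integral>\<^sup>+z. ennreal ((cmod (f z))\<^sup>2) * indicator (cball 0 r) z \<partial>\<nu>) \<le> ennreal ((2 * c + A0 / 2 ^ 0) * D.sqnorm f)" .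
      qed
    next
      case (Suc k)
      have "c + (2 * c + A0 / 2 ^ k) / 2 = 2 * c + A0 / 2 ^ Suc k" by (simp add: field_simps)
      with c(2)[OF r Suc] show ?case by simp
    qed
    have "(\<lambda>k. ennreal ((2 * c + A0 * (1 / 2) ^ k) * D.sqnorm f)) \<longlonglongrightarrow> ennreal ((2 * c + A0 * 0) * D.sqnorm f)"
      by (intro tendsto_ennrealI tendsto_intros LIMSEQ_realpow_zero) auto
    moreover have "(\<integral>\<^sup>+z. ennreal ((cmod (f z))\<^sup>2) * indicator (cball 0 r) z \<partial>\<nu>) \<le> ennreal ((2 * c + A0 * (1 / 2) ^ k) * D.sqnorm f)" for k
      using step[of k] f by (simp add: truncated_carleson_def power_divide)
    ultimately have "(\<integral>\<^sup>+z. ennreal ((cmod (f z))\<^sup>2) * indicator (cball 0 r) z \<partial>\<nu>) \<le> ennreal ((2 * c + A0 * 0) * D.sqnorm f)"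
      by (intro LIMSEQ_le_const[of _ _ "\<integral>\<^sup>+z. ennreal ((cmod (f z))\<^sup>2) * indicator (cball 0 r) z \<partial>\<nu>"]) auto
    then show ?thesis by simp
  qed
  \<comment> \<open>The summand 1 makes the constant positive even if \<open>c = 0\<close>.\<close>
  have "(\<integral>\<^sup>+z. ennreal ((cmod (f z))\<^sup>2) \<partial>\<nu>) \<le> ennreal (2 * c + 1) * dirichlet_norm_sq \<mu> f" if f: "f \<in> D" for f
  proof -
    have [measurable]: "f \<in> borel_measurable \<nu>" by (rule holomorphic_measurable[OF D_imp(1)[OF f]])
    have "(\<integral>\<^sup>+z. ennreal ((cmod (f z))\<^sup>2) \<partial>\<nu>) = (SUP m. \<integral>\<^sup>+z. ennreal ((cmod (f z))\<^sup>2) * indicator (cball 0 (1 - 1 / (real m + 2))) z \<partial>\<nu>)"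
      by (rule nn_integral_disc_exhaust[OF sets_\<sigma>]) measurable
    also have "\<dots> \<le> ennreal (2 * c * D.sqnorm f)"
      by (intro SUP_least trunc f) auto
    also have "\<dots> \<le> ennreal ((2 * c + 1) * D.sqnorm f)"
      using D.sqnorm_nonneg[OF f] by (intro ennreal_leI mult_right_mono) auto
    also have "\<dots> = ennreal (2 * c + 1) * dirichlet_norm_sq \<mu> f"
      unfolding dirichlet_norm_sq_eq[OF f] using c(1) D.sqnorm_nonneg[OF f] by (intro ennreal_mult) auto
    finally show ?thesis .
  qed
  then show ?thesis
    unfolding carleson_measure_def using c(1) by (intro exI[of _ "2 * c + 1"]) auto
qed

end

section \<open>The reproducing kernel thesis\<close>

text \<open>Almost everywhere the integrand is a finite combination of indicators of points.\<close>

lemma integral_finite_support: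
  fixes f :: "complex \<Rightarrow> real"
  assumes "finite_measure M" and fin: "finite S" and S: "\<And>x. x \<in> S \<Longrightarrow> {x} \<in> sets M"
    and null: "emeasure M (space M - S) = 0" and f: "f \<in> borel_measurable M"
  shows "(\<integral>x. f x \<partial>M) = (\<Sum>x\<in>S. f x * measure M {x})"
proof -
  interpret finite_measure M by fact
  have SM: "S \<in> sets M" using fin S by (subst UN_singleton[symmetric]) (intro sets.finite_UN, auto)
  have "AE x in M. x \<in> S"
    using null SM by (intro AE_I[of _ _ "space M - S"]) auto
  then have ae: "AE x in M. f x = (\<Sum>y\<in>S. f y * indicator {y} x)"
  proof eventually_elim
    case (elim x)
    have "(\<Sum>y\<in>S. f y * indicator {y} x) = (\<Sum>y\<in>S. if y = x then f y else 0)"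
      by (intro sum.cong refl) (auto simp: indicator_def)
    then show ?case using elim fin by simp
  qed
  have im: "(\<lambda>x. f y * indicator {y} x) \<in> borel_measurable M" if "y \<in> S" for y
    using S[OF that] by (intro borel_measurable_times borel_measurable_const borel_measurable_indicator)
  have "(\<integral>x. f x \<partial>M) = (\<integral>x. (\<Sum>y\<in>S. f y * indicator {y} x) \<partial>M)"
    by (rule integral_cong_AE[OF f _ ae]) (intro borel_measurable_sum im)
  also have "\<dots> = (\<Sum>y\<in>S. (\<integral>x. f y * indicator {y} x \<partial>M))"
    using S by (intro Bochner_Integration.integral_sum integrable_mult_right integrable_real_indicator)
      (auto simp: emeasure_eq_measure)
  also have "\<dots> = (\<Sum>y\<in>S. f y * measure M {y})"
  proof (intro sum.cong refl)
    fix y assume "y \<in> S"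
    then have "{y} \<inter> space M = {y}" using sets.sets_into_space[OF S] by auto
    then show "(\<integral>x. f y * indicator {y} x \<partial>M) = f y * measure M {y}"
      by simp
  qed
  finally show ?thesis .
qed

text \<open>The weight of a point is its full mass, the sum of all \<open>\<alpha> j\<close> with
  \<open>lam j\<close> equal to it, so repetitions in the family are harmless.\<close>

lemma atomic_circle_measure_atomic_dirichlet:
  assumes n: "n \<ge> 1" and lam: "\<And>j. j \<in> {1..n} \<Longrightarrow> lam j \<in> sphere 0 1"
    and \<alpha>: "\<And>j. j \<in> {1..n} \<Longrightarrow> \<alpha> j > 0"
  shows "atomic_dirichlet (atomic_circle_measure n \<alpha> lam) (lam ` {1..n}) (\<lambda>l. measure (atomic_circle_measure n \<alpha> lam) {l})"
proof -
  let ?M = "atomic_circle_measure n \<alpha> lam"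
  have em: "emeasure ?M A = (\<Sum>j=1..n. ennreal (\<alpha> j) * indicator A (lam j))" if "A \<in> sets circle_borel" for A
    unfolding emeasure_atomic_circle_measure[OF that]
    using that by (intro sum.cong refl) (simp add: emeasure_return)
  have sp: "space ?M = sphere 0 1"
    using sets_eq_imp_space_eq[OF sets_atomic_circle_measure[of n \<alpha> lam]] by (simp add: space_restrict_space)
  have fin: "finite_measure ?M"
  proof (rule finite_measureI)
    have "sphere 0 1 \<in> sets circle_borel" by (simp add: sets_restrict_space_iff)
    from em[OF this] show "emeasure ?M (space ?M) \<noteq> \<infinity>"
      unfolding sp by (simp add: ennreal_mult_eq_top_iff indicator_def)
  qed
  then interpret finite_measure ?M .
  have sing: "{l} \<in> sets circle_borel" if "l \<in> sphere 0 1" for l :: complex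
    using that by (simp add: sets_restrict_space_iff)
  have Lam: "lam ` {1..n} \<subseteq> sphere 0 1" using lam by blast
  have pos: "0 < measure ?M {l}" if l: "l \<in> lam ` {1..n}" for l
  proof -
    obtain j where j: "j \<in> {1..n}" "l = lam j" using l by blast
    have "0 < ennreal (\<alpha> j) * indicator {l} (lam j)" using \<alpha>[OF j(1)] j(2) by simp
    also have "\<dots> \<le> (\<Sum>j=1..n. ennreal (\<alpha> j) * indicator {l} (lam j))"
      using j(1) by (intro member_le_sum) auto
    also have "\<dots> = emeasure ?M {l}" using l Lam by (intro em[symmetric] sing) auto
    finally show ?thesis by (simp add: emeasure_eq_measure)
  qed
  show ?thesis
  proof
    show "finite (lam ` {1..n})" by simp
    show "lam ` {1..n} \<noteq> {}" using n by simp
    show "cmod l = 1" if "l \<in> lam ` {1..n}" for l using that Lam by auto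
    show "0 < measure ?M {l}" if "l \<in> lam ` {1..n}" for l by (rule pos[OF that])
    fix z :: complex assume z: "cmod z < 1"
    have "poisson ?M z = (\<Sum>l\<in>lam ` {1..n}. (1 - (cmod z)\<^sup>2) / (cmod (l - z))\<^sup>2 * measure ?M {l})"
      unfolding poisson_def
    proof (rule integral_finite_support[OF fin])
      show "{l} \<in> sets ?M" if "l \<in> lam ` {1..n}" for l
        using that Lam sing by auto
      have "sphere 0 1 - lam ` {1..n} \<in> sets circle_borel"
        using borel_closed[OF closed_sphere] borel_closed[OF finite_imp_closed[of "lam ` {1..n}"]]
        by (auto simp: sets_restrict_space_iff)
      from em[OF this] show "emeasure ?M (space ?M - lam ` {1..n}) = 0"
        unfolding sp by simp
      show "(\<lambda>l. (1 - (cmod z)\<^sup>2) / (cmod (l - z))\<^sup>2) \<in> borel_measurable ?M"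
        by (subst measurable_cong_sets[OF sets_atomic_circle_measure refl])
          (intro measurable_restrict_space1, measurable)
    qed simp
    then show "poisson ?M z = (\<Sum>l\<in>lam ` {1..n}. measure ?M {l} * ((1 - (cmod z)\<^sup>2) / (cmod (l - z))\<^sup>2))"
      by (simp add: mult.commute)
  qed
qed

theorem theorem6p1:
  fixes \<nu> \<mu> :: "complex measure" and n :: nat
    and \<alpha> :: "nat \<Rightarrow> real" and lam :: "nat \<Rightarrow> complex"
  assumes "finite_measure \<nu>" and "sets \<nu> = sets disc_borel"
    and "n \<ge> 1"
    and "\<And>j. j \<in> {1..n} \<Longrightarrow> lam j \<in> sphere 0 1"
    and "\<And>j. j \<in> {1..n} \<Longrightarrow> \<alpha> j > 0"
    and "\<mu> = atomic_circle_measure n \<alpha> lam"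
  shows "carleson_measure \<mu> \<nu> \<longleftrightarrow>
    (\<exists>C::real. C > 0 \<and>
       (\<forall>w\<in>unit_disc.
          (\<integral>\<^sup>+z. ennreal ((cmod (repr_kernel \<mu> w z))\<^sup>2) \<partial>\<nu>)
            \<le> ennreal C * dirichlet_norm_sq \<mu> (repr_kernel \<mu> w)))"
proof -
  interpret atomic_dirichlet \<mu> "lam ` {1..n}" "\<lambda>l. measure \<mu> {l}"
    unfolding assms(6) by (rule atomic_circle_measure_atomic_dirichlet[OF assms(3-5)])
  show ?thesis
  proof
    \<comment> \<open>The kernels belong to the space, so they are admissible in the Carleson
      inequality.\<close>
    assume "carleson_measure \<mu> \<nu>"
    then show "\<exists>C::real. C > 0 \<and> (\<forall>w\<in>unit_disc. (\<integral>\<^sup>+z. ennreal ((cmod (ker w z))\<^sup>2) \<partial>\<nu>)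
            \<le> ennreal C * dirichlet_norm_sq \<mu> (ker w))"
      unfolding carleson_measure_def using ker(1) by (meson mem_ball_0)
  next
    assume "\<exists>C::real. C > 0 \<and> (\<forall>w\<in>unit_disc. (\<integral>\<^sup>+z. ennreal ((cmod (ker w z))\<^sup>2) \<partial>\<nu>)
            \<le> ennreal C * dirichlet_norm_sq \<mu> (ker w))"
    then obtain C where C: "0 < C" "\<forall>w\<in>unit_disc. (\<integral>\<^sup>+z. ennreal ((cmod (ker w z))\<^sup>2) \<partial>\<nu>)
            \<le> ennreal C * dirichlet_norm_sq \<mu> (ker w)" by blast
    interpret finite_measure \<nu> by (rule assms(1))
    interpret kernel_carleson \<mu> "lam ` {1..n}" "\<lambda>l. measure \<mu> {l}" \<nu> C
      by unfold_locales (use C assms(2) in auto)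
    show "carleson_measure \<mu> \<nu>" by (rule carleson)
  qed
qed

end
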